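(* Let $(R,\mathfrak m)$ be a Noetherian local ring with infinite residue field $k$, let $S=R[z_1,\ldots,z_t]$ be a polynomial ring over $R$, let $M$ be a finitely generated $R$-module, and set $M'=M\otimes_RS$. Let $N'\subseteq M'$ be an $S$-submodule such that $\lambda_{S_{\mathfrak mS}}(M'_{\mathfrak mS}/N'_{\mathfrak mS})=\delta$ (a finite number). Then: (a) for a general vector $\underline\alpha\in R^t$, $\lambda_R(M/N'_{\underline\alpha})=\delta$. (b) Assume $R$ is equicharacteristic and fix any vector $\underline{\alpha_0}\in R^t$. Then for a general vector $\underline\alpha\in R^t$, $\delta=\lambda_R(M/N'_{\underline\alpha})\leq\lambda_R(M/N'_{\underline{\alpha_0}})$.
   Context: $\lambda$ denotes length (possibly $\infty$). For a finitely generated $S$-module $L$ with free presentation $S^f\to S^g\to L\to0$ given by a matrix $(a_{ij}[\underline z])$ and a vector $\underline\alpha\in R^t$, the specialization $L_{\underline\alpha}$ is the cokernel of the map $R^f\to R^g$ given by $(a_{ij}[\underline\alpha])$; it is independent of the presentation, and equals $L\otimes_SS/(z_1-\alpha_1,\ldots,z_t-\alpha_t)$. In particular $M'_{\underline\alpha}=M$. In the quotient $M/N'_{\underline\alpha}$, the specialization $N'_{\underline\alpha}$ is regarded as a submodule of $M$, namely through its image under the natural map $N'_{\underline\alpha}\to M'_{\underline\alpha}=M$; thus $M/N'_{\underline\alpha}=(M'/N')\otimes_SS/(\underline z-\underline\alpha)$. A property holds for a general vector $\underline\alpha\in R^t$ if there is a dense Zariski open subset $U\subseteq k^t$ such that it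 holds for all $\underline\alpha\in R^t$ whose image in $k^t$ lies in $U$. *)

theory Defs
  imports "HOL-Analysis.Abstract_Topology" "HOL-Algebra.Algebra" "HOL-Library.Extended_Nat"
begin

section \<open>Modules\<close>

text \<open>
  The record \<^typ>\<open>('a, 'b) module\<close> extends the ring record, so modules have fields
  \<open>mult\<close> and \<open>one\<close> that play no role; they are left unspecified below.
\<close>

definition finitely_generated_module ::
    "('a, 'r) ring_scheme \<Rightarrow> ('a, 'b, 'm) module_scheme \<Rightarrow> bool" where
  "finitely_generated_module R M \<longleftrightarrow>
     (\<exists>G. finite G \<and> G \<subseteq> carrier M \<and>
          (\<forall>H. submodule H R M \<and> G \<subseteq> H \<longrightarrow> H = carrier M))"

definition module_length ::
    "('a, 'r) ring_scheme \<Rightarrow> ('a, 'b, 'm) module_scheme \<Rightarrow> enat" where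
  "module_length R M =
     (SUP n \<in> {n. \<exists>C. (\<forall>i\<le>n. submodule (C i) R M) \<and> (\<forall>i<n. C i \<subset> C (Suc i))}. enat n)"

definition quot_module :: "('a, 'b, 'm) module_scheme \<Rightarrow> 'b set \<Rightarrow> ('a, 'b set) module" where
  "quot_module M N =
     \<lparr>carrier = a_rcosets\<^bsub>M\<^esub> N,
      monoid.mult = undefined, one = undefined,
      ring.zero = N,
      ring.add = set_add M,
      smult = (\<lambda>a C. \<Union>x\<in>C. N +>\<^bsub>M\<^esub> (a \<odot>\<^bsub>M\<^esub> x))\<rparr>"

definition restrict_scalars ::
    "('a \<Rightarrow> 'c) \<Rightarrow> ('c, 'b, 'm) module_scheme \<Rightarrow> ('a, 'b) module" where
  "restrict_scalars \<phi> L =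
     \<lparr>carrier = carrier L,
      monoid.mult = undefined, one = undefined,
      ring.zero = \<zero>\<^bsub>L\<^esub>,
      ring.add = (\<lambda>x y. x \<oplus>\<^bsub>L\<^esub> y),
      smult = (\<lambda>a x. \<phi> a \<odot>\<^bsub>L\<^esub> x)\<rparr>"


section \<open>Tensor products: base change along a ring homomorphism\<close>

text \<open>
  For a homomorphism \<open>\<phi>\<close> from \<open>A\<close> to \<open>B\<close> and an \<open>A\<close>-module \<open>L\<close>, the tensor product of \<open>L\<close>
  and \<open>B\<close> over \<open>A\<close> is the free abelian group on pairs \<open>(x, b)\<close> modulo the subgroup generated
  by the bilinearity and balancing relations. It is a \<open>B\<close>-module via the factor \<open>B\<close>.
\<close>

definition tensor_free ::
    "('c, 'q) ring_scheme \<Rightarrow> ('a, 'b, 'm) module_scheme \<Rightarrow> ('b \<times> 'c \<Rightarrow>\<^sub>0 int) monoid" where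
  "tensor_free B L = free_Abelian_group (carrier L \<times> carrier B)"

definition tensor_rels ::
    "('a, 'r) ring_scheme \<Rightarrow> ('c, 'q) ring_scheme \<Rightarrow> ('a \<Rightarrow> 'c) \<Rightarrow> ('a, 'b, 'm) module_scheme
      \<Rightarrow> ('b \<times> 'c \<Rightarrow>\<^sub>0 int) set" where
  "tensor_rels A B \<phi> L = generate (tensor_free B L)
     ({frag_of (x \<oplus>\<^bsub>L\<^esub> y, b) - frag_of (x, b) - frag_of (y, b) | x y b.
         x \<in> carrier L \<and> y \<in> carrier L \<and> b \<in> carrier B} \<union>
      {frag_of (x, b \<oplus>\<^bsub>B\<^esub> c) - frag_of (x, b) - frag_of (x, c) | x b c.
         x \<in> carrier L \<and> b \<in> carrier B \<and> c \<in> carrier B} \<union>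
      {frag_of (a \<odot>\<^bsub>L\<^esub> x, b) - frag_of (x, \<phi> a \<otimes>\<^bsub>B\<^esub> b) | a x b.
         a \<in> carrier A \<and> x \<in> carrier L \<and> b \<in> carrier B})"

definition base_change ::
    "('a, 'r) ring_scheme \<Rightarrow> ('c, 'q) ring_scheme \<Rightarrow> ('a \<Rightarrow> 'c) \<Rightarrow> ('a, 'b, 'm) module_scheme
      \<Rightarrow> ('c, ('b \<times> 'c \<Rightarrow>\<^sub>0 int) set) module" where
  "base_change A B \<phi> L =
     \<lparr>carrier = rcosets\<^bsub>tensor_free B L\<^esub> tensor_rels A B \<phi> L,
      monoid.mult = undefined, one = undefined,
      ring.zero = tensor_rels A B \<phi> L,
      ring.add = (\<lambda>C D. C <#>\<^bsub>tensor_free B L\<^esub> D),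
      smult = (\<lambda>b C. \<Union>c\<in>C. tensor_rels A B \<phi> L #>\<^bsub>tensor_free B L\<^esub>
                 frag_extend (\<lambda>(x, b'). frag_of (x, b \<otimes>\<^bsub>B\<^esub> b')) c)\<rparr>"

definition pure_tensor ::
    "('a, 'r) ring_scheme \<Rightarrow> ('c, 'q) ring_scheme \<Rightarrow> ('a \<Rightarrow> 'c) \<Rightarrow> ('a, 'b, 'm) module_scheme
      \<Rightarrow> 'b \<Rightarrow> 'c \<Rightarrow> ('b \<times> 'c \<Rightarrow>\<^sub>0 int) set" where
  "pure_tensor A B \<phi> L x b = tensor_rels A B \<phi> L #>\<^bsub>tensor_free B L\<^esub> frag_of (x, b)"

text \<open>The map of base changes induced by an \<open>A\<close>-linear map \<open>h\<close> into \<open>L\<close>.\<close>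

definition base_change_map ::
    "('a, 'r) ring_scheme \<Rightarrow> ('c, 'q) ring_scheme \<Rightarrow> ('a \<Rightarrow> 'c) \<Rightarrow> ('a, 'b, 'm) module_scheme
      \<Rightarrow> ('d \<Rightarrow> 'b) \<Rightarrow> ('d \<times> 'c \<Rightarrow>\<^sub>0 int) set \<Rightarrow> ('b \<times> 'c \<Rightarrow>\<^sub>0 int) set" where
  "base_change_map A B \<phi> L h C =
     (\<Union>c\<in>C. tensor_rels A B \<phi> L #>\<^bsub>tensor_free B L\<^esub>
        frag_extend (\<lambda>(x, b). frag_of (h x, b)) c)"


section \<open>Localization\<close>

definition mod_frac ::
    "('a, 'r) ring_scheme \<Rightarrow> 'a set \<Rightarrow> ('a, 'b, 'm) module_scheme \<Rightarrow> 'b \<Rightarrow> 'a \<Rightarrow> ('b \<times> 'a) set" where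
  "mod_frac A W L x s =
     {(y, t). y \<in> carrier L \<and> t \<in> W \<and>
        (\<exists>u\<in>W. u \<odot>\<^bsub>L\<^esub> (t \<odot>\<^bsub>L\<^esub> x) = u \<odot>\<^bsub>L\<^esub> (s \<odot>\<^bsub>L\<^esub> y))}"

definition ring_frac ::
    "('a, 'r) ring_scheme \<Rightarrow> 'a set \<Rightarrow> 'a \<Rightarrow> 'a \<Rightarrow> ('a \<times> 'a) set" where
  "ring_frac A W a s =
     {(b, t). b \<in> carrier A \<and> t \<in> W \<and>
        (\<exists>u\<in>W. u \<otimes>\<^bsub>A\<^esub> (t \<otimes>\<^bsub>A\<^esub> a) = u \<otimes>\<^bsub>A\<^esub> (s \<otimes>\<^bsub>A\<^esub> b))}"

definition localized_ring :: "('a, 'r) ring_scheme \<Rightarrow> 'a set \<Rightarrow> ('a \<times> 'a) set ring" where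
  "localized_ring A P =
     (let W = carrier A - P in
      \<lparr>carrier = {ring_frac A W a s | a s. a \<in> carrier A \<and> s \<in> W},
       monoid.mult = (\<lambda>C D. \<Union>(a, s)\<in>C. \<Union>(b, t)\<in>D. ring_frac A W (a \<otimes>\<^bsub>A\<^esub> b) (s \<otimes>\<^bsub>A\<^esub> t)),
       one = ring_frac A W \<one>\<^bsub>A\<^esub> \<one>\<^bsub>A\<^esub>,
       ring.zero = ring_frac A W \<zero>\<^bsub>A\<^esub> \<one>\<^bsub>A\<^esub>,
       ring.add = (\<lambda>C D. \<Union>(a, s)\<in>C. \<Union>(b, t)\<in>D.
                ring_frac A W (t \<otimes>\<^bsub>A\<^esub> a \<oplus>\<^bsub>A\<^esub> s \<otimes>\<^bsub>A\<^esub> b) (s \<otimes>\<^bsub>A\<^esub> t))\<rparr>)"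

definition localized_module ::
    "('a, 'r) ring_scheme \<Rightarrow> 'a set \<Rightarrow> ('a, 'b, 'm) module_scheme
      \<Rightarrow> (('a \<times> 'a) set, ('b \<times> 'a) set) module" where
  "localized_module A P L =
     (let W = carrier A - P in
      \<lparr>carrier = {mod_frac A W L x s | x s. x \<in> carrier L \<and> s \<in> W},
       monoid.mult = undefined, one = undefined,
       ring.zero = mod_frac A W L \<zero>\<^bsub>L\<^esub> \<one>\<^bsub>A\<^esub>,
       ring.add = (\<lambda>C D. \<Union>(x, s)\<in>C. \<Union>(y, t)\<in>D.
                mod_frac A W L (t \<odot>\<^bsub>L\<^esub> x \<oplus>\<^bsub>L\<^esub> s \<odot>\<^bsub>L\<^esub> y) (s \<otimes>\<^bsub>A\<^esub> t)),
       smult = (\<lambda>C D. \<Union>(a, s)\<in>C. \<Union>(y, t)\<in>D. mod_frac A W L (a \<odot>\<^bsub>L\<^esub> y) (s \<otimes>\<^bsub>A\<^esub> t))\<rparr>)"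

text \<open>The localization of a submodule \<open>N\<close> of \<open>L\<close>, as a submodule of the localization of \<open>L\<close>.\<close>

definition localized_submodule ::
    "('a, 'r) ring_scheme \<Rightarrow> 'a set \<Rightarrow> ('a, 'b, 'm) module_scheme \<Rightarrow> 'b set \<Rightarrow> ('b \<times> 'a) set set" where
  "localized_submodule A P L N =
     {mod_frac A (carrier A - P) L n s | n s. n \<in> N \<and> s \<in> carrier A - P}"


section \<open>Local rings and polynomial rings\<close>

locale noetherian_local_ring =
  cring R + noetherian_ring R + maximalideal \<mm> R for \<mm> and R (structure) +
  assumes unique_maximalideal: "\<And>J. maximalideal J R \<Longrightarrow> J = \<mm>"

text \<open>The additive order of \<open>1\<close>; \<^const>\<open>group.ord\<close> is \<open>0\<close> on elements of infinite order.\<close>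

definition ring_char :: "('a, 'r) ring_scheme \<Rightarrow> nat" where
  "ring_char R = group.ord (add_monoid R) \<one>\<^bsub>R\<^esub>"

definition equicharacteristic :: "('a, 'r) ring_scheme \<Rightarrow> 'a set \<Rightarrow> bool" where
  "equicharacteristic R \<mm> \<longleftrightarrow> ring_char R = ring_char (R Quot \<mm>)"

text \<open>
  Polynomials in \<open>z\<^sub>0, \<dots>, z\<^sub>t\<^sub>-\<^sub>1\<close>: coefficient functions on monomials (multisets of
  variable indices), on top of \<^theory>\<open>HOL-Algebra.Indexed_Polynomials\<close>, with the
  convolution product.
\<close>

abbreviation mpoly_const :: "('a, 'r) ring_scheme \<Rightarrow> 'a \<Rightarrow> (nat multiset \<Rightarrow> 'a)" where
  "mpoly_const R \<equiv> ring.indexed_const R"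

definition mpoly_ring :: "('a, 'r) ring_scheme \<Rightarrow> nat \<Rightarrow> (nat multiset \<Rightarrow> 'a) ring" where
  "mpoly_ring R t =
     \<lparr>carrier = ring.indexed_pset R {..<t} (carrier R),
      monoid.mult = (\<lambda>p q m. \<Oplus>\<^bsub>R\<^esub>a\<in>{a. a \<subseteq># m}. p a \<otimes>\<^bsub>R\<^esub> q (m - a)),
      one = mpoly_const R \<one>\<^bsub>R\<^esub>,
      ring.zero = mpoly_const R \<zero>\<^bsub>R\<^esub>,
      ring.add = ring.indexed_padd R\<rparr>"

definition mpoly_eval ::
    "('a, 'r) ring_scheme \<Rightarrow> nat \<Rightarrow> (nat \<Rightarrow> 'a) \<Rightarrow> (nat multiset \<Rightarrow> 'a) \<Rightarrow> 'a" where
  "mpoly_eval R t x p =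
     (\<Oplus>\<^bsub>R\<^esub>m\<in>{m. p m \<noteq> \<zero>\<^bsub>R\<^esub>}. p m \<otimes>\<^bsub>R\<^esub> (\<Otimes>\<^bsub>R\<^esub>i\<in>{..<t}. x i [^]\<^bsub>R\<^esub> count m i))"

text \<open>For an ideal \<open>I\<close> of \<open>R\<close>, the ideal \<open>IS\<close> of \<open>S = R[z]\<close>.\<close>

definition extended_ideal ::
    "('a, 'r) ring_scheme \<Rightarrow> nat \<Rightarrow> 'a set \<Rightarrow> (nat multiset \<Rightarrow> 'a) set" where
  "extended_ideal R t I = Idl\<^bsub>mpoly_ring R t\<^esub> (mpoly_const R ` I)"

definition poly_module ::
    "('a, 'r) ring_scheme \<Rightarrow> nat \<Rightarrow> ('a, 'b, 'm) module_scheme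
      \<Rightarrow> (nat multiset \<Rightarrow> 'a, ('b \<times> (nat multiset \<Rightarrow> 'a) \<Rightarrow>\<^sub>0 int) set) module" where
  "poly_module R t M = base_change R (mpoly_ring R t) (mpoly_const R) M"


section \<open>Specialization\<close>

definition vectors :: "('a, 'r) ring_scheme \<Rightarrow> nat \<Rightarrow> (nat \<Rightarrow> 'a) set" where
  "vectors R t = {..<t} \<rightarrow>\<^sub>E carrier R"

definition point_ideal ::
    "('a, 'r) ring_scheme \<Rightarrow> nat \<Rightarrow> (nat \<Rightarrow> 'a) \<Rightarrow> (nat multiset \<Rightarrow> 'a) set" where
  "point_ideal R t \<alpha> = Idl\<^bsub>mpoly_ring R t\<^esub>
     {ring.indexed_var R i \<ominus>\<^bsub>mpoly_ring R t\<^esub> mpoly_const R (\<alpha> i) | i. i < t}"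

abbreviation point_ring ::
    "('a, 'r) ring_scheme \<Rightarrow> nat \<Rightarrow> (nat \<Rightarrow> 'a) \<Rightarrow> (nat multiset \<Rightarrow> 'a) set ring" where
  "point_ring R t \<alpha> \<equiv> mpoly_ring R t Quot point_ideal R t \<alpha>"

abbreviation point_proj ::
    "('a, 'r) ring_scheme \<Rightarrow> nat \<Rightarrow> (nat \<Rightarrow> 'a) \<Rightarrow> (nat multiset \<Rightarrow> 'a) \<Rightarrow> (nat multiset \<Rightarrow> 'a) set" where
  "point_proj R t \<alpha> \<equiv> (\<lambda>p. point_ideal R t \<alpha> +>\<^bsub>mpoly_ring R t\<^esub> p)"

text \<open>
  The specialization of an \<open>S\<close>-module \<open>L\<close> at \<open>\<alpha>\<close> is its tensor product with \<open>S/(z - \<alpha>)\<close>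
  over \<open>S\<close>, with scalars restricted to \<open>R\<close>.
\<close>

definition specialization ::
    "('a, 'r) ring_scheme \<Rightarrow> nat \<Rightarrow> (nat \<Rightarrow> 'a) \<Rightarrow> (nat multiset \<Rightarrow> 'a, 'b, 'm) module_scheme
      \<Rightarrow> ('a, ('b \<times> (nat multiset \<Rightarrow> 'a) set \<Rightarrow>\<^sub>0 int) set) module" where
  "specialization R t \<alpha> L =
     restrict_scalars (\<lambda>r. point_proj R t \<alpha> (mpoly_const R r))
       (base_change (mpoly_ring R t) (point_ring R t \<alpha>) (point_proj R t \<alpha>) L)"

definition specialization_map ::
    "('a, 'r) ring_scheme \<Rightarrow> nat \<Rightarrow> (nat \<Rightarrow> 'a) \<Rightarrow> (nat multiset \<Rightarrow> 'a, 'b, 'm) module_scheme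
      \<Rightarrow> ('d \<Rightarrow> 'b) \<Rightarrow> ('d \<times> (nat multiset \<Rightarrow> 'a) set \<Rightarrow>\<^sub>0 int) set
      \<Rightarrow> ('b \<times> (nat multiset \<Rightarrow> 'a) set \<Rightarrow>\<^sub>0 int) set" where
  "specialization_map R t \<alpha> L h =
     base_change_map (mpoly_ring R t) (point_ring R t \<alpha>) (point_proj R t \<alpha>) L h"

text \<open>
  The canonical isomorphism from \<open>M\<close> to the specialization of \<open>M' = poly_module R t M\<close>,
  sending \<open>x\<close> to the pure tensor of \<open>x\<close>, \<open>1\<close> and \<open>1\<close>.
\<close>

definition specialization_iso ::
    "('a, 'r) ring_scheme \<Rightarrow> nat \<Rightarrow> (nat \<Rightarrow> 'a) \<Rightarrow> ('a, 'b, 'm) module_scheme \<Rightarrow> 'b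
      \<Rightarrow> (('b \<times> (nat multiset \<Rightarrow> 'a) \<Rightarrow>\<^sub>0 int) set \<times> (nat multiset \<Rightarrow> 'a) set \<Rightarrow>\<^sub>0 int) set" where
  "specialization_iso R t \<alpha> M x =
     pure_tensor (mpoly_ring R t) (point_ring R t \<alpha>) (point_proj R t \<alpha>) (poly_module R t M)
       (pure_tensor R (mpoly_ring R t) (mpoly_const R) M x \<one>\<^bsub>mpoly_ring R t\<^esub>)
       \<one>\<^bsub>point_ring R t \<alpha>\<^esub>"

text \<open>
  The image in \<open>M\<close> of the specialization of an \<open>S\<close>-submodule \<open>N'\<close> of \<open>M'\<close>, under the map
  induced by the inclusion followed by the inverse of the canonical isomorphism above.
\<close>

definition specialized_submodule ::
    "('a, 'r) ring_scheme \<Rightarrow> nat \<Rightarrow> (nat \<Rightarrow> 'a) \<Rightarrow> ('a, 'b, 'm) module_scheme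
      \<Rightarrow> ('b \<times> (nat multiset \<Rightarrow> 'a) \<Rightarrow>\<^sub>0 int) set set \<Rightarrow> 'b set" where
  "specialized_submodule R t \<alpha> M N' =
     {x \<in> carrier M. specialization_iso R t \<alpha> M x
        \<in> specialization_map R t \<alpha> (poly_module R t M) (\<lambda>n. n) `
            carrier (specialization R t \<alpha> (poly_module R t M\<lparr>carrier := N'\<rparr>))}"


section \<open>General vectors\<close>

definition zariski_topology :: "('a, 'r) ring_scheme \<Rightarrow> nat \<Rightarrow> (nat \<Rightarrow> 'a) topology" where
  "zariski_topology k t = topology_generated_by
     {{x \<in> vectors k t. \<not> (\<forall>f\<in>F. mpoly_eval k t x f = \<zero>\<^bsub>k\<^esub>)} | F. F \<subseteq> carrier (mpoly_ring k t)}"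

definition residue_vector ::
    "('a, 'r) ring_scheme \<Rightarrow> 'a set \<Rightarrow> nat \<Rightarrow> (nat \<Rightarrow> 'a) \<Rightarrow> (nat \<Rightarrow> 'a set)" where
  "residue_vector R \<mm> t \<alpha> = (\<lambda>i\<in>{..<t}. \<mm> +>\<^bsub>R\<^esub> \<alpha> i)"

definition general_vector ::
    "('a, 'r) ring_scheme \<Rightarrow> 'a set \<Rightarrow> nat \<Rightarrow> ((nat \<Rightarrow> 'a) \<Rightarrow> bool) \<Rightarrow> bool" where
  "general_vector R \<mm> t P \<longleftrightarrow>
     (\<exists>U. openin (zariski_topology (R Quot \<mm>) t) U \<and>
          zariski_topology (R Quot \<mm>) t closure_of U = vectors (R Quot \<mm>) t \<and>
          (\<forall>\<alpha>\<in>vectors R t. residue_vector R \<mm> t \<alpha> \<in> U \<longrightarrow> P \<alpha>))"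

end

(*
  Let W be the complement of mS in S. Chains of submodules of M'_mS / N'_mS correspond to chains of
  W-saturated submodules of M' above N'. The specialization N'_alpha is the image of N' under the
  evaluation map M' -> M at z = alpha, whose kernel is (z - alpha) M'.

  Upper bound, for general alpha: lift a composition series of the localization to elements
  x_1, ..., x_delta of M'. The relations saying that each factor is killed by m and that the series
  exhausts M' hold after multiplication by a single f in W, so they survive evaluation wherever
  f(alpha) is a unit, and give a series of M / N'_alpha with at most delta simple factors.

  Lower bound, for every alpha: pass from the generic point mS to the closed point (m, z - alpha)
  through the primes mS + (z_1 - alpha_1, ..., z_i - alpha_i), one variable at a time. If z lies
  outside a prime p and inside a larger prime q, then the length of L_p is at most that of (L/zL)_q:
  the top factor of a p-saturated chain has no z-torsion, so it splits off exactly modulo z, and it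
  stays nonzero by Nakayama's lemma, which is where Hilbert's basis theorem for M' enters.
*)
theory Submission
  imports Defs
begin

section \<open>Polynomial rings\<close>

text \<open>The argument stays outside the localized rings: a finite length \<delta> means that some
  chain with \<delta> steps exists above N' and none with \<delta> + 1, and both halves become
  statements about submodules of M' and a set of denominators. A prime between the generic and the
  closed point enters only through its complement, described by values: f is in
  \<open>nonvan i \<alpha>\<close> if f is nonzero modulo \<mm> at some point that agrees with
  \<alpha> in the first i coordinates. Three facts rest on counting roots modulo \<mm> along a line,
  and hence on the infinite residue field: these sets are multiplicatively closed,
  \<open>nonvan 0 \<alpha>\<close> is the complement of \<mm>S, and a nonempty basic open set is
  dense. Variables are removed singly because z_i - \<alpha>_i has two roles: it must be a
  denominator before the step, to exclude torsion, and lie in the Jacobson radical after it, for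
  Nakayama's lemma. A single f suffices for the upper bound because \<mm> and M are finitely
  generated. As the lower bound holds at every vector, (b) compares it at \<alpha>_0 with the
  equality at general \<alpha>.\<close>

definition (in ring) conv :: "('c multiset \<Rightarrow> 'a) \<Rightarrow> ('c multiset \<Rightarrow> 'a) \<Rightarrow> ('c multiset \<Rightarrow> 'a)" where
  "conv p q = (\<lambda>m. \<Oplus>a\<in>{a. a \<subseteq># m}. p a \<otimes> q (m - a))"

lemma finite_submultisets: "finite {a. a \<subseteq># m}"
proof (induction m)
  case (add x m)
  have "{a. a \<subseteq># add_mset x m} \<subseteq> {a. a \<subseteq># m} \<union> add_mset x ` {a. a \<subseteq># m}"
  proof
    fix a assume a: "a \<in> {a. a \<subseteq># add_mset x m}"
    show "a \<in> {a. a \<subseteq># m} \<union> add_mset x ` {a. a \<subseteq># m}"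
    proof (cases "x \<in># a")
      case True
      then obtain b where "a = add_mset x b" by (metis mset_add)
      with a show ?thesis by auto
    next
      case False
      have "count a y \<le> count m y" for y
      proof (cases "y = x")
        case True
        with False show ?thesis by (simp add: not_in_iff)
      next
        case False
        with a mset_subset_eq_count[of a "add_mset x m" y] show ?thesis by simp
      qed
      then show ?thesis by (simp add: mset_subset_eqI)
    qed
  qed
  then show ?case using add finite_subset by blast
qed auto

section \<open>Convolution of coefficient functions and the ring axioms\<close>

context cring
begin

lemma conv_closed:
  assumes "carrier_coeff p" "carrier_coeff q" shows "carrier_coeff (conv p q)"
  unfolding carrier_coeff_def conv_def
  using assms by (auto intro!: finsum_closed simp: carrier_coeff_def)

text \<open>Taking complements in \<open>m\<close> is an involution of the submultisets of
  \<open>m\<close>, and it swaps the two factors of every summand.\<close>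

lemma conv_comm:
  fixes p q :: "'c multiset \<Rightarrow> 'a"
  assumes "carrier_coeff p" "carrier_coeff q" shows "conv p q = conv q p"
proof
  fix m :: "'c multiset"
  let ?A = "{a. a \<subseteq># m}"
  have img: "(\<lambda>a. m - a) ` ?A = ?A"
  proof
    show "?A \<subseteq> (\<lambda>a. m - a) ` ?A"
    proof
      fix a assume "a \<in> ?A"
      then have "a = m - (m - a)" "m - a \<in> ?A" by (auto simp: subset_mset.diff_diff_right)
      then show "a \<in> (\<lambda>a. m - a) ` ?A" by blast
    qed
  qed auto
  have inj: "inj_on (\<lambda>a. m - a) ?A"
    by (rule inj_on_inverseI[where g = "\<lambda>a. m - a"]) (auto simp: subset_mset.diff_diff_right)
  have "conv p q m = (\<Oplus>a\<in>(\<lambda>a. m - a) ` ?A. p a \<otimes> q (m - a))"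
    unfolding conv_def img ..
  also have "\<dots> = (\<Oplus>a\<in>?A. p (m - a) \<otimes> q (m - (m - a)))"
    by (rule finsum_reindex[OF _ inj]) (use assms in \<open>auto simp: carrier_coeff_def\<close>)
  also have "\<dots> = conv q p m"
    unfolding conv_def
    by (rule finsum_cong') (use assms in \<open>auto simp: carrier_coeff_def m_comm subset_mset.diff_diff_right\<close>)
  finally show "conv p q m = conv q p m" .
qed

lemma conv_add:
  assumes "carrier_coeff p" "carrier_coeff p'" "carrier_coeff q"
  shows "conv (p \<Oplus> p') q = conv p q \<Oplus> conv p' q"
proof
  fix m
  have "conv (p \<Oplus> p') q m = (\<Oplus>a\<in>{a. a \<subseteq># m}. p a \<otimes> q (m - a) \<oplus> p' a \<otimes> q (m - a))"
    unfolding conv_def indexed_padd_def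
    by (rule finsum_cong') (use assms in \<open>auto simp: carrier_coeff_def l_distr\<close>)
  also have "\<dots> = conv p q m \<oplus> conv p' q m"
    unfolding conv_def
    by (rule finsum_addf) (use assms in \<open>auto simp: carrier_coeff_def\<close>)
  finally show "conv (p \<Oplus> p') q m = (conv p q \<Oplus> conv p' q) m"
    by (simp add: indexed_padd_def)
qed

lemma conv_const:
  assumes "c \<in> carrier R" "carrier_coeff q"
  shows "conv (indexed_const c) q = (\<lambda>m. c \<otimes> q m)"
proof
  fix m
  have "conv (indexed_const c) q m = (\<Oplus>a\<in>{{#}}. c \<otimes> q (m - a))"
    unfolding conv_def
    by (rule add.finprod_mono_neutral_cong_right[OF finite_submultisets])
       (use assms in \<open>auto simp: carrier_coeff_def indexed_const_def\<close>)
  then show "conv (indexed_const c) q m = c \<otimes> q m"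
    using assms by (simp add: carrier_coeff_def)
qed

text \<open>Only submultisets that contain \<open>i\<close> contribute. Removing one
  \<open>i\<close> from each turns the sum at \<open>m\<close> into the sum at
  \<open>m - {#i#}\<close>; if \<open>i\<close> is not in \<open>m\<close>, both sides are
  zero.\<close>

lemma conv_pmult:
  assumes "carrier_coeff p" "carrier_coeff q"
  shows "conv (p \<Otimes> i) q = conv p q \<Otimes> i"
proof
  fix m
  show "conv (p \<Otimes> i) q m = (conv p q \<Otimes> i) m"
  proof (cases "i \<in># m")
    case True
    have inj: "inj_on (add_mset i) {b. b \<subseteq># m - {#i#}}" by (auto intro: inj_onI)
    have "conv (p \<Otimes> i) q m = (\<Oplus>a\<in>add_mset i ` {b. b \<subseteq># m - {#i#}}. (p \<Otimes> i) a \<otimes> q (m - a))"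
      unfolding conv_def
    proof (rule add.finprod_mono_neutral_cong_right[OF finite_submultisets])
      show "add_mset i ` {b. b \<subseteq># m - {#i#}} \<subseteq> {a. a \<subseteq># m}"
        using True by (auto simp: insert_subset_eq_iff)
      show "(p \<Otimes> i) a \<otimes> q (m - a) = \<zero>"
        if "a \<in> {a. a \<subseteq># m} - add_mset i ` {b. b \<subseteq># m - {#i#}}" for a
      proof -
        have "i \<notin># a"
        proof
          assume "i \<in># a"
          then obtain b where "a = add_mset i b" by (metis mset_add)
          with that True show False by (auto simp: insert_subset_eq_iff)
        qed
        then show ?thesis using assms by (auto simp: indexed_pmult_def carrier_coeff_def)
      qed
    qed (use assms in \<open>auto simp: carrier_coeff_def indexed_pmult_def\<close>)
    also have "\<dots> = (\<Oplus>b\<in>{b. b \<subseteq># m - {#i#}}. (p \<Otimes> i) (add_mset i b) \<otimes> q (m - add_mset i b))"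
      by (rule finsum_reindex[OF _ inj]) (use assms in \<open>auto simp: carrier_coeff_def indexed_pmult_def\<close>)
    also have "\<dots> = conv p q (m - {#i#})"
      unfolding conv_def
      by (rule finsum_cong') (use assms in \<open>auto simp: carrier_coeff_def indexed_pmult_def\<close>)
    finally show ?thesis using True by (simp add: indexed_pmult_def)
  next
    case False
    have "conv (p \<Otimes> i) q m = (\<Oplus>a\<in>{a. a \<subseteq># m}. \<zero>)"
      unfolding conv_def
    proof (rule finsum_cong')
      fix a assume "a \<in> {a. a \<subseteq># m}"
      then have "i \<notin># a" using False by (auto dest: mset_subset_eqD)
      then show "(p \<Otimes> i) a \<otimes> q (m - a) = \<zero>"
        using assms by (auto simp: indexed_pmult_def carrier_coeff_def)
    qed auto
    then show ?thesis using False by (simp add: indexed_pmult_def)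
  qed
qed

lemma pset_coeff: "p \<in> indexed_pset I (carrier R) \<Longrightarrow> carrier_coeff p"
  by (rule indexed_pset_in_carrier[OF subset_refl])

lemma pmult_coeff: "carrier_coeff p \<Longrightarrow> carrier_coeff (p \<Otimes> i)"
  by (rule indexed_pmult_in_carrier)

lemma padd_coeff: "carrier_coeff p \<Longrightarrow> carrier_coeff q \<Longrightarrow> carrier_coeff (p \<Oplus> q)"
  by (rule indexed_padd_in_carrier)

lemma const_coeff: "c \<in> carrier R \<Longrightarrow> carrier_coeff (indexed_const c)"
  by (auto simp: carrier_coeff_def indexed_const_def)

lemma scale_const: "c \<in> carrier R \<Longrightarrow> (\<lambda>m. c \<otimes> indexed_const k m) = indexed_const (c \<otimes> k)"
  by (auto simp: indexed_const_def)

lemma scale_padd: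
  "c \<in> carrier R \<Longrightarrow> carrier_coeff p \<Longrightarrow> carrier_coeff q
    \<Longrightarrow> (\<lambda>m. c \<otimes> (p \<Oplus> q) m) = (\<lambda>m. c \<otimes> p m) \<Oplus> (\<lambda>m. c \<otimes> q m)"
  by (auto simp: indexed_padd_def carrier_coeff_def r_distr)

lemma scale_pmult: "c \<in> carrier R \<Longrightarrow> (\<lambda>m. c \<otimes> (p \<Otimes> i) m) = (\<lambda>m. c \<otimes> p m) \<Otimes> i"
  by (auto simp: indexed_pmult_def)

lemma scale_pset:
  assumes "c \<in> carrier R" "q \<in> indexed_pset I (carrier R)"
  shows "(\<lambda>m. c \<otimes> q m) \<in> indexed_pset I (carrier R)"
  using assms(2)
proof induction
  case (indexed_const k)
  then show ?case using assms(1) by (simp add: scale_const indexed_pset.indexed_const)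
next
  case (indexed_padd P Q)
  then show ?case
    using assms(1) by (simp add: scale_padd pset_coeff[OF indexed_padd(1)] pset_coeff[OF indexed_padd(2)] indexed_pset.indexed_padd)
next
  case (indexed_pmult P i)
  then show ?case using assms(1) by (simp add: scale_pmult indexed_pset.indexed_pmult)
qed

lemma conv_pset:
  assumes "p \<in> indexed_pset I (carrier R)" "q \<in> indexed_pset I (carrier R)"
  shows "conv p q \<in> indexed_pset I (carrier R)"
  using assms(1)
proof induction
  case (indexed_const k)
  then show ?case using scale_pset[OF _ assms(2)] by (simp add: conv_const pset_coeff[OF assms(2)])
next
  case (indexed_padd P Q)
  then show ?case
    by (simp add: conv_add pset_coeff[OF assms(2)] pset_coeff[OF indexed_padd(1)] pset_coeff[OF indexed_padd(2)]
        indexed_pset.indexed_padd)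
next
  case (indexed_pmult P i)
  then show ?case
    by (simp add: conv_pmult pset_coeff[OF assms(2)] pset_coeff[OF indexed_pmult(1)] indexed_pset.indexed_pmult)
qed

text \<open>Induction over the construction of \<open>p\<close> reduces the law to constants, sums
  and multiplication by a variable, so no double sum has to be rearranged.\<close>

lemma conv_assoc:
  fixes p q r :: "'c multiset \<Rightarrow> 'a"
  assumes "p \<in> indexed_pset I (carrier R)" "carrier_coeff q" "carrier_coeff r"
  shows "conv (conv p q) r = conv p (conv q r)"
  using assms(1)
proof induction
  case (indexed_const k)
  have c: "carrier_coeff (\<lambda>m. k \<otimes> q m)"
    using assms indexed_const by (auto simp: carrier_coeff_def)
  have "conv (\<lambda>m. k \<otimes> q m) r = (\<lambda>m. k \<otimes> conv q r m)"
  proof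
    fix m :: "'c multiset"
    have "k \<otimes> conv q r m = (\<Oplus>a\<in>{a. a \<subseteq># m}. k \<otimes> (q a \<otimes> r (m - a)))"
      unfolding conv_def
      by (rule finsum_rdistr[OF finite_submultisets]) (use assms indexed_const in \<open>auto simp: carrier_coeff_def\<close>)
    also have "\<dots> = conv (\<lambda>m. k \<otimes> q m) r m"
      unfolding conv_def
      by (rule finsum_cong') (use assms indexed_const in \<open>auto simp: carrier_coeff_def m_assoc\<close>)
    finally show "conv (\<lambda>m. k \<otimes> q m) r m = k \<otimes> conv q r m" ..
  qed
  then show ?case
    using indexed_const assms by (simp add: conv_const conv_closed)
next
  case (indexed_padd P Q)
  then show ?case
    using assms by (simp add: conv_add conv_closed pset_coeff[OF indexed_padd(1)] pset_coeff[OF indexed_padd(2)])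
next
  case (indexed_pmult P i)
  then show ?case
    using assms by (simp add: conv_pmult conv_closed pset_coeff[OF indexed_pmult(1)])
qed

lemma mpoly_ring_simps:
  "carrier (mpoly_ring R t) = indexed_pset {..<t} (carrier R)"
  "p \<otimes>\<^bsub>mpoly_ring R t\<^esub> q = conv p q"
  "\<one>\<^bsub>mpoly_ring R t\<^esub> = indexed_const \<one>"
  "\<zero>\<^bsub>mpoly_ring R t\<^esub> = indexed_const \<zero>"
  "p \<oplus>\<^bsub>mpoly_ring R t\<^esub> q = p \<Oplus> q"
  by (simp_all add: mpoly_ring_def conv_def)

lemma mpoly_cring: "cring (mpoly_ring R t)"
proof (rule cringI)
  show "abelian_group (mpoly_ring R t)"
  proof (rule abelian_groupI)
    fix p assume "p \<in> carrier (mpoly_ring R t)"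
    then have p: "p \<in> indexed_pset {..<t} (carrier R)" by (simp add: mpoly_ring_simps)
    \<comment> \<open>The negative is formed as the multiple by \<open>\<ominus>\<one>\<close>,
      because \<open>scale_pset\<close> already shows that multiples are polynomials.\<close>
    have "(\<lambda>m. \<ominus>\<one> \<otimes> p m) \<in> carrier (mpoly_ring R t)"
      using scale_pset[OF _ p, of "\<ominus>\<one>"] by (simp add: mpoly_ring_simps)
    moreover have "(\<lambda>m. \<ominus>\<one> \<otimes> p m) \<Oplus> p = indexed_const \<zero>"
      using pset_coeff[OF p] by (auto simp: indexed_padd_def indexed_const_def carrier_coeff_def l_minus l_neg)
    ultimately show "\<exists>q\<in>carrier (mpoly_ring R t). q \<oplus>\<^bsub>mpoly_ring R t\<^esub> p = \<zero>\<^bsub>mpoly_ring R t\<^esub>"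
      by (auto simp: mpoly_ring_simps)
    show "\<zero>\<^bsub>mpoly_ring R t\<^esub> \<oplus>\<^bsub>mpoly_ring R t\<^esub> p = p"
      using pset_coeff[OF p] by (simp add: mpoly_ring_simps indexed_padd_zero)
    fix q assume "q \<in> carrier (mpoly_ring R t)"
    then have q: "q \<in> indexed_pset {..<t} (carrier R)" by (simp add: mpoly_ring_simps)
    show "p \<oplus>\<^bsub>mpoly_ring R t\<^esub> q \<in> carrier (mpoly_ring R t)"
      using indexed_pset.indexed_padd[OF p q] by (simp add: mpoly_ring_simps)
    show "p \<oplus>\<^bsub>mpoly_ring R t\<^esub> q = q \<oplus>\<^bsub>mpoly_ring R t\<^esub> p"
      using pset_coeff[OF p] pset_coeff[OF q] by (simp add: mpoly_ring_simps indexed_padd_def carrier_coeff_def a_comm)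
    fix r assume "r \<in> carrier (mpoly_ring R t)"
    then have r: "r \<in> indexed_pset {..<t} (carrier R)" by (simp add: mpoly_ring_simps)
    show "p \<oplus>\<^bsub>mpoly_ring R t\<^esub> q \<oplus>\<^bsub>mpoly_ring R t\<^esub> r = p \<oplus>\<^bsub>mpoly_ring R t\<^esub> (q \<oplus>\<^bsub>mpoly_ring R t\<^esub> r)"
      using pset_coeff[OF p] pset_coeff[OF q] pset_coeff[OF r]
      by (simp add: mpoly_ring_simps indexed_padd_def carrier_coeff_def a_assoc)
  qed (auto simp: mpoly_ring_simps indexed_pset.indexed_const)
  show "comm_monoid (mpoly_ring R t)"
  proof (rule comm_monoidI)
    fix p assume "p \<in> carrier (mpoly_ring R t)"
    then have p: "p \<in> indexed_pset {..<t} (carrier R)" by (simp add: mpoly_ring_simps)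
    show "\<one>\<^bsub>mpoly_ring R t\<^esub> \<otimes>\<^bsub>mpoly_ring R t\<^esub> p = p"
      using pset_coeff[OF p] by (simp add: mpoly_ring_simps conv_const carrier_coeff_def)
    fix q assume "q \<in> carrier (mpoly_ring R t)"
    then have q: "q \<in> indexed_pset {..<t} (carrier R)" by (simp add: mpoly_ring_simps)
    show "p \<otimes>\<^bsub>mpoly_ring R t\<^esub> q \<in> carrier (mpoly_ring R t)"
      using conv_pset[OF p q] by (simp add: mpoly_ring_simps)
    show "p \<otimes>\<^bsub>mpoly_ring R t\<^esub> q = q \<otimes>\<^bsub>mpoly_ring R t\<^esub> p"
      using conv_comm[OF pset_coeff[OF p] pset_coeff[OF q]] by (simp add: mpoly_ring_simps)
    fix r assume "r \<in> carrier (mpoly_ring R t)"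
    then have r: "r \<in> indexed_pset {..<t} (carrier R)" by (simp add: mpoly_ring_simps)
    show "p \<otimes>\<^bsub>mpoly_ring R t\<^esub> q \<otimes>\<^bsub>mpoly_ring R t\<^esub> r = p \<otimes>\<^bsub>mpoly_ring R t\<^esub> (q \<otimes>\<^bsub>mpoly_ring R t\<^esub> r)"
      using conv_assoc[OF p pset_coeff[OF q] pset_coeff[OF r]] by (simp add: mpoly_ring_simps)
  qed (auto simp: mpoly_ring_simps indexed_pset.indexed_const)
  fix p q r assume "p \<in> carrier (mpoly_ring R t)" "q \<in> carrier (mpoly_ring R t)" "r \<in> carrier (mpoly_ring R t)"
  then show "(p \<oplus>\<^bsub>mpoly_ring R t\<^esub> q) \<otimes>\<^bsub>mpoly_ring R t\<^esub> r
      = p \<otimes>\<^bsub>mpoly_ring R t\<^esub> r \<oplus>\<^bsub>mpoly_ring R t\<^esub> q \<otimes>\<^bsub>mpoly_ring R t\<^esub> r"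
    unfolding mpoly_ring_simps
    by (intro conv_add) (auto dest: pset_coeff)
qed

end

subsection \<open>Evaluation\<close>

context cring
begin

definition monomial_val :: "nat \<Rightarrow> (nat \<Rightarrow> 'a) \<Rightarrow> nat multiset \<Rightarrow> 'a" where
  "monomial_val t x m = (\<Otimes>i\<in>{..<t}. x i [^] count m i)"

lemma monomial_val_closed: "x \<in> {..<t} \<rightarrow> carrier R \<Longrightarrow> monomial_val t x m \<in> carrier R"
  unfolding monomial_val_def by (rule finprod_closed) auto

lemma monomial_val_empty: "monomial_val t x {#} = \<one>"
  unfolding monomial_val_def by (simp add: finprod_one_eqI)

lemma monomial_val_add_mset:
  assumes x: "x \<in> {..<t} \<rightarrow> carrier R" and i: "i < t"
  shows "monomial_val t x (add_mset i m) = x i \<otimes> monomial_val t x m"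
proof -
  have xc: "x j \<in> carrier R" if "j < t" for j using x that by auto
  have "monomial_val t x (add_mset i m) = (\<Otimes>j\<in>{..<t}. (if i = j then x i else \<one>) \<otimes> x j [^] count m j)"
    unfolding monomial_val_def
    by (rule finprod_cong') (use xc i in \<open>auto simp: m_comm\<close>)
  also have "\<dots> = (\<Otimes>j\<in>{..<t}. (if i = j then x i else \<one>)) \<otimes> monomial_val t x m"
    unfolding monomial_val_def using x i by (intro finprod_multf) auto
  also have "(\<Otimes>j\<in>{..<t}. (if i = j then x i else \<one>)) = x i"
    using finprod_singleton[of i "{..<t}" "\<lambda>_. x i"] x i by auto
  finally show ?thesis .
qed

lemma support_pmult: "{m. (p \<Otimes> i) m \<noteq> \<zero>} \<subseteq> add_mset i ` {m. p m \<noteq> \<zero>}"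
proof
  fix m assume "m \<in> {m. (p \<Otimes> i) m \<noteq> \<zero>}"
  then have "m = add_mset i (m - {#i#})" "p (m - {#i#}) \<noteq> \<zero>"
    by (auto simp: indexed_pmult_def split: if_splits)
  then show "m \<in> add_mset i ` {m. p m \<noteq> \<zero>}" by blast
qed

lemma pset_finite_support:
  assumes "p \<in> indexed_pset I (carrier R)" shows "finite {m. p m \<noteq> \<zero>}"
  using assms
proof induction
  case (indexed_const k)
  have "{m. indexed_const k m \<noteq> \<zero>} \<subseteq> {{#}}" by (auto simp: indexed_const_def)
  then show ?case using finite_subset by blast
next
  case (indexed_padd P Q)
  have "{m. (P \<Oplus> Q) m \<noteq> \<zero>} \<subseteq> {m. P m \<noteq> \<zero>} \<union> {m. Q m \<noteq> \<zero>}" by (auto simp: indexed_padd_def)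
  then show ?case using indexed_padd finite_subset by blast
next
  case (indexed_pmult P i)
  then show ?case using support_pmult[of P i] finite_subset by blast
qed

text \<open>The defining sum runs over the support, which varies with the polynomial; a common
  finite superset lets such sums be added termwise.\<close>

lemma mpoly_eval_superset:
  assumes x: "x \<in> {..<t} \<rightarrow> carrier R" and p: "carrier_coeff p"
    and A: "finite A" "{m. p m \<noteq> \<zero>} \<subseteq> A"
  shows "mpoly_eval R t x p = (\<Oplus>m\<in>A. p m \<otimes> monomial_val t x m)"
  unfolding mpoly_eval_def monomial_val_def[symmetric]
  by (rule add.finprod_mono_neutral_cong_left[OF A])
     (use monomial_val_closed[OF x] p in \<open>auto simp: carrier_coeff_def\<close>)

lemma mpoly_eval_closed [simp]:
  assumes "x \<in> {..<t} \<rightarrow> carrier R" "p \<in> carrier (mpoly_ring R t)"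
  shows "mpoly_eval R t x p \<in> carrier R"
  unfolding mpoly_eval_def monomial_val_def[symmetric]
  using carrier_coeffE[OF pset_coeff[OF assms(2)[unfolded mpoly_ring_simps]]] monomial_val_closed[OF assms(1)]
  by (auto intro!: finsum_closed)

lemma mpoly_eval_const [simp]:
  assumes x: "x \<in> {..<t} \<rightarrow> carrier R" and c: "c \<in> carrier R"
  shows "mpoly_eval R t x (indexed_const c) = c"
proof -
  have "mpoly_eval R t x (indexed_const c) = (\<Oplus>m\<in>{{#}}. indexed_const c m \<otimes> monomial_val t x m)"
    by (rule mpoly_eval_superset[OF x const_coeff[OF c]]) (auto simp: indexed_const_def split: if_splits)
  then show ?thesis using c by (simp add: indexed_const_def monomial_val_empty)
qed

lemma mpoly_eval_add:
  assumes x: "x \<in> {..<t} \<rightarrow> carrier R"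
    and p: "p \<in> carrier (mpoly_ring R t)" and q: "q \<in> carrier (mpoly_ring R t)"
  shows "mpoly_eval R t x (p \<oplus>\<^bsub>mpoly_ring R t\<^esub> q) = mpoly_eval R t x p \<oplus> mpoly_eval R t x q"
proof -
  let ?A = "{m. p m \<noteq> \<zero>} \<union> {m. q m \<noteq> \<zero>}"
  have A: "finite ?A" using p q pset_finite_support by (auto simp: mpoly_ring_simps)
  note pc = pset_coeff[OF p[unfolded mpoly_ring_simps]] pset_coeff[OF q[unfolded mpoly_ring_simps]]
  have "mpoly_eval R t x (p \<Oplus> q) = (\<Oplus>m\<in>?A. (p \<Oplus> q) m \<otimes> monomial_val t x m)"
    by (rule mpoly_eval_superset[OF x _ A]) (use pc padd_coeff in \<open>auto simp: indexed_padd_def\<close>)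
  also have "\<dots> = (\<Oplus>m\<in>?A. p m \<otimes> monomial_val t x m \<oplus> q m \<otimes> monomial_val t x m)"
    by (rule finsum_cong')
       (use pc monomial_val_closed[OF x] in \<open>auto simp: indexed_padd_def carrier_coeff_def l_distr\<close>)
  also have "\<dots> = (\<Oplus>m\<in>?A. p m \<otimes> monomial_val t x m) \<oplus> (\<Oplus>m\<in>?A. q m \<otimes> monomial_val t x m)"
    by (rule finsum_addf) (use pc monomial_val_closed[OF x] in \<open>auto simp: carrier_coeff_def\<close>)
  also have "\<dots> = mpoly_eval R t x p \<oplus> mpoly_eval R t x q"
    using mpoly_eval_superset[OF x pc(1) A] mpoly_eval_superset[OF x pc(2) A] by auto
  finally show ?thesis by (simp add: mpoly_ring_simps)
qed

lemma mpoly_eval_pmult: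
  assumes x: "x \<in> {..<t} \<rightarrow> carrier R"
    and p: "p \<in> carrier (mpoly_ring R t)" and i: "i < t"
  shows "mpoly_eval R t x (p \<Otimes> i) = x i \<otimes> mpoly_eval R t x p"
proof -
  let ?A = "{m. p m \<noteq> \<zero>}"
  have A: "finite ?A" using p pset_finite_support by (auto simp: mpoly_ring_simps)
  note pc = pset_coeff[OF p[unfolded mpoly_ring_simps]]
  have xi: "x i \<in> carrier R" using x i by auto
  note cl = monomial_val_closed[OF x] carrier_coeffE[OF pc] xi
  have "mpoly_eval R t x (p \<Otimes> i) = (\<Oplus>m\<in>add_mset i ` ?A. (p \<Otimes> i) m \<otimes> monomial_val t x m)"
    by (rule mpoly_eval_superset[OF x pmult_coeff[OF pc] _ support_pmult]) (use A in auto)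
  also have "\<dots> = (\<Oplus>m\<in>?A. (p \<Otimes> i) (add_mset i m) \<otimes> monomial_val t x (add_mset i m))"
    by (rule finsum_reindex) (use cl in \<open>auto simp: indexed_pmult_def intro: inj_onI\<close>)
  also have "\<dots> = (\<Oplus>m\<in>?A. x i \<otimes> (p m \<otimes> monomial_val t x m))"
    by (rule finsum_cong')
       (use cl in \<open>auto simp: indexed_pmult_def monomial_val_add_mset[OF x i] m_lcomm\<close>)
  also have "\<dots> = x i \<otimes> mpoly_eval R t x p"
    unfolding mpoly_eval_def monomial_val_def[symmetric]
    by (rule finsum_rdistr[symmetric]) (use A cl in auto)
  finally show ?thesis .
qed

lemma mpoly_eval_mult:
  assumes x: "x \<in> {..<t} \<rightarrow> carrier R"
    and p: "p \<in> carrier (mpoly_ring R t)" and q: "q \<in> carrier (mpoly_ring R t)"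
  shows "mpoly_eval R t x (p \<otimes>\<^bsub>mpoly_ring R t\<^esub> q) = mpoly_eval R t x p \<otimes> mpoly_eval R t x q"
proof -
  note add = mpoly_eval_add[OF x, unfolded mpoly_ring_simps]
    and pmult = mpoly_eval_pmult[OF x, unfolded mpoly_ring_simps]
    and closed = mpoly_eval_closed[OF x, unfolded mpoly_ring_simps]
    and q' = q[unfolded mpoly_ring_simps]
  show ?thesis
    using p unfolding mpoly_ring_simps
  proof induction
    case (indexed_const k)
    note k = \<open>k \<in> carrier R\<close>
    \<comment> \<open>A constant factor needs an induction of its own, this time on
      \<open>q\<close>.\<close>
    have "mpoly_eval R t x (\<lambda>m. k \<otimes> q m) = k \<otimes> mpoly_eval R t x q"
      using q unfolding mpoly_ring_simps
    proof induction
      case (indexed_const k')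
      then show ?case using k x by (simp add: scale_const)
    next
      case (indexed_padd P Q)
      then show ?case
        using add[OF scale_pset[OF k indexed_padd(1)] scale_pset[OF k indexed_padd(2)]] add[OF indexed_padd(1,2)]
          closed[OF indexed_padd(1)] closed[OF indexed_padd(2)] k
        by (simp add: scale_padd pset_coeff[OF indexed_padd(1)] pset_coeff[OF indexed_padd(2)] r_distr)
    next
      case (indexed_pmult P i)
      moreover have "x i \<in> carrier R" using x indexed_pmult by auto
      ultimately show ?case
        using pmult[OF scale_pset[OF k indexed_pmult(1)], of i] pmult[OF indexed_pmult(1), of i]
          closed[OF indexed_pmult(1)] k
        by (simp add: scale_pmult m_lcomm)
    qed
    then show ?case
      using k x by (simp add: conv_const pset_coeff[OF q'])
  next
    case (indexed_padd P Q)
    then show ?case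
      using add[OF conv_pset[OF indexed_padd(1) q'] conv_pset[OF indexed_padd(2) q']] add[OF indexed_padd(1,2)]
        closed[OF indexed_padd(1)] closed[OF indexed_padd(2)] closed[OF q']
      by (simp add: conv_add l_distr pset_coeff[OF indexed_padd(1)] pset_coeff[OF indexed_padd(2)] pset_coeff[OF q'])
  next
    case (indexed_pmult P i)
    moreover have "x i \<in> carrier R" using x indexed_pmult by auto
    ultimately show ?case
      using pmult[OF conv_pset[OF indexed_pmult(1) q'], of i] pmult[OF indexed_pmult(1), of i]
        closed[OF indexed_pmult(1)] closed[OF q']
      by (simp add: conv_pmult m_assoc pset_coeff[OF indexed_pmult(1)] pset_coeff[OF q'])
  qed
qed

lemma mpoly_eval_hom:
  assumes "x \<in> {..<t} \<rightarrow> carrier R"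
  shows "mpoly_eval R t x \<in> ring_hom (mpoly_ring R t) R"
  by (rule ring_hom_memI)
     (simp_all add: assms mpoly_eval_add mpoly_eval_mult mpoly_ring_simps(3))

lemma mpoly_const_hom: "indexed_const \<in> ring_hom R (mpoly_ring R t)"
  by (rule ring_hom_memI)
     (simp_all add: mpoly_ring_simps indexed_pset.indexed_const indexed_padd_const conv_const const_coeff scale_const)

lemma mpoly_var_closed: "i < t \<Longrightarrow> indexed_var i \<in> carrier (mpoly_ring R t)"
  by (simp add: mpoly_ring_simps indexed_var_def indexed_pset.intros)

lemma mpoly_pmult_eq:
  assumes "p \<in> carrier (mpoly_ring R t)"
  shows "p \<Otimes> i = indexed_var i \<otimes>\<^bsub>mpoly_ring R t\<^esub> p"
proof -
  have "carrier_coeff p" using assms pset_coeff[of p] by (simp add: mpoly_ring_simps)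
  moreover from this have "(\<lambda>m. \<one> \<otimes> p m) = p" by (auto simp: carrier_coeff_def)
  ultimately show ?thesis
    by (simp add: mpoly_ring_simps indexed_var_def conv_pmult const_coeff conv_const)
qed

lemma mpoly_eval_var:
  assumes "x \<in> {..<t} \<rightarrow> carrier R" "i < t"
  shows "mpoly_eval R t x (indexed_var i) = x i"
proof -
  have "x i \<in> carrier R" using assms by auto
  then show ?thesis
    unfolding indexed_var_def using mpoly_eval_pmult[OF assms(1) _ assms(2), of "indexed_const \<one>"] assms
    by (simp add: mpoly_ring_simps indexed_pset.indexed_const)
qed

text \<open>The inductive set multiplies by a variable through a shift of coefficients. Here the
  step is a product in the ring, so the laws of homomorphisms and modules apply to it
  directly.\<close>

lemma mpoly_induct [consumes 1, case_names const add mult]: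
  assumes "p \<in> carrier (mpoly_ring R t)"
    and "\<And>c. c \<in> carrier R \<Longrightarrow> P (indexed_const c)"
    and "\<And>p q. p \<in> carrier (mpoly_ring R t) \<Longrightarrow> q \<in> carrier (mpoly_ring R t) \<Longrightarrow> P p \<Longrightarrow> P q
           \<Longrightarrow> P (p \<oplus>\<^bsub>mpoly_ring R t\<^esub> q)"
    and "\<And>p i. p \<in> carrier (mpoly_ring R t) \<Longrightarrow> i < t \<Longrightarrow> P p \<Longrightarrow> P (indexed_var i \<otimes>\<^bsub>mpoly_ring R t\<^esub> p)"
  shows "P p"
  using assms(1) unfolding mpoly_ring_simps(1)
proof induction
  case (indexed_const k)
  then show ?case using assms(2) by simp
next
  case (indexed_padd p q)
  then show ?case using assms(3) by (simp add: mpoly_ring_simps)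
next
  case (indexed_pmult p i)
  then show ?case using assms(4)[of p i] mpoly_pmult_eq[of p t i] by (simp add: mpoly_ring_simps(1))
qed

end

section \<open>Non-vanishing points\<close>

context cring
begin

text \<open>Univariate polynomials are lists of coefficients with the constant term first. Several
  lists may give the same function, which is harmless because only values are used.\<close>

primrec horner_val :: "'a list \<Rightarrow> 'a \<Rightarrow> 'a" where
  "horner_val [] s = \<zero>"
| "horner_val (c # cs) s = c \<oplus> s \<otimes> horner_val cs s"

lemma horner_val_closed [simp]:
  "set cs \<subseteq> carrier R \<Longrightarrow> s \<in> carrier R \<Longrightarrow> horner_val cs s \<in> carrier R"
  by (induction cs) auto

text \<open>Synthetic division by the linear factor with root \<open>a\<close>. The quotient has one
  coefficient less, which drives the induction in \<open>finite_root_classes\<close>.\<close>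

lemma horner_val_divide:
  assumes "set cs \<subseteq> carrier R" "a \<in> carrier R"
  shows "\<exists>ds. set ds \<subseteq> carrier R \<and> length ds = length cs - 1 \<and>
     (\<forall>s\<in>carrier R. horner_val cs s = horner_val cs a \<oplus> (s \<ominus> a) \<otimes> horner_val ds s)"
  using assms(1)
proof (induction cs)
  case Nil
  show ?case using assms(2) by (intro exI[of _ "[]"]) simp
next
  case (Cons c cs)
  then obtain ds where ds: "set ds \<subseteq> carrier R" "length ds = length cs - 1"
    "\<And>s. s \<in> carrier R \<Longrightarrow> horner_val cs s = horner_val cs a \<oplus> (s \<ominus> a) \<otimes> horner_val ds s"
    by auto
  show ?case
  proof (cases "cs = []")
    case True
    then show ?thesis using assms(2) Cons.prems by (intro exI[of _ "[]"]) simp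
  next
    case False
    \<comment> \<open>Horner's scheme: the value of the tail at \<open>a\<close> becomes the
      constant term of the quotient.\<close>
    have "horner_val (c # cs) s = horner_val (c # cs) a \<oplus> (s \<ominus> a) \<otimes> horner_val (horner_val cs a # ds) s"
      if s: "s \<in> carrier R" for s
    proof -
      have cl: "c \<in> carrier R" "horner_val cs a \<in> carrier R" "horner_val ds s \<in> carrier R"
        using Cons.prems ds(1) assms(2) s by auto
      have "horner_val (c # cs) s = c \<oplus> s \<otimes> (horner_val cs a \<oplus> (s \<ominus> a) \<otimes> horner_val ds s)"
        using ds(3)[OF s] by simp
      also have "\<dots> = (c \<oplus> a \<otimes> horner_val cs a) \<oplus> (s \<ominus> a) \<otimes> (horner_val cs a \<oplus> s \<otimes> horner_val ds s)"
        using cl s assms(2) by algebra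
      finally show ?thesis by simp
    qed
    moreover have "set (horner_val cs a # ds) \<subseteq> carrier R" using ds(1) Cons.prems assms(2) by simp
    moreover have "length (horner_val cs a # ds) = length (c # cs) - 1" using ds(2) False by (cases cs) auto
    ultimately show ?thesis by blast
  qed
qed

text \<open>A nonzero polynomial over the domain R / P has finitely many roots; inside R they are
  counted by their cosets. After division by a root \<open>a\<close>, primeness puts every root into
  the coset of \<open>a\<close> or among the roots of the quotient.\<close>

lemma finite_root_classes:
  assumes P: "primeideal P R"
    and "set cs \<subseteq> carrier R" "s0 \<in> carrier R" "horner_val cs s0 \<notin> P"
  shows "finite {P +> s | s. s \<in> carrier R \<and> horner_val cs s \<in> P}"
  using assms(2,4)
proof (induction "length cs" arbitrary: cs rule: less_induct)
  case less
  interpret primeideal P R by fact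
  show ?case
  proof (cases "\<exists>a\<in>carrier R. horner_val cs a \<in> P")
    case False
    then have "{P +> s | s. s \<in> carrier R \<and> horner_val cs s \<in> P} = {}" by auto
    then show ?thesis by (metis finite.emptyI)
  next
    case True
    then obtain a where a: "a \<in> carrier R" "horner_val cs a \<in> P" by auto
    obtain ds where ds: "set ds \<subseteq> carrier R" "length ds = length cs - 1"
      "\<And>s. s \<in> carrier R \<Longrightarrow> horner_val cs s = horner_val cs a \<oplus> (s \<ominus> a) \<otimes> horner_val ds s"
      using horner_val_divide[OF less.prems(1) a(1)] by auto
    have "cs \<noteq> []" using less.prems by auto
    then have len: "length ds < length cs" using ds(2) by (cases cs) auto
    \<comment> \<open>The witness \<open>s0\<close> survives the division, so the induction
      hypothesis applies to the quotient.\<close>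
    have "horner_val ds s0 \<notin> P"
    proof
      assume "horner_val ds s0 \<in> P"
      then have "(s0 \<ominus> a) \<otimes> horner_val ds s0 \<in> P" using I_l_closed assms(3) a(1) by simp
      then have "horner_val cs s0 \<in> P" using ds(3)[OF assms(3)] a(2) by simp
      then show False using less.prems by simp
    qed
    from less.hyps[OF len ds(1) this]
    have fin: "finite {P +> s | s. s \<in> carrier R \<and> horner_val ds s \<in> P}" .
    have "{P +> s | s. s \<in> carrier R \<and> horner_val cs s \<in> P}
        \<subseteq> insert (P +> a) {P +> s | s. s \<in> carrier R \<and> horner_val ds s \<in> P}"
    proof
      fix K assume "K \<in> {P +> s | s. s \<in> carrier R \<and> horner_val cs s \<in> P}"
      then obtain s where K: "K = P +> s" and s: "s \<in> carrier R" "horner_val cs s \<in> P" by auto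
      have cl: "horner_val ds s \<in> carrier R" "horner_val cs a \<in> carrier R"
        using ds(1) s a less.prems by auto
      have "(s \<ominus> a) \<otimes> horner_val ds s = horner_val cs s \<ominus> horner_val cs a"
        unfolding ds(3)[OF s(1)] using cl s a by algebra
      also have "\<dots> \<in> P" using s(2) a(2) by (simp add: minus_eq)
      finally have "s \<ominus> a \<in> P \<or> horner_val ds s \<in> P"
        using I_prime s(1) a(1) cl by simp
      then show "K \<in> insert (P +> a) {P +> s | s. s \<in> carrier R \<and> horner_val ds s \<in> P}"
      proof
        assume "s \<ominus> a \<in> P"
        then show ?thesis
          using quotient_eq_iff_same_a_r_cos[OF is_ideal s(1) a(1)] K by simp
      next
        assume "horner_val ds s \<in> P"
        then show ?thesis using K s(1) by blast
      qed
    qed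
    then show ?thesis using fin finite_subset by blast
  qed
qed

text \<open>Each of the two polynomials excludes finitely many cosets of \<open>P\<close>, and R / P
  has infinitely many.\<close>

lemma common_nonroot:
  assumes P: "primeideal P R" and inf: "infinite (carrier (R Quot P))"
    and "set cs \<subseteq> carrier R" "s0 \<in> carrier R" "horner_val cs s0 \<notin> P"
    and "set ds \<subseteq> carrier R" "s1 \<in> carrier R" "horner_val ds s1 \<notin> P"
  shows "\<exists>s\<in>carrier R. horner_val cs s \<notin> P \<and> horner_val ds s \<notin> P"
proof (rule ccontr)
  assume *: "\<not> ?thesis"
  have "carrier (R Quot P) \<subseteq> {P +> s | s. s \<in> carrier R \<and> horner_val cs s \<in> P}
      \<union> {P +> s | s. s \<in> carrier R \<and> horner_val ds s \<in> P}"
    using * by (auto simp: FactRing_def A_RCOSETS_def')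
  moreover have "finite \<dots>"
    using finite_root_classes[OF P assms(3-5)] finite_root_classes[OF P assms(6-8)] by simp
  ultimately show False using inf finite_subset by blast
qed

text \<open>The existence of some coefficient list takes the place of a polynomial ring in the
  parameter of a line.\<close>

definition polyfun :: "('a \<Rightarrow> 'a) \<Rightarrow> bool" where
  "polyfun h \<longleftrightarrow> (\<exists>cs. set cs \<subseteq> carrier R \<and> (\<forall>s\<in>carrier R. h s = horner_val cs s))"

lemma polyfun_const: "c \<in> carrier R \<Longrightarrow> polyfun (\<lambda>s. c)"
  unfolding polyfun_def by (rule exI[of _ "[c]"]) simp

lemma polyfun_shift: "polyfun h \<Longrightarrow> polyfun (\<lambda>s. s \<otimes> h s)"
  unfolding polyfun_def
proof (elim exE conjE)
  fix cs assume "set cs \<subseteq> carrier R" "\<forall>s\<in>carrier R. h s = horner_val cs s"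
  then show "\<exists>cs. set cs \<subseteq> carrier R \<and> (\<forall>s\<in>carrier R. s \<otimes> h s = horner_val cs s)"
    by (intro exI[of _ "\<zero> # cs"]) simp
qed

lemma polyfun_add:
  assumes "polyfun g" "polyfun h" shows "polyfun (\<lambda>s. g s \<oplus> h s)"
proof -
  have "\<exists>es. set es \<subseteq> carrier R \<and> (\<forall>s\<in>carrier R. horner_val cs s \<oplus> horner_val ds s = horner_val es s)"
    if "set cs \<subseteq> carrier R" "set ds \<subseteq> carrier R" for cs ds
    using that
  proof (induction cs arbitrary: ds)
    case Nil
    then show ?case by (intro exI[of _ ds]) auto
  next
    case (Cons c cs)
    show ?case
    proof (cases ds)
      case Nil
      then show ?thesis using Cons.prems by (intro exI[of _ "c # cs"]) auto
    next
      case (Cons d ds')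
      then have cl: "c \<in> carrier R" "d \<in> carrier R" "set cs \<subseteq> carrier R" "set ds' \<subseteq> carrier R"
        using Cons.prems by auto
      obtain es where es: "set es \<subseteq> carrier R"
        "\<And>s. s \<in> carrier R \<Longrightarrow> horner_val cs s \<oplus> horner_val ds' s = horner_val es s"
        using Cons.IH[OF cl(3,4)] by auto
      have "horner_val (c # cs) s \<oplus> horner_val ds s = horner_val ((c \<oplus> d) # es) s" if s: "s \<in> carrier R" for s
      proof -
        have "horner_val cs s \<in> carrier R" "horner_val ds' s \<in> carrier R" using cl s by auto
        then have "(c \<oplus> s \<otimes> horner_val cs s) \<oplus> (d \<oplus> s \<otimes> horner_val ds' s)
            = (c \<oplus> d) \<oplus> s \<otimes> (horner_val cs s \<oplus> horner_val ds' s)"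
          using cl(1,2) s by algebra
        then show ?thesis using es(2)[OF s] Cons by simp
      qed
      then show ?thesis using es cl by (intro exI[of _ "(c \<oplus> d) # es"]) auto
    qed
  qed
  note sum = this
  obtain cs ds where cs: "set cs \<subseteq> carrier R" "\<And>s. s \<in> carrier R \<Longrightarrow> g s = horner_val cs s"
    and ds: "set ds \<subseteq> carrier R" "\<And>s. s \<in> carrier R \<Longrightarrow> h s = horner_val ds s"
    using assms unfolding polyfun_def by auto
  from sum[OF cs(1) ds(1)] show ?thesis
    unfolding polyfun_def using cs(2) ds(2) by auto
qed

lemma polyfun_scale:
  assumes "c \<in> carrier R" "polyfun h" shows "polyfun (\<lambda>s. c \<otimes> h s)"
proof -
  obtain cs where cs: "set cs \<subseteq> carrier R" "\<forall>s\<in>carrier R. h s = horner_val cs s"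
    using assms(2) unfolding polyfun_def by auto
  have "c \<otimes> horner_val cs s = horner_val (map ((\<otimes>) c) cs) s" if "s \<in> carrier R" for s
    using cs(1)
  proof (induction cs)
    case (Cons a cs)
    then have "horner_val cs s \<in> carrier R" "a \<in> carrier R" using that by auto
    then have "c \<otimes> (a \<oplus> s \<otimes> horner_val cs s) = c \<otimes> a \<oplus> s \<otimes> (c \<otimes> horner_val cs s)"
      using assms(1) that by algebra
    then show ?case using Cons by simp
  qed (use assms(1) in simp)
  then show ?thesis
    using cs assms(1) unfolding polyfun_def by (intro exI[of _ "map ((\<otimes>) c) cs"]) auto
qed

lemma polyfun_cong: "polyfun g \<Longrightarrow> (\<And>s. s \<in> carrier R \<Longrightarrow> g s = h s) \<Longrightarrow> polyfun h"
  unfolding polyfun_def by auto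

text \<open>Restriction to a line leaves a polynomial function of the single parameter
  \<open>s\<close>, to which the count of roots applies.\<close>

lemma polyfun_eval_line:
  assumes b: "b \<in> vectors R t" and v: "v \<in> {..<t} \<rightarrow> carrier R" and f: "f \<in> carrier (mpoly_ring R t)"
  shows "polyfun (\<lambda>s. mpoly_eval R t (\<lambda>i\<in>{..<t}. b i \<oplus> s \<otimes> v i) f)"
proof -
  have bc: "b i \<in> carrier R" "v i \<in> carrier R" if "i < t" for i
    using b v that by (auto simp: vectors_def PiE_def)
  define L where "L s = (\<lambda>i\<in>{..<t}. b i \<oplus> s \<otimes> v i)" for s
  have l: "L s \<in> {..<t} \<rightarrow> carrier R" if "s \<in> carrier R" for s
    using bc that by (auto simp: L_def)
  interpret S: cring "mpoly_ring R t" by (rule mpoly_cring)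
  show ?thesis
    unfolding L_def[symmetric] using f
  proof (induction rule: mpoly_induct)
    case (const c)
    show ?case by (rule polyfun_cong[OF polyfun_const[OF const]]) (use l const in simp)
  next
    case (add p q)
    show ?case
      by (rule polyfun_cong[OF polyfun_add[OF add.IH]]) (use l add in \<open>simp add: mpoly_eval_add\<close>)
  next
    case (mult p i)
    show ?case
    proof (rule polyfun_cong[OF polyfun_add[OF polyfun_scale[OF bc(1)[OF mult(2)] mult(3)] polyfun_shift[OF polyfun_scale[OF bc(2)[OF mult(2)] mult(3)]]]])
      fix s assume s: "s \<in> carrier R"
      let ?x = "L s"
      have "mpoly_eval R t ?x p \<in> carrier R" using l[OF s] mult(1) by simp
      moreover have "mpoly_eval R t ?x (indexed_var i \<otimes>\<^bsub>mpoly_ring R t\<^esub> p)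
          = (b i \<oplus> s \<otimes> v i) \<otimes> mpoly_eval R t ?x p"
        using mpoly_eval_mult[OF l[OF s] mpoly_var_closed[OF mult(2)] mult(1)] mpoly_eval_var[OF l[OF s] mult(2)] mult(2)
        by (simp add: L_def)
      ultimately show "b i \<otimes> mpoly_eval R t ?x p \<oplus> s \<otimes> (v i \<otimes> mpoly_eval R t ?x p)
          = mpoly_eval R t ?x (indexed_var i \<otimes>\<^bsub>mpoly_ring R t\<^esub> p)"
        using bc[OF mult(2)] s by (simp add: l_distr m_assoc)
    qed
  qed
qed

text \<open>Both polynomials are nonzero somewhere on the line through the two given points, and each has
  only finitely many zeros modulo \<open>P\<close> on it.\<close>

lemma common_nonvanishing_point:
  assumes P: "primeideal P R" and inf: "infinite (carrier (R Quot P))"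
    and f: "f \<in> carrier (mpoly_ring R t)" and g: "g \<in> carrier (mpoly_ring R t)"
    and x: "x \<in> vectors R t" "mpoly_eval R t x f \<notin> P"
    and y: "y \<in> vectors R t" "mpoly_eval R t y g \<notin> P"
  obtains z where "z \<in> vectors R t" "mpoly_eval R t z f \<notin> P" "mpoly_eval R t z g \<notin> P"
    "\<And>i. x i = y i \<Longrightarrow> z i = x i"
proof -
  define l where "l s = (\<lambda>i\<in>{..<t}. x i \<oplus> s \<otimes> (y i \<ominus> x i))" for s
  have xc: "x i \<in> carrier R" "y i \<in> carrier R" if "i < t" for i
    using x y that by (auto simp: vectors_def PiE_def)
  have und: "x i = undefined" "y i = undefined" if "\<not> i < t" for i
    using x y that by (auto simp: vectors_def PiE_def extensional_def)
  have l0: "l \<zero> = x"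
    unfolding l_def by (rule ext) (use xc und in auto)
  have "x i \<oplus> \<one> \<otimes> (y i \<ominus> x i) = y i" if "i < t" for i
    using xc[OF that] by algebra
  then have l1: "l \<one> = y"
    unfolding l_def by (intro ext) (use und in auto)
  have v: "(\<lambda>i. y i \<ominus> x i) \<in> {..<t} \<rightarrow> carrier R" using xc by auto
  obtain cs where cs: "set cs \<subseteq> carrier R" "\<And>s. s \<in> carrier R \<Longrightarrow> mpoly_eval R t (l s) f = horner_val cs s"
    using polyfun_eval_line[OF x(1) v f] unfolding polyfun_def l_def by auto
  obtain ds where ds: "set ds \<subseteq> carrier R" "\<And>s. s \<in> carrier R \<Longrightarrow> mpoly_eval R t (l s) g = horner_val ds s"
    using polyfun_eval_line[OF x(1) v g] unfolding polyfun_def l_def by auto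
  have "horner_val cs \<zero> \<notin> P" "horner_val ds \<one> \<notin> P"
    using cs(2)[of \<zero>] ds(2)[of \<one>] l0 l1 x y by auto
  from common_nonroot[OF P inf cs(1) _ this(1) ds(1) _ this(2)]
  obtain s where s: "s \<in> carrier R" "horner_val cs s \<notin> P" "horner_val ds s \<notin> P" by auto
  show thesis
  proof (rule that[of "l s"])
    show "l s \<in> vectors R t" using xc s by (auto simp: vectors_def l_def)
    \<comment> \<open>The line is constant in every coordinate where \<open>x\<close> and
      \<open>y\<close> agree. Multiplicative closure of \<open>nonvan i \<alpha>\<close> depends on
      this, since the first \<open>i\<close> coordinates are prescribed there.\<close>
    show "l s i = x i" if "x i = y i" for i
      using that xc[of i] und[of i] s by (auto simp: l_def minus_eq r_neg)
  qed (use s cs ds in auto)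
qed

end

text \<open>The values of polynomials in \<open>z\<close> with coefficients in \<open>H\<close>, in
  Horner form c + z g, so that induction peels off the constant term.\<close>

inductive_set horner_set :: "('a, 'b) ring_scheme \<Rightarrow> 'a \<Rightarrow> 'a set \<Rightarrow> 'a set" for A and z H where
  base: "c \<in> H \<Longrightarrow> c \<in> horner_set A z H"
| step: "c \<in> H \<Longrightarrow> g \<in> horner_set A z H \<Longrightarrow> c \<oplus>\<^bsub>A\<^esub> z \<otimes>\<^bsub>A\<^esub> g \<in> horner_set A z H"

section \<open>Polynomials whose values all lie in a prime\<close>

context cring
begin

text \<open>Polynomials in the first \<open>i\<close> variables, as iterated univariate polynomials.\<close>

primrec initial_polys :: "nat \<Rightarrow> nat \<Rightarrow> (nat multiset \<Rightarrow> 'a) set" where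
  "initial_polys t 0 = indexed_const ` carrier R"
| "initial_polys t (Suc i) = horner_set (mpoly_ring R t) (indexed_var i) (initial_polys t i)"

lemma initial_polys_closed: "i \<le> t \<Longrightarrow> initial_polys t i \<subseteq> carrier (mpoly_ring R t)"
proof (induction i)
  case 0
  then show ?case by (auto simp: mpoly_ring_simps indexed_pset.indexed_const)
next
  case (Suc i)
  interpret S: cring "mpoly_ring R t" by (rule mpoly_cring)
  show ?case
  proof
    fix f assume "f \<in> initial_polys t (Suc i)"
    then have "f \<in> horner_set (mpoly_ring R t) (indexed_var i) (initial_polys t i)" by simp
    then show "f \<in> carrier (mpoly_ring R t)"
      by induction (use Suc mpoly_var_closed in auto)
  qed
qed

lemma initial_polys_add:
  "i \<le> t \<Longrightarrow> p \<in> initial_polys t i \<Longrightarrow> q \<in> initial_polys t i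
    \<Longrightarrow> p \<oplus>\<^bsub>mpoly_ring R t\<^esub> q \<in> initial_polys t i"
proof (induction i arbitrary: p q)
  case 0
  then show ?case by (auto simp: mpoly_ring_simps indexed_padd_const)
next
  case (Suc i)
  interpret S: cring "mpoly_ring R t" by (rule mpoly_cring)
  let ?H = "horner_set (mpoly_ring R t) (indexed_var i) (initial_polys t i)"
  have sub: "initial_polys t i \<subseteq> carrier (mpoly_ring R t)" "?H \<subseteq> carrier (mpoly_ring R t)"
    using initial_polys_closed[of i t] initial_polys_closed[of "Suc i" t] Suc.prems(1) by simp_all
  have z: "indexed_var i \<in> carrier (mpoly_ring R t)" using mpoly_var_closed Suc.prems(1) by simp
  note IH = Suc.IH[OF Suc_leD[OF Suc.prems(1)]]
  \<comment> \<open>The mixed case of the double induction: a summand free of the newest variable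
    changes only the constant term.\<close>
  have one: "c \<oplus>\<^bsub>mpoly_ring R t\<^esub> q \<in> ?H" if "c \<in> initial_polys t i" "q \<in> ?H" for c q
    using that(2)
  proof cases
    case base
    then show ?thesis using IH[OF that(1)] by (simp add: horner_set.base)
  next
    case (step d g)
    have "c \<oplus>\<^bsub>mpoly_ring R t\<^esub> q = (c \<oplus>\<^bsub>mpoly_ring R t\<^esub> d) \<oplus>\<^bsub>mpoly_ring R t\<^esub> indexed_var i \<otimes>\<^bsub>mpoly_ring R t\<^esub> g"
      using step that(1) sub z by (auto simp: S.a_assoc subset_iff)
    then show ?thesis using IH[OF that(1) step(2)] step(3) by (simp add: horner_set.step)
  qed
  have "p \<oplus>\<^bsub>mpoly_ring R t\<^esub> q \<in> ?H" if "p \<in> ?H" "q \<in> ?H" for p q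
    using that
  proof (induction arbitrary: q)
    case (base c)
    then show ?case using one by simp
  next
    case (step c g)
    note c = step(1) and g = step(2) and IHg = step(3)
    from step(4) show ?case
    proof cases
      case base
      have "c \<oplus>\<^bsub>mpoly_ring R t\<^esub> indexed_var i \<otimes>\<^bsub>mpoly_ring R t\<^esub> g \<oplus>\<^bsub>mpoly_ring R t\<^esub> q
         = q \<oplus>\<^bsub>mpoly_ring R t\<^esub> (c \<oplus>\<^bsub>mpoly_ring R t\<^esub> indexed_var i \<otimes>\<^bsub>mpoly_ring R t\<^esub> g)"
        using c g base sub z by (intro S.a_comm) (auto simp: subset_iff)
      then show ?thesis using one[OF base horner_set.step[OF c g]] by simp
    next
      case (step d h)
      have cl: "c \<in> carrier (mpoly_ring R t)" "d \<in> carrier (mpoly_ring R t)"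
         "g \<in> carrier (mpoly_ring R t)" "h \<in> carrier (mpoly_ring R t)"
        using step c g sub by auto
      have "c \<oplus>\<^bsub>mpoly_ring R t\<^esub> indexed_var i \<otimes>\<^bsub>mpoly_ring R t\<^esub> g \<oplus>\<^bsub>mpoly_ring R t\<^esub> q
         = (c \<oplus>\<^bsub>mpoly_ring R t\<^esub> d) \<oplus>\<^bsub>mpoly_ring R t\<^esub> indexed_var i \<otimes>\<^bsub>mpoly_ring R t\<^esub> (g \<oplus>\<^bsub>mpoly_ring R t\<^esub> h)"
        unfolding step(1) using cl z by (simp add: S.a_ac S.r_distr)
      then show ?thesis
        using IH[OF c step(2)] IHg[OF step(3)] by (simp add: horner_set.step)
    qed
  qed
  then show ?case using Suc.prems by simp
qed

lemma initial_polys_zero: "i \<le> t \<Longrightarrow> \<zero>\<^bsub>mpoly_ring R t\<^esub> \<in> initial_polys t i"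
  by (induction i) (auto simp: mpoly_ring_simps intro: horner_set.base)

lemma initial_polys_var:
  "i \<le> t \<Longrightarrow> j < i \<Longrightarrow> p \<in> initial_polys t i \<Longrightarrow> indexed_var j \<otimes>\<^bsub>mpoly_ring R t\<^esub> p \<in> initial_polys t i"
proof (induction i arbitrary: p)
  case 0
  then show ?case by simp
next
  case (Suc i)
  interpret S: cring "mpoly_ring R t" by (rule mpoly_cring)
  let ?H = "horner_set (mpoly_ring R t) (indexed_var i) (initial_polys t i)"
  have sub: "initial_polys t i \<subseteq> carrier (mpoly_ring R t)" "?H \<subseteq> carrier (mpoly_ring R t)"
    using initial_polys_closed[of i t] initial_polys_closed[of "Suc i" t] Suc.prems(1) by simp_all
  have z: "indexed_var i \<in> carrier (mpoly_ring R t)" "indexed_var j \<in> carrier (mpoly_ring R t)"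
    using mpoly_var_closed Suc.prems by simp_all
  have p: "p \<in> ?H" using Suc.prems by simp
  show ?case
  proof (cases "j = i")
    case True
    \<comment> \<open>Multiplication by the newest variable prepends a zero constant term.\<close>
    have "\<zero>\<^bsub>mpoly_ring R t\<^esub> \<oplus>\<^bsub>mpoly_ring R t\<^esub> indexed_var i \<otimes>\<^bsub>mpoly_ring R t\<^esub> p \<in> ?H"
      using p Suc.prems(1) initial_polys_zero[of i t] by (intro horner_set.step) auto
    then show ?thesis using True p sub z by (auto simp: subset_iff)
  next
    case False
    note IH = Suc.IH[OF Suc_leD[OF Suc.prems(1)]]
    from p have "indexed_var j \<otimes>\<^bsub>mpoly_ring R t\<^esub> p \<in> ?H"
    proof induction
      case (base c)
      then show ?case using IH False Suc.prems by (simp add: horner_set.base)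
    next
      case (step c g)
      have "indexed_var j \<otimes>\<^bsub>mpoly_ring R t\<^esub> (c \<oplus>\<^bsub>mpoly_ring R t\<^esub> indexed_var i \<otimes>\<^bsub>mpoly_ring R t\<^esub> g)
        = indexed_var j \<otimes>\<^bsub>mpoly_ring R t\<^esub> c
          \<oplus>\<^bsub>mpoly_ring R t\<^esub> indexed_var i \<otimes>\<^bsub>mpoly_ring R t\<^esub> (indexed_var j \<otimes>\<^bsub>mpoly_ring R t\<^esub> g)"
        using step sub z by (auto simp: S.r_distr S.m_lcomm subset_iff)
      then show ?case using IH[of c] False Suc.prems step by (simp add: horner_set.step)
    qed
    then show ?thesis by simp
  qed
qed

lemma initial_polys_const: "c \<in> carrier R \<Longrightarrow> indexed_const c \<in> initial_polys t i"
  by (induction i) (auto intro: horner_set.base)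

text \<open>Since every polynomial is an iterated univariate one, a claim about all of them can be
  proved by induction on the number of variables.\<close>

lemma initial_polys_all: "initial_polys t t = carrier (mpoly_ring R t)"
proof
  show "initial_polys t t \<subseteq> carrier (mpoly_ring R t)" by (simp add: initial_polys_closed)
  show "carrier (mpoly_ring R t) \<subseteq> initial_polys t t"
  proof
    fix f assume "f \<in> carrier (mpoly_ring R t)"
    then show "f \<in> initial_polys t t"
      by (induction rule: mpoly_induct) (auto intro: initial_polys_const initial_polys_add initial_polys_var)
  qed
qed

lemma vectors_Pi: "x \<in> vectors R t \<Longrightarrow> x \<in> {..<t} \<rightarrow> carrier R"
  by (auto simp: vectors_def PiE_def)

lemma vectors_upd: "x \<in> vectors R t \<Longrightarrow> i < t \<Longrightarrow> s \<in> carrier R \<Longrightarrow> x(i := s) \<in> vectors R t"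
  by (auto simp: vectors_def PiE_def extensional_def)

lemma initial_polys_eval_upd:
  assumes "f \<in> initial_polys t i" "i \<le> j" "j < t" "x \<in> vectors R t" "s \<in> carrier R"
  shows "mpoly_eval R t (x(j := s)) f = mpoly_eval R t x f"
  using assms(1,2)
proof (induction i arbitrary: f)
  case 0
  then obtain c where c: "c \<in> carrier R" "f = indexed_const c" by auto
  show ?case
    unfolding c(2) mpoly_eval_const[OF vectors_Pi[OF vectors_upd[OF assms(4,3,5)]] c(1)]
      mpoly_eval_const[OF vectors_Pi[OF assms(4)] c(1)] ..
next
  case (Suc i)
  interpret S: cring "mpoly_ring R t" by (rule mpoly_cring)
  let ?H = "horner_set (mpoly_ring R t) (indexed_var i) (initial_polys t i)"
  have it: "i < t" "i \<noteq> j" using Suc assms by simp_all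
  have sub: "initial_polys t i \<subseteq> carrier (mpoly_ring R t)" "?H \<subseteq> carrier (mpoly_ring R t)"
    using initial_polys_closed[of i t] initial_polys_closed[of "Suc i" t] it by simp_all
  note x = vectors_Pi[OF vectors_upd[OF assms(4,3,5)]] vectors_Pi[OF assms(4)]
  have "f \<in> ?H" using Suc by simp
  then show ?case
  proof induction
    case (base c)
    then show ?case using Suc by simp
  next
    case (step c g)
    have c: "c \<in> carrier (mpoly_ring R t)" "g \<in> carrier (mpoly_ring R t)" using step sub by auto
    have ev: "mpoly_eval R t y (c \<oplus>\<^bsub>mpoly_ring R t\<^esub> indexed_var i \<otimes>\<^bsub>mpoly_ring R t\<^esub> g)
       = mpoly_eval R t y c \<oplus> y i \<otimes> mpoly_eval R t y g" if "y \<in> {..<t} \<rightarrow> carrier R" for y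
      using c mpoly_var_closed[OF it(1)] that
      by (simp add: mpoly_eval_add mpoly_eval_mult mpoly_eval_var[OF that it(1)])
    show ?case
      unfolding ev[OF x(1)] ev[OF x(2)] step.IH Suc.IH[OF step(1) Suc_leD[OF Suc.prems(2)]]
      using it by simp
  qed
qed

lemma extended_ideal_is_ideal:
  assumes "I \<subseteq> carrier R" shows "ideal (extended_ideal R t I) (mpoly_ring R t)"
proof -
  interpret S: cring "mpoly_ring R t" by (rule mpoly_cring)
  show ?thesis unfolding extended_ideal_def
    by (rule S.genideal_ideal) (use assms ring_hom_closed[OF mpoly_const_hom] in auto)
qed

text \<open>This is where R / P has to be infinite. Inside the induction on the number of variables
  runs an induction on the Horner form c + z_i g: first c, then g is shown to have all its values in
  \<open>P\<close>.\<close>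

lemma vanishing_imp_extended_ideal:
  assumes P: "primeideal P R" and inf: "infinite (carrier (R Quot P))"
  shows "i \<le> t \<Longrightarrow> f \<in> initial_polys t i \<Longrightarrow> \<forall>x\<in>vectors R t. mpoly_eval R t x f \<in> P
    \<Longrightarrow> f \<in> extended_ideal R t P"
proof (induction i arbitrary: f)
  note zeroR = zero_closed
  interpret S: cring "mpoly_ring R t" by (rule mpoly_cring)
  interpret primeideal P R by fact
  interpret E: ideal "extended_ideal R t P" "mpoly_ring R t" by (rule extended_ideal_is_ideal) (rule a_subset)
  {
    case 0
    then obtain c where c: "f = indexed_const c" "c \<in> carrier R" by auto
    have "(\<lambda>i\<in>{..<t}. \<zero>) \<in> vectors R t" by (auto simp: vectors_def)
    with 0(3) c have "c \<in> P" using mpoly_eval_const[OF vectors_Pi c(2)] by metis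
    moreover have "indexed_const ` P \<subseteq> carrier (mpoly_ring R t)"
      using a_subset ring_hom_closed[OF mpoly_const_hom] by auto
    ultimately show ?case
      using S.genideal_self c unfolding extended_ideal_def by blast
  }
  case (Suc i)
  let ?H = "horner_set (mpoly_ring R t) (indexed_var i) (initial_polys t i)"
  have it: "i < t" using Suc by simp
  have z: "indexed_var i \<in> carrier (mpoly_ring R t)" using mpoly_var_closed it .
  have sub: "initial_polys t i \<subseteq> carrier (mpoly_ring R t)" "?H \<subseteq> carrier (mpoly_ring R t)"
    using initial_polys_closed[of i t] initial_polys_closed[of "Suc i" t] it by simp_all
  have "f \<in> ?H" using Suc by simp
  then show ?case using Suc.prems(3)
  proof induction
    case (base c)
    then show ?case using Suc by simp
  next
    case (step c g)
    have cg: "c \<in> carrier (mpoly_ring R t)" "g \<in> carrier (mpoly_ring R t)" using step sub by auto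
    have ev: "mpoly_eval R t y (c \<oplus>\<^bsub>mpoly_ring R t\<^esub> indexed_var i \<otimes>\<^bsub>mpoly_ring R t\<^esub> g)
       = mpoly_eval R t y c \<oplus> y i \<otimes> mpoly_eval R t y g" if "y \<in> {..<t} \<rightarrow> carrier R" for y
      using cg z that by (simp add: mpoly_eval_add mpoly_eval_mult mpoly_eval_var[OF that it])
    \<comment> \<open>Setting coordinate \<open>i\<close> to zero leaves only \<open>c\<close>, and
      \<open>c\<close> does not depend on that coordinate.\<close>
    have c0: "mpoly_eval R t x c \<in> P" if x: "x \<in> vectors R t" for x
    proof -
      have x': "x(i := \<zero>) \<in> vectors R t" using vectors_upd[OF x it] by simp
      have "mpoly_eval R t (x(i := \<zero>)) c \<oplus> (x(i := \<zero>)) i \<otimes> mpoly_eval R t (x(i := \<zero>)) g \<in> P"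
        using step.prems x' ev[OF vectors_Pi[OF x']] by metis
      then have "mpoly_eval R t (x(i := \<zero>)) c \<in> P"
        using vectors_Pi[OF x'] cg by simp
      then show ?thesis
        using initial_polys_eval_upd[OF step(1) _ it x zeroR] by simp
    qed
    have g0: "x i \<otimes> mpoly_eval R t x g \<in> P" if x: "x \<in> vectors R t" for x
    proof -
      have cl: "mpoly_eval R t x c \<in> carrier R" "x i \<otimes> mpoly_eval R t x g \<in> carrier R"
        using vectors_Pi[OF x] cg it by (auto simp: Pi_def)
      have "mpoly_eval R t x c \<oplus> x i \<otimes> mpoly_eval R t x g \<in> P"
        using step.prems x ev[OF vectors_Pi[OF x]] by metis
      then have "(mpoly_eval R t x c \<oplus> x i \<otimes> mpoly_eval R t x g) \<ominus> mpoly_eval R t x c \<in> P"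
        using c0[OF x] by (simp add: minus_eq)
      moreover have "(mpoly_eval R t x c \<oplus> x i \<otimes> mpoly_eval R t x g) \<ominus> mpoly_eval R t x c
          = x i \<otimes> mpoly_eval R t x g"
        using cl by algebra
      ultimately show ?thesis by simp
    qed
    \<comment> \<open>Here s g(s) is in \<open>P\<close> for every value s of coordinate
      \<open>i\<close>, and the factor s has to be cancelled. If g had a value outside
      \<open>P\<close>, some s would have both s and g(s) outside \<open>P\<close>, against
      primeness.\<close>
    have "mpoly_eval R t x g \<in> P" if x: "x \<in> vectors R t" for x
    proof (rule ccontr)
      assume non: "mpoly_eval R t x g \<notin> P"
      define v where "v = (\<lambda>j. if j = i then \<one> else \<zero>)"
      have l: "(\<lambda>j\<in>{..<t}. (x(i := \<zero>)) j \<oplus> s \<otimes> v j) = x(i := s)" if "s \<in> carrier R" for s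
        using x that it by (auto simp: v_def vectors_def PiE_def extensional_def fun_eq_iff Pi_def)
      obtain cs where cs: "set cs \<subseteq> carrier R"
         "\<And>s. s \<in> carrier R \<Longrightarrow> mpoly_eval R t (x(i := s)) g = horner_val cs s"
        using polyfun_eval_line[OF vectors_upd[OF x it zeroR] _ cg(2), of v] l
        unfolding polyfun_def by (auto simp: v_def)
      have xi: "x i \<in> carrier R" using x it by (auto simp: vectors_def)
      have "horner_val cs (x i) \<notin> P" using cs(2)[OF xi] non by simp
      \<comment> \<open>The list \<open>[\<zero>, \<one>]\<close> is the polynomial s itself, with
        value one at one.\<close>
      moreover have "horner_val [\<zero>, \<one>] \<one> \<notin> P" using one_imp_carrier I_notcarr by auto
      ultimately obtain s where s: "s \<in> carrier R" "horner_val cs s \<notin> P" "horner_val [\<zero>, \<one>] s \<notin> P"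
        using common_nonroot[OF P inf cs(1) xi _ _ one_closed, of "[\<zero>, \<one>]"] by auto
      have "s \<otimes> horner_val cs s \<in> P"
        using g0[OF vectors_upd[OF x it s(1)]] cs(2)[OF s(1)] by simp
      then show False using s I_prime[of s "horner_val cs s"] cs(1) by simp
    qed
    then have "g \<in> extended_ideal R t P" using step.IH by simp
    moreover have "c \<in> extended_ideal R t P" using Suc.IH[of c] it step(1) c0 by simp
    ultimately show ?case using z by (simp add: E.I_l_closed)
  qed
qed

text \<open>Membership in the extended ideal becomes a statement about values. For \<mm> this
  identifies \<open>nonvan 0\<close> with the complement of \<mm>S.\<close>

lemma extended_ideal_iff:
  assumes P: "primeideal P R" and inf: "infinite (carrier (R Quot P))"
    and f: "f \<in> carrier (mpoly_ring R t)"
  shows "f \<in> extended_ideal R t P \<longleftrightarrow> (\<forall>x\<in>vectors R t. mpoly_eval R t x f \<in> P)"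
proof
  interpret S: cring "mpoly_ring R t" by (rule mpoly_cring)
  interpret primeideal P R by fact
  assume fE: "f \<in> extended_ideal R t P"
  show "\<forall>x\<in>vectors R t. mpoly_eval R t x f \<in> P"
  proof
    fix x assume x: "x \<in> vectors R t"
    interpret h: ring_hom_ring "mpoly_ring R t" R "mpoly_eval R t x"
      by (rule ring_hom_ringI2[OF S.ring_axioms ring_axioms mpoly_eval_hom[OF vectors_Pi[OF x]]])
    have "ideal {r \<in> carrier (mpoly_ring R t). mpoly_eval R t x r \<in> P} (mpoly_ring R t)"
      by (rule h.ideal_vimage) (rule is_ideal)
    moreover have "indexed_const ` P \<subseteq> {r \<in> carrier (mpoly_ring R t). mpoly_eval R t x r \<in> P}"
      using a_subset ring_hom_closed[OF mpoly_const_hom] vectors_Pi[OF x] by auto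
    ultimately have "extended_ideal R t P \<subseteq> {r \<in> carrier (mpoly_ring R t). mpoly_eval R t x r \<in> P}"
      unfolding extended_ideal_def by (rule S.genideal_minimal)
    then show "mpoly_eval R t x f \<in> P" using fE by auto
  qed
next
  assume "\<forall>x\<in>vectors R t. mpoly_eval R t x f \<in> P"
  then show "f \<in> extended_ideal R t P"
    using vanishing_imp_extended_ideal[OF P inf le_refl] f initial_polys_all by blast
qed

end

section \<open>Base change\<close>

lemma free_Abelian_subgroupI:
  assumes "\<And>c. c \<in> H \<Longrightarrow> Poly_Mapping.keys c \<subseteq> S" "0 \<in> H" "\<And>c d. c \<in> H \<Longrightarrow> d \<in> H \<Longrightarrow> c - d \<in> H"
  shows "subgroup H (free_Abelian_group S)"
proof (rule group.subgroupI[OF group_free_Abelian_group])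
  show "H \<subseteq> carrier (free_Abelian_group S)" using assms(1) by auto
  show "H \<noteq> {}" using assms(2) by auto
  have neg: "- c \<in> H" if "c \<in> H" for c using assms(3)[OF assms(2) that] by simp
  then show "inv\<^bsub>free_Abelian_group S\<^esub> c \<in> H" if "c \<in> H" for c
    using that assms(1) by simp
  show "c \<otimes>\<^bsub>free_Abelian_group S\<^esub> d \<in> H" if "c \<in> H" "d \<in> H" for c d
    using assms(3)[OF that(1) neg[OF that(2)]] by simp
qed

locale scalar_extension = L: module A L + B: cring B
  for A :: "('a, 'r) ring_scheme" and B :: "('c, 'q) ring_scheme" and \<phi> :: "'a \<Rightarrow> 'c"
    and L :: "('a, 'b, 'm) module_scheme" +
  assumes hom: "\<phi> \<in> ring_hom A B"
begin

abbreviation "F \<equiv> tensor_free B L"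
abbreviation "T \<equiv> tensor_rels A B \<phi> L"
abbreviation "BC \<equiv> base_change A B \<phi> L"
abbreviation "pt \<equiv> pure_tensor A B \<phi> L"
abbreviation coset where "coset c \<equiv> T #>\<^bsub>F\<^esub> c"

lemma phi_closed [simp]: "a \<in> carrier A \<Longrightarrow> \<phi> a \<in> carrier B"
  using hom by (rule ring_hom_closed)

text \<open>The carrier of the free abelian group as a plain set of finitely supported functions, so
  that computations use the type class operations on them instead of the group record.\<close>

definition fc :: "('b \<times> 'c \<Rightarrow>\<^sub>0 int) set" where
  "fc = {c. Poly_Mapping.keys c \<subseteq> carrier L \<times> carrier B}"

lemma fc_zero [simp]: "0 \<in> fc"
  and fc_uminus [simp]: "- c \<in> fc \<longleftrightarrow> c \<in> fc"
  and frag_in [simp]: "frag_of (x, b) \<in> fc \<longleftrightarrow> x \<in> carrier L \<and> b \<in> carrier B"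
  by (simp_all add: fc_def)

lemma fc_add [simp]: "c \<in> fc \<Longrightarrow> d \<in> fc \<Longrightarrow> c + d \<in> fc"
  unfolding fc_def mem_Collect_eq by (rule order_trans[OF keys_add Un_least])

lemma fc_diff [simp]: "c \<in> fc \<Longrightarrow> d \<in> fc \<Longrightarrow> c - d \<in> fc"
  unfolding fc_def mem_Collect_eq by (rule order_trans[OF keys_diff Un_least])

lemma fc_induct [consumes 1, case_names zero diff gen]:
  assumes "c \<in> fc" and "P 0"
    and "\<And>c d. c \<in> fc \<Longrightarrow> d \<in> fc \<Longrightarrow> P c \<Longrightarrow> P d \<Longrightarrow> P (c - d)"
    and "\<And>x b. x \<in> carrier L \<Longrightarrow> b \<in> carrier B \<Longrightarrow> P (frag_of (x, b))"
  shows "P c"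
  by (rule free_Abelian_group_induct[of c "carrier L \<times> carrier B"]) (use assms in \<open>auto simp: fc_def\<close>)

definition gens :: "('b \<times> 'c \<Rightarrow>\<^sub>0 int) set" where
  "gens = {frag_of (x \<oplus>\<^bsub>L\<^esub> y, b) - frag_of (x, b) - frag_of (y, b) | x y b.
         x \<in> carrier L \<and> y \<in> carrier L \<and> b \<in> carrier B} \<union>
      {frag_of (x, b \<oplus>\<^bsub>B\<^esub> c) - frag_of (x, b) - frag_of (x, c) | x b c.
         x \<in> carrier L \<and> b \<in> carrier B \<and> c \<in> carrier B} \<union>
      {frag_of (a \<odot>\<^bsub>L\<^esub> x, b) - frag_of (x, \<phi> a \<otimes>\<^bsub>B\<^esub> b) | a x b.
         a \<in> carrier A \<and> x \<in> carrier L \<and> b \<in> carrier B}"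

lemma T_eq: "T = generate F gens"
  unfolding tensor_rels_def gens_def ..

lemma gens_left:
  "x \<in> carrier L \<Longrightarrow> y \<in> carrier L \<Longrightarrow> b \<in> carrier B
    \<Longrightarrow> frag_of (x \<oplus>\<^bsub>L\<^esub> y, b) - frag_of (x, b) - frag_of (y, b) \<in> gens"
  unfolding gens_def by blast

lemma gens_right:
  "x \<in> carrier L \<Longrightarrow> b \<in> carrier B \<Longrightarrow> c \<in> carrier B
    \<Longrightarrow> frag_of (x, b \<oplus>\<^bsub>B\<^esub> c) - frag_of (x, b) - frag_of (x, c) \<in> gens"
  unfolding gens_def by blast

lemma gens_balance:
  "a \<in> carrier A \<Longrightarrow> x \<in> carrier L \<Longrightarrow> b \<in> carrier B
    \<Longrightarrow> frag_of (a \<odot>\<^bsub>L\<^esub> x, b) - frag_of (x, \<phi> a \<otimes>\<^bsub>B\<^esub> b) \<in> gens"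
  unfolding gens_def by blast

lemma gens_closed: "gens \<subseteq> fc"
proof
  fix g assume "g \<in> gens"
  then show "g \<in> fc"
    unfolding gens_def by (elim UnE CollectE exE conjE) simp_all
qed

lemma F_group: "comm_group F"
  unfolding tensor_free_def by (rule abelian_free_Abelian_group)

lemma F_simps [simp]:
  "carrier F = fc" "c \<otimes>\<^bsub>F\<^esub> d = c + d" "\<one>\<^bsub>F\<^esub> = 0"
  unfolding tensor_free_def fc_def by auto

lemma F_inv [simp]: "c \<in> fc \<Longrightarrow> inv\<^bsub>F\<^esub> c = - c"
  unfolding tensor_free_def fc_def by simp

lemma T_subgroup: "subgroup T F"
  unfolding T_eq by (rule group.generate_is_subgroup) (use F_group gens_closed in \<open>auto simp: comm_group_def\<close>)

lemma T_closed: "T \<subseteq> fc"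
  using subgroup.subset[OF T_subgroup] by simp

lemma T_zero: "0 \<in> T"
  using subgroup.one_closed[OF T_subgroup] by simp

lemma T_minus: "c \<in> T \<Longrightarrow> - c \<in> T"
  using subgroup.m_inv_closed[OF T_subgroup, of c] F_inv[of c] subsetD[OF T_closed, of c] by simp

lemma T_add: "c \<in> T \<Longrightarrow> d \<in> T \<Longrightarrow> c + d \<in> T"
  using subgroup.m_closed[OF T_subgroup] by simp

lemma T_diff: "c \<in> T \<Longrightarrow> d \<in> T \<Longrightarrow> c - d \<in> T"
  using T_add[of c "- d"] T_minus[of d] by simp

text \<open>Minimality of the relation subgroup, tested on generators and differences. A map meant
  to factor through the tensor product is shown in this way to respect the relations.\<close>

lemma T_subset:
  assumes "gens \<subseteq> H" "H \<subseteq> fc" "0 \<in> H" "\<And>c d. c \<in> H \<Longrightarrow> d \<in> H \<Longrightarrow> c - d \<in> H"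
  shows "T \<subseteq> H"
proof -
  have "subgroup H F"
    unfolding tensor_free_def by (rule free_Abelian_subgroupI) (use assms in \<open>auto simp: fc_def\<close>)
  then show ?thesis
    unfolding T_eq using F_group assms(1) group.generate_subgroup_incl unfolding comm_group_def by blast
qed

lemma coset_mem: "d \<in> coset c \<longleftrightarrow> d - c \<in> T"
proof -
  have "d \<in> coset c \<longleftrightarrow> (\<exists>e\<in>T. d = e + c)" unfolding r_coset_def by auto
  also have "\<dots> \<longleftrightarrow> d - c \<in> T" by (metis add_diff_cancel_right' diff_add_cancel)
  finally show ?thesis .
qed

lemma coset_eq: "coset c = coset d \<longleftrightarrow> c - d \<in> T"
proof
  assume "coset c = coset d"
  then have "c \<in> coset d" using coset_mem[of c c] T_zero by simp
  then show "c - d \<in> T" by (simp add: coset_mem)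
next
  assume cd: "c - d \<in> T"
  have "x - c \<in> T \<longleftrightarrow> x - d \<in> T" for x
  proof
    assume "x - c \<in> T"
    from T_add[OF this cd] show "x - d \<in> T" by simp
  next
    assume "x - d \<in> T"
    from T_diff[OF this cd] show "x - c \<in> T" by simp
  qed
  then show "coset c = coset d" by (auto simp: coset_mem)
qed

lemma BC_carrier: "carrier BC = coset ` fc"
  by (auto simp: base_change_def RCOSETS_def)

lemma BC_zero: "\<zero>\<^bsub>BC\<^esub> = coset 0"
  by (auto simp: base_change_def coset_mem)

lemma BC_add:
  assumes "c \<in> fc" "d \<in> fc" shows "coset c \<oplus>\<^bsub>BC\<^esub> coset d = coset (c + d)"
proof -
  have "T \<lhd> F" using comm_group.subgroup_imp_normal[OF F_group T_subgroup] .
  from normal.rcos_sum[OF this, of c d] assms show ?thesis by (simp add: base_change_def)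
qed

definition mul :: "'c \<Rightarrow> ('b \<times> 'c \<Rightarrow>\<^sub>0 int) \<Rightarrow> ('b \<times> 'c \<Rightarrow>\<^sub>0 int)" where
  "mul b = frag_extend (\<lambda>(x, b'). frag_of (x, b \<otimes>\<^bsub>B\<^esub> b'))"

lemma mul_diff: "mul b (c - d) = mul b c - mul b d"
  unfolding mul_def by (rule frag_extend_diff)

lemma mul_of [simp]: "mul b (frag_of (x, b')) = frag_of (x, b \<otimes>\<^bsub>B\<^esub> b')"
  unfolding mul_def by simp

lemma mul_zero [simp]: "mul b 0 = 0"
  unfolding mul_def by simp

lemma mul_closed [simp]: "b \<in> carrier B \<Longrightarrow> c \<in> fc \<Longrightarrow> mul b c \<in> fc"
  by (rotate_tac, induction rule: fc_induct) (simp_all add: mul_diff)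

lemma mul_T:
  assumes b: "b \<in> carrier B" and c: "c \<in> T" shows "mul b c \<in> T"
proof -
  have "T \<subseteq> {c \<in> fc. mul b c \<in> T}"
  proof (rule T_subset)
    show "gens \<subseteq> {c \<in> fc. mul b c \<in> T}"
    proof
      fix g assume g: "g \<in> gens"
      then have "mul b g \<in> gens"
      proof (subst (asm) gens_def, elim UnE CollectE exE conjE)
        fix x y c assume "g = frag_of (x \<oplus>\<^bsub>L\<^esub> y, c) - frag_of (x, c) - frag_of (y, c)"
          "x \<in> carrier L" "y \<in> carrier L" "c \<in> carrier B"
        then show ?thesis using gens_left[of x y "b \<otimes>\<^bsub>B\<^esub> c"] b by (simp add: mul_diff)
      next
        fix x c d assume "g = frag_of (x, c \<oplus>\<^bsub>B\<^esub> d) - frag_of (x, c) - frag_of (x, d)"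
          "x \<in> carrier L" "c \<in> carrier B" "d \<in> carrier B"
        then show ?thesis
          using gens_right[of x "b \<otimes>\<^bsub>B\<^esub> c" "b \<otimes>\<^bsub>B\<^esub> d"] b by (simp add: mul_diff B.r_distr)
      next
        fix a x c assume "g = frag_of (a \<odot>\<^bsub>L\<^esub> x, c) - frag_of (x, \<phi> a \<otimes>\<^bsub>B\<^esub> c)"
          "a \<in> carrier A" "x \<in> carrier L" "c \<in> carrier B"
        then show ?thesis
          using gens_balance[of a x "b \<otimes>\<^bsub>B\<^esub> c"] b by (simp add: mul_diff B.m_lcomm)
      qed
      then show "g \<in> {c \<in> fc. mul b c \<in> T}"
        using subsetD[OF gens_closed g] generate.incl[of "mul b g" gens F] by (simp add: T_eq)
    qed
  qed (auto simp: mul_diff T_zero T_diff)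
  then show ?thesis using c by auto
qed

lemma BC_smult:
  assumes b: "b \<in> carrier B" and c: "c \<in> fc" shows "b \<odot>\<^bsub>BC\<^esub> coset c = coset (mul b c)"
proof -
  \<comment> \<open>The scalar product is defined as a union over all representatives; by
    \<open>mul_T\<close> they all yield the same coset.\<close>
  have "coset (mul b d) = coset (mul b c)" if "d \<in> coset c" for d
    using mul_T[OF b, of "d - c"] that by (simp add: coset_eq coset_mem mul_diff)
  moreover have "c \<in> coset c" by (simp add: coset_mem T_zero)
  ultimately have "(\<Union>d\<in>coset c. coset (mul b d)) = coset (mul b c)" by blast
  then show ?thesis by (simp add: base_change_def mul_def)
qed

lemma pt_coset: "pt x b = coset (frag_of (x, b))"
  by (simp add: pure_tensor_def)

lemma pt_closed [simp]: "x \<in> carrier L \<Longrightarrow> b \<in> carrier B \<Longrightarrow> pt x b \<in> carrier BC"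
  unfolding pt_coset BC_carrier by simp

lemma gens_T: "g \<in> gens \<Longrightarrow> g \<in> T"
  unfolding T_eq by (rule generate.incl)

lemma pt_add_left:
  assumes "x \<in> carrier L" "y \<in> carrier L" "b \<in> carrier B"
  shows "pt (x \<oplus>\<^bsub>L\<^esub> y) b = pt x b \<oplus>\<^bsub>BC\<^esub> pt y b"
proof -
  show ?thesis
    using gens_T[OF gens_left[OF assms]] assms by (simp add: pt_coset BC_add coset_eq diff_diff_eq)
qed

lemma pt_add_right:
  assumes "x \<in> carrier L" "b \<in> carrier B" "c \<in> carrier B"
  shows "pt x (b \<oplus>\<^bsub>B\<^esub> c) = pt x b \<oplus>\<^bsub>BC\<^esub> pt x c"
proof -
  show ?thesis
    using gens_T[OF gens_right[OF assms]] assms by (simp add: pt_coset BC_add coset_eq diff_diff_eq)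
qed

lemma pt_balance:
  assumes "a \<in> carrier A" "x \<in> carrier L" "b \<in> carrier B"
  shows "pt (a \<odot>\<^bsub>L\<^esub> x) b = pt x (\<phi> a \<otimes>\<^bsub>B\<^esub> b)"
proof -
  show ?thesis
    using gens_T[OF gens_balance[OF assms]] by (simp add: pt_coset coset_eq)
qed

lemma smult_pt:
  "x \<in> carrier L \<Longrightarrow> b \<in> carrier B \<Longrightarrow> c \<in> carrier B \<Longrightarrow> b \<odot>\<^bsub>BC\<^esub> pt x c = pt x (b \<otimes>\<^bsub>B\<^esub> c)"
  by (simp add: pt_coset BC_smult)

lemma BC_abelian: "abelian_group BC"
proof (rule abelian_groupI)
  fix C D E assume C: "C \<in> carrier BC" and D: "D \<in> carrier BC" and E: "E \<in> carrier BC"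
  obtain c where c: "C = coset c" "c \<in> fc" using C by (auto simp: BC_carrier)
  obtain d where d: "D = coset d" "d \<in> fc" using D by (auto simp: BC_carrier)
  obtain e where e: "E = coset e" "e \<in> fc" using E by (auto simp: BC_carrier)
  have cl: "c + d \<in> fc" "d + e \<in> fc" "- c \<in> fc" using c d e by auto
  show "C \<oplus>\<^bsub>BC\<^esub> D \<in> carrier BC" using c d cl by (simp add: BC_add BC_carrier)
  show "C \<oplus>\<^bsub>BC\<^esub> D = D \<oplus>\<^bsub>BC\<^esub> C" using c d by (simp add: BC_add add.commute)
  show "C \<oplus>\<^bsub>BC\<^esub> D \<oplus>\<^bsub>BC\<^esub> E = C \<oplus>\<^bsub>BC\<^esub> (D \<oplus>\<^bsub>BC\<^esub> E)"
    using BC_add[OF c(2) d(2)] BC_add[OF d(2) e(2)] BC_add[OF cl(1) e(2)] BC_add[OF c(2) cl(2)] c d e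
    by (simp add: add.assoc)
  show "\<zero>\<^bsub>BC\<^esub> \<oplus>\<^bsub>BC\<^esub> C = C" using c BC_add[of 0 c] by (simp add: BC_zero)
  show "\<exists>y\<in>carrier BC. y \<oplus>\<^bsub>BC\<^esub> C = \<zero>\<^bsub>BC\<^esub>"
    using BC_add[OF cl(3) c(2)] c cl by (intro bexI[of _ "coset (- c)"]) (auto simp: BC_zero BC_carrier)
next
  show "\<zero>\<^bsub>BC\<^esub> \<in> carrier BC" unfolding BC_zero BC_carrier by simp
qed

lemma mul_add_scalar_T:
  assumes b: "b \<in> carrier B" "c \<in> carrier B" and d: "d \<in> fc"
  shows "mul (b \<oplus>\<^bsub>B\<^esub> c) d - (mul b d + mul c d) \<in> T"
  using d
proof (induction rule: fc_induct)
  case zero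
  then show ?case by (simp add: T_zero)
next
  case (diff x y)
  from T_diff[OF diff(3,4)] show ?case by (simp add: mul_diff algebra_simps)
next
  case (gen x b')
  from gens_right[of x "b \<otimes>\<^bsub>B\<^esub> b'" "c \<otimes>\<^bsub>B\<^esub> b'"] gen b gens_T show ?case
    by (simp add: B.l_distr diff_diff_eq)
qed

lemma mul_assoc:
  assumes b: "b \<in> carrier B" "c \<in> carrier B" and d: "d \<in> fc"
  shows "mul (b \<otimes>\<^bsub>B\<^esub> c) d = mul b (mul c d)"
  using d by (induction rule: fc_induct) (use b in \<open>simp_all add: mul_diff B.m_assoc\<close>)

lemma mul_one:
  assumes d: "d \<in> fc" shows "mul \<one>\<^bsub>B\<^esub> d = d"
  using d by (induction rule: fc_induct) (simp_all add: mul_diff)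

lemma mul_add: "mul b (c + d) = mul b c + mul b d"
  unfolding mul_def by (rule frag_extend_add)

lemma BC_module: "module B BC"
proof (rule moduleI[OF B.cring_axioms BC_abelian])
  fix a b C D assume a: "a \<in> carrier B" and C: "C \<in> carrier BC"
  obtain c where c: "C = coset c" "c \<in> fc" using C by (auto simp: BC_carrier)
  show "a \<odot>\<^bsub>BC\<^esub> C \<in> carrier BC"
    using a c by (simp add: BC_smult BC_carrier)
  {
    assume D: "D \<in> carrier BC"
    obtain d where d: "D = coset d" "d \<in> fc" using D by (auto simp: BC_carrier)
    show "a \<odot>\<^bsub>BC\<^esub> (C \<oplus>\<^bsub>BC\<^esub> D) = a \<odot>\<^bsub>BC\<^esub> C \<oplus>\<^bsub>BC\<^esub> a \<odot>\<^bsub>BC\<^esub> D"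
      using a c d by (simp add: BC_add BC_smult mul_add)
  }
  assume b: "b \<in> carrier B"
  show "(a \<oplus>\<^bsub>B\<^esub> b) \<odot>\<^bsub>BC\<^esub> C = a \<odot>\<^bsub>BC\<^esub> C \<oplus>\<^bsub>BC\<^esub> b \<odot>\<^bsub>BC\<^esub> C"
    using mul_add_scalar_T[OF a b c(2)] a b c by (simp add: BC_add BC_smult coset_eq)
  show "(a \<otimes>\<^bsub>B\<^esub> b) \<odot>\<^bsub>BC\<^esub> C = a \<odot>\<^bsub>BC\<^esub> (b \<odot>\<^bsub>BC\<^esub> C)"
    using a b c by (simp add: BC_smult mul_assoc)
qed (auto simp: BC_carrier BC_smult mul_one)

text \<open>Since the negative of a pure tensor is again a pure tensor, sums of pure tensors already
  exhaust the module; \<open>BC_induct\<close> depends on this.\<close>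

lemma coset_minus_pt:
  assumes "x \<in> carrier L" "b \<in> carrier B"
  shows "coset (- frag_of (x, b)) = pt x (\<ominus>\<^bsub>B\<^esub> b)"
proof -
  interpret BC: module B BC by (rule BC_module)
  have eq: "pt x b = pt x b \<oplus>\<^bsub>BC\<^esub> pt x \<zero>\<^bsub>B\<^esub>"
    using pt_add_right[OF assms B.zero_closed] assms by simp
  then have "pt x \<zero>\<^bsub>B\<^esub> = \<zero>\<^bsub>BC\<^esub>"
    using assms by (metis B.zero_closed BC.add.l_cancel_one' pt_closed)
  then have 1: "pt x b \<oplus>\<^bsub>BC\<^esub> pt x (\<ominus>\<^bsub>B\<^esub> b) = \<zero>\<^bsub>BC\<^esub>"
    using pt_add_right[OF assms B.a_inv_closed[OF assms(2)]] assms by (simp add: B.r_neg)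
  have m: "coset (- frag_of (x, b)) \<in> carrier BC" using assms by (simp add: BC_carrier)
  have "pt x b \<oplus>\<^bsub>BC\<^esub> coset (- frag_of (x, b)) = \<zero>\<^bsub>BC\<^esub>"
    unfolding pt_coset BC_zero using BC_add[of "frag_of (x, b)" "- frag_of (x, b)"] assms by simp
  with 1 have "pt x b \<oplus>\<^bsub>BC\<^esub> coset (- frag_of (x, b)) = pt x b \<oplus>\<^bsub>BC\<^esub> pt x (\<ominus>\<^bsub>B\<^esub> b)" by simp
  then show ?thesis
    using BC.add.l_cancel[of "pt x b" "coset (- frag_of (x, b))" "pt x (\<ominus>\<^bsub>B\<^esub> b)"] assms m by simp
qed

lemma BC_induct [consumes 1, case_names zero pt add]:
  assumes "C \<in> carrier BC"
    and "P \<zero>\<^bsub>BC\<^esub>"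
    and "\<And>x b. x \<in> carrier L \<Longrightarrow> b \<in> carrier B \<Longrightarrow> P (pt x b)"
    and "\<And>C D. C \<in> carrier BC \<Longrightarrow> D \<in> carrier BC \<Longrightarrow> P C \<Longrightarrow> P D \<Longrightarrow> P (C \<oplus>\<^bsub>BC\<^esub> D)"
  shows "P C"
proof -
  obtain c where c: "C = coset c" "c \<in> fc" using assms(1) by (auto simp: BC_carrier)
  \<comment> \<open>Induction on the free group proceeds by differences, while \<open>P\<close> is
    only known to respect sums. Carrying the negative along closes the gap.\<close>
  from c(2) have "P (coset c) \<and> P (coset (- c))"
  proof (induction rule: fc_induct)
    case zero
    then show ?case using assms(2) by (simp add: BC_zero)
  next
    case (diff x y)
    have cl: "coset x \<in> carrier BC" "coset y \<in> carrier BC" "coset (- x) \<in> carrier BC" "coset (- y) \<in> carrier BC"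
      using diff by (simp_all add: BC_carrier)
    have "P (coset x \<oplus>\<^bsub>BC\<^esub> coset (- y))" "P (coset (- x) \<oplus>\<^bsub>BC\<^esub> coset y)"
      using assms(4) cl diff by blast+
    then show ?case using diff(1,2) by (simp add: BC_add add.commute)
  next
    case (gen x b)
    then show ?case
      using assms(3)[OF gen] assms(3)[OF gen(1) B.a_inv_closed[OF gen(2)]] coset_minus_pt[OF gen]
      by (simp add: pt_coset)
  qed
  then show ?thesis using c by simp
qed

text \<open>The universal property for biadditive balanced maps into an abelian group. Compatibility
  with scalars is a separate matter, because the target may be a module over another ring than
  \<open>B\<close>.\<close>

lemma BC_universal:
  fixes G :: "('d, 's) ring_scheme"
  assumes G: "abelian_group G"
    and cl: "\<And>x b. x \<in> carrier L \<Longrightarrow> b \<in> carrier B \<Longrightarrow> f x b \<in> carrier G"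
    and addl: "\<And>x y b. x \<in> carrier L \<Longrightarrow> y \<in> carrier L \<Longrightarrow> b \<in> carrier B \<Longrightarrow> f (x \<oplus>\<^bsub>L\<^esub> y) b = f x b \<oplus>\<^bsub>G\<^esub> f y b"
    and addr: "\<And>x b c. x \<in> carrier L \<Longrightarrow> b \<in> carrier B \<Longrightarrow> c \<in> carrier B \<Longrightarrow> f x (b \<oplus>\<^bsub>B\<^esub> c) = f x b \<oplus>\<^bsub>G\<^esub> f x c"
    and bal: "\<And>a x b. a \<in> carrier A \<Longrightarrow> x \<in> carrier L \<Longrightarrow> b \<in> carrier B \<Longrightarrow> f (a \<odot>\<^bsub>L\<^esub> x) b = f x (\<phi> a \<otimes>\<^bsub>B\<^esub> b)"
  obtains h where "\<And>C. C \<in> carrier BC \<Longrightarrow> h C \<in> carrier G"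
    "\<And>x b. x \<in> carrier L \<Longrightarrow> b \<in> carrier B \<Longrightarrow> h (pt x b) = f x b"
    "\<And>C D. C \<in> carrier BC \<Longrightarrow> D \<in> carrier BC \<Longrightarrow> h (C \<oplus>\<^bsub>BC\<^esub> D) = h C \<oplus>\<^bsub>G\<^esub> h D"
    "h \<zero>\<^bsub>BC\<^esub> = \<zero>\<^bsub>G\<^esub>"
proof -
  interpret G: abelian_group G by fact
  obtain g where g: "g \<in> hom (free_Abelian_group (carrier L \<times> carrier B)) (add_monoid G)"
    "\<And>p. p \<in> carrier L \<times> carrier B \<Longrightarrow> g (frag_of p) = (\<lambda>(x, b). f x b) p"
    using comm_group.free_Abelian_group_universal[OF G.a_comm_group, of "\<lambda>(x, b). f x b" "carrier L \<times> carrier B"] cl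
    by (auto simp: image_subset_iff)
  have gcl: "g c \<in> carrier G" if "c \<in> fc" for c
    using Group.hom_in_carrier[OF g(1), of c] that by (simp add: fc_def)
  have gadd: "g (c + d) = g c \<oplus>\<^bsub>G\<^esub> g d" if "c \<in> fc" "d \<in> fc" for c d
    using hom_mult[OF g(1), of c d] that by (simp add: fc_def)
  have gof: "g (frag_of (x, b)) = f x b" if "x \<in> carrier L" "b \<in> carrier B" for x b
    using g(2)[of "(x, b)"] that by simp
  have "g 0 \<oplus>\<^bsub>G\<^esub> g 0 = g 0" using gadd[of 0 0] by simp
  then have g0: "g 0 = \<zero>\<^bsub>G\<^esub>"
    using gcl[of 0] by simp
  have gdiff: "g (c - d) = g c \<ominus>\<^bsub>G\<^esub> g d" if "c \<in> fc" "d \<in> fc" for c d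
  proof -
    have "g c = g (c - d) \<oplus>\<^bsub>G\<^esub> g d" "g (c - d) \<in> carrier G"
      using gadd[of "c - d" d] that gcl by auto
    then show ?thesis
      using gcl[OF that(2)] by (simp add: G.minus_eq G.a_assoc G.r_neg)
  qed
  have gT: "g c = \<zero>\<^bsub>G\<^esub>" if "c \<in> T" for c
  proof -
    have "T \<subseteq> {c \<in> fc. g c = \<zero>\<^bsub>G\<^esub>}"
    proof (rule T_subset)
      show "gens \<subseteq> {c \<in> fc. g c = \<zero>\<^bsub>G\<^esub>}"
      proof
        fix r assume r: "r \<in> gens"
        then have "r \<in> fc" using gens_closed by auto
        moreover have "g r = \<zero>\<^bsub>G\<^esub>"
          using r
        proof (subst (asm) gens_def, elim UnE CollectE exE conjE)
          fix x y b assume *: "r = frag_of (x \<oplus>\<^bsub>L\<^esub> y, b) - frag_of (x, b) - frag_of (y, b)"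
            "x \<in> carrier L" "y \<in> carrier L" "b \<in> carrier B"
          then have "g r = f (x \<oplus>\<^bsub>L\<^esub> y) b \<ominus>\<^bsub>G\<^esub> (f x b \<oplus>\<^bsub>G\<^esub> f y b)"
            using gdiff[of "frag_of (x \<oplus>\<^bsub>L\<^esub> y, b)" "frag_of (x, b) + frag_of (y, b)"]
            by (simp add: gadd gof diff_diff_eq)
          then show ?thesis using addl cl * by (simp add: G.minus_eq G.r_neg)
        next
          fix x b c assume *: "r = frag_of (x, b \<oplus>\<^bsub>B\<^esub> c) - frag_of (x, b) - frag_of (x, c)"
            "x \<in> carrier L" "b \<in> carrier B" "c \<in> carrier B"
          then have "g r = f x (b \<oplus>\<^bsub>B\<^esub> c) \<ominus>\<^bsub>G\<^esub> (f x b \<oplus>\<^bsub>G\<^esub> f x c)"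
            using gdiff[of "frag_of (x, b \<oplus>\<^bsub>B\<^esub> c)" "frag_of (x, b) + frag_of (x, c)"]
            by (simp add: gadd gof diff_diff_eq)
          then show ?thesis using addr cl * by (simp add: G.minus_eq G.r_neg)
        next
          fix a x b assume *: "r = frag_of (a \<odot>\<^bsub>L\<^esub> x, b) - frag_of (x, \<phi> a \<otimes>\<^bsub>B\<^esub> b)"
            "a \<in> carrier A" "x \<in> carrier L" "b \<in> carrier B"
          then have "g r = f (a \<odot>\<^bsub>L\<^esub> x) b \<ominus>\<^bsub>G\<^esub> f x (\<phi> a \<otimes>\<^bsub>B\<^esub> b)"
            by (simp add: gdiff gof)
          then show ?thesis using bal cl * by (simp add: G.minus_eq G.r_neg)
        qed
        ultimately show "r \<in> {c \<in> fc. g c = \<zero>\<^bsub>G\<^esub>}" by simp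
      qed
      fix c d assume "c \<in> {c \<in> fc. g c = \<zero>\<^bsub>G\<^esub>}" "d \<in> {c \<in> fc. g c = \<zero>\<^bsub>G\<^esub>}"
      then show "c - d \<in> {c \<in> fc. g c = \<zero>\<^bsub>G\<^esub>}"
        using gdiff by (auto simp: G.minus_eq)
    qed (use g0 in auto)
    then show ?thesis using that by auto
  qed
  \<comment> \<open>The value is taken at a chosen representative; it does not depend on the choice
    because \<open>g\<close> kills the relations.\<close>
  define h where "h C = g (SOME c. c \<in> fc \<and> coset c = C)" for C
  have h: "h (coset c) = g c" if c: "c \<in> fc" for c
  proof -
    let ?d = "SOME d. d \<in> fc \<and> coset d = coset c"
    have d: "?d \<in> fc" "coset ?d = coset c"
      using someI[of "\<lambda>d. d \<in> fc \<and> coset d = coset c" c] c by auto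
    have "g (?d - c) = \<zero>\<^bsub>G\<^esub>" using d(2) gT by (simp add: coset_eq)
    then have "g ?d = g c" using gadd[of "?d - c" c] gcl[OF c] d(1) c by simp
    then show ?thesis by (simp add: h_def)
  qed
  show thesis
  proof (rule that[of h])
    fix C D assume C: "C \<in> carrier BC"
    obtain c where c: "C = coset c" "c \<in> fc" using C by (auto simp: BC_carrier)
    show "h C \<in> carrier G" unfolding c(1) h[OF c(2)] by (rule gcl[OF c(2)])
    assume D: "D \<in> carrier BC"
    obtain d where d: "D = coset d" "d \<in> fc" using D by (auto simp: BC_carrier)
    have cd: "c + d \<in> fc" using c(2) d(2) by simp
    show "h (C \<oplus>\<^bsub>BC\<^esub> D) = h C \<oplus>\<^bsub>G\<^esub> h D"
      unfolding c(1) d(1) BC_add[OF c(2) d(2)] h[OF c(2)] h[OF d(2)] h[OF cd] by (rule gadd[OF c(2) d(2)])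
  next
    fix x b assume xb: "x \<in> carrier L" "b \<in> carrier B"
    show "h (pt x b) = f x b"
      unfolding pt_coset using h[of "frag_of (x, b)"] gof[OF xb] xb by simp
  next
    show "h \<zero>\<^bsub>BC\<^esub> = \<zero>\<^bsub>G\<^esub>" unfolding BC_zero using h g0 by simp
  qed
qed

text \<open>For surjective \<phi> the balancing relation moves every scalar to the left: n \<otimes>
  \<phi>(a) = an \<otimes> 1. For the projection from S to S / (z - \<alpha>) this describes the
  image of a specialized submodule inside the specialization of M'.\<close>

lemma base_change_map_image:
  assumes N: "submodule N A L" and surj: "\<phi> ` carrier A = carrier B"
  shows "base_change_map A B \<phi> L (\<lambda>n. n) ` carrier (base_change A B \<phi> (L\<lparr>carrier := N\<rparr>))
    = (\<lambda>n. pt n \<one>\<^bsub>B\<^esub>) ` N"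
proof -
  interpret N: scalar_extension A B \<phi> "L\<lparr>carrier := N\<rparr>"
    by (intro scalar_extension.intro submodule.submodule_is_module[OF N] L.module_axioms B.cring_axioms
        scalar_extension_axioms.intro hom)
  have NL: "N \<subseteq> carrier L" using L.submoduleE(1)[OF N] .
  have fcN: "N.fc \<subseteq> fc" unfolding N.fc_def fc_def using NL by auto
  \<comment> \<open>Relations over \<open>N\<close> are relations over \<open>L\<close>, so cosets
    go to cosets; the converse may fail, and the induced map need not be injective.\<close>
  have sub: "N.T \<subseteq> T"
  proof -
    have "N.gens \<subseteq> gens" unfolding N.gens_def gens_def using NL by (simp; blast)
    then have "N.gens \<subseteq> T \<inter> N.fc" using gens_T N.gens_closed by blast
    then have "N.T \<subseteq> T \<inter> N.fc" by (rule N.T_subset) (auto simp: T_zero T_diff)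
    then show ?thesis by blast
  qed
  have map: "base_change_map A B \<phi> L (\<lambda>n. n) (N.coset c) = coset c" for c
  proof -
    have id: "frag_extend (\<lambda>(x, b). frag_of (x, b)) d = d" for d :: "'b \<times> 'c \<Rightarrow>\<^sub>0 int"
    proof -
      have "(\<lambda>(x, b). frag_of (x, b)) = (frag_of :: 'b \<times> 'c \<Rightarrow> _)" by (rule ext) auto
      then show ?thesis using frag_expansion[of d] by simp
    qed
    have "coset d = coset c" if "d \<in> N.coset c" for d
      using that sub by (auto simp: N.coset_mem coset_eq)
    moreover have "c \<in> N.coset c" by (simp add: N.coset_mem N.T_zero)
    ultimately show ?thesis unfolding base_change_map_def id by blast
  qed
  interpret BC: module B BC by (rule BC_module)
  have pt_minus: "pt x \<one>\<^bsub>B\<^esub> \<ominus>\<^bsub>BC\<^esub> pt y \<one>\<^bsub>B\<^esub> = pt (x \<ominus>\<^bsub>L\<^esub> y) \<one>\<^bsub>B\<^esub>" if "x \<in> carrier L" "y \<in> carrier L" for x y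
  proof -
    have "pt x \<one>\<^bsub>B\<^esub> = pt (x \<ominus>\<^bsub>L\<^esub> y) \<one>\<^bsub>B\<^esub> \<oplus>\<^bsub>BC\<^esub> pt y \<one>\<^bsub>B\<^esub>"
      using pt_add_left[of "x \<ominus>\<^bsub>L\<^esub> y" y "\<one>\<^bsub>B\<^esub>"] that by (simp add: L.minus_eq L.a_assoc L.l_neg)
    then show ?thesis using that by (simp add: BC.minus_eq BC.a_assoc BC.r_neg)
  qed
  have coset_minus: "coset (c - d) = coset c \<ominus>\<^bsub>BC\<^esub> coset d" if "c \<in> fc" "d \<in> fc" for c d
  proof -
    have cl: "coset c \<in> carrier BC" "coset d \<in> carrier BC" "coset (c - d) \<in> carrier BC"
      using that by (simp_all add: BC_carrier)
    have "coset c = coset (c - d) \<oplus>\<^bsub>BC\<^esub> coset d" using that by (simp add: BC_add)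
    then show ?thesis using cl by (simp add: BC.minus_eq BC.a_assoc BC.r_neg)
  qed
  have "coset c \<in> (\<lambda>n. pt n \<one>\<^bsub>B\<^esub>) ` N" if "c \<in> N.fc" for c
    using that
  proof (induction rule: N.fc_induct)
    case zero
    have "\<zero>\<^bsub>L\<^esub> \<in> N" using subgroup.one_closed[OF submodule.axioms(1)[OF N]] by simp
    moreover have "pt \<zero>\<^bsub>L\<^esub> \<one>\<^bsub>B\<^esub> = coset 0"
      using pt_add_left[of "\<zero>\<^bsub>L\<^esub>" "\<zero>\<^bsub>L\<^esub>" "\<one>\<^bsub>B\<^esub>"] by (simp add: BC_zero[symmetric])
    ultimately show ?case by (metis image_eqI)
  next
    case (diff c d)
    then obtain x y where xy: "x \<in> N" "y \<in> N" "coset c = pt x \<one>\<^bsub>B\<^esub>" "coset d = pt y \<one>\<^bsub>B\<^esub>" by auto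
    then have "coset (c - d) = pt (x \<ominus>\<^bsub>L\<^esub> y) \<one>\<^bsub>B\<^esub>"
      using coset_minus[of c d] subsetD[OF fcN diff(1)] subsetD[OF fcN diff(2)] pt_minus[of x y]
        subsetD[OF NL xy(1)] subsetD[OF NL xy(2)] by simp
    moreover have "x \<ominus>\<^bsub>L\<^esub> y \<in> N" using xy L.submoduleE(3,5)[OF N] by (simp add: L.minus_eq)
    ultimately show ?case by blast
  next
    case (gen x b)
    then have x: "x \<in> N" by simp
    obtain a where a: "a \<in> carrier A" "b = \<phi> a" using surj gen by auto
    have "coset (frag_of (x, b)) = pt (a \<odot>\<^bsub>L\<^esub> x) \<one>\<^bsub>B\<^esub>"
      using pt_balance[of a x "\<one>\<^bsub>B\<^esub>"] a x NL by (auto simp: pt_coset)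
    then show ?case using L.submoduleE(4)[OF N a(1) x] by blast
  qed
  moreover have "pt n \<one>\<^bsub>B\<^esub> \<in> coset ` N.fc" if "n \<in> N" for n
    using that by (auto simp: pt_coset)
  ultimately have "coset ` N.fc = (\<lambda>n. pt n \<one>\<^bsub>B\<^esub>) ` N" by blast
  then show ?thesis unfolding N.BC_carrier image_image map .
qed

end

section \<open>Chain conditions\<close>

context module
begin

text \<open>The scalars form an arbitrary set \<open>A\<close>. In Hilbert's basis theorem
  \<open>A\<close> consists of constants and some of the variables, so that all intermediate modules
  live inside M' and no intermediate polynomial ring is formed.\<close>

definition closed_sub :: "'a set \<Rightarrow> 'c set \<Rightarrow> bool" where
  "closed_sub A N \<longleftrightarrow> N \<subseteq> carrier M \<and> \<zero>\<^bsub>M\<^esub> \<in> N \<and> (\<forall>x\<in>N. \<forall>y\<in>N. x \<ominus>\<^bsub>M\<^esub> y \<in> N) \<and> (\<forall>a\<in>A. \<forall>x\<in>N. a \<odot>\<^bsub>M\<^esub> x \<in> N)"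

lemma closed_subI:
  assumes "\<And>x. x \<in> N \<Longrightarrow> x \<in> carrier M" "\<zero>\<^bsub>M\<^esub> \<in> N" "\<And>x y. x \<in> N \<Longrightarrow> y \<in> N \<Longrightarrow> x \<ominus>\<^bsub>M\<^esub> y \<in> N"
    "\<And>a x. a \<in> A \<Longrightarrow> x \<in> N \<Longrightarrow> a \<odot>\<^bsub>M\<^esub> x \<in> N"
  shows "closed_sub A N"
  using assms unfolding closed_sub_def by auto

lemma closed_subD:
  assumes "closed_sub A N"
  shows "x \<in> N \<Longrightarrow> x \<in> carrier M" "\<zero>\<^bsub>M\<^esub> \<in> N" "x \<in> N \<Longrightarrow> y \<in> N \<Longrightarrow> x \<ominus>\<^bsub>M\<^esub> y \<in> N"
    "a \<in> A \<Longrightarrow> x \<in> N \<Longrightarrow> a \<odot>\<^bsub>M\<^esub> x \<in> N" "N \<subseteq> carrier M"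
  using assms unfolding closed_sub_def by auto

lemma closed_sub_minus:
  assumes "closed_sub A N" "x \<in> N" shows "\<ominus>\<^bsub>M\<^esub> x \<in> N"
  using closed_subD(3)[OF assms(1) closed_subD(2)[OF assms(1)] assms(2)] closed_subD(1)[OF assms]
  by (simp add: M.minus_eq)

lemma closed_sub_add:
  assumes "closed_sub A N" "x \<in> N" "y \<in> N" shows "x \<oplus>\<^bsub>M\<^esub> y \<in> N"
  using closed_subD(3)[OF assms(1,2) closed_sub_minus[OF assms(1,3)]] closed_subD(1)[OF assms(1)] assms(2,3)
  by (simp add: M.minus_eq)

lemma submodule_iff: "submodule N R M \<longleftrightarrow> closed_sub (carrier R) N"
proof
  assume N: "submodule N R M"
  show "closed_sub (carrier R) N"
  proof (rule closed_subI)
    show "\<zero>\<^bsub>M\<^esub> \<in> N" using subgroup.one_closed[OF submodule.axioms(1)[OF N]] by simp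
    show "x \<ominus>\<^bsub>M\<^esub> y \<in> N" if "x \<in> N" "y \<in> N" for x y
      using submoduleE(5)[OF N that(1) submoduleE(3)[OF N that(2)]] by (simp add: M.minus_eq)
  qed (use submoduleE(1,4)[OF N] in auto)
next
  assume N: "closed_sub (carrier R) N"
  show "submodule N R M"
    by (rule submoduleI) (use closed_subD[OF N] closed_sub_minus[OF N] closed_sub_add[OF N] in auto)
qed

lemma minus_cancel_right: "x \<in> carrier M \<Longrightarrow> y \<in> carrier M \<Longrightarrow> (x \<oplus>\<^bsub>M\<^esub> y) \<ominus>\<^bsub>M\<^esub> y = x"
  by (simp add: M.minus_eq M.a_assoc M.r_neg)

lemma add_minus_add:
  "x \<in> carrier M \<Longrightarrow> y \<in> carrier M \<Longrightarrow> u \<in> carrier M \<Longrightarrow> v \<in> carrier M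
    \<Longrightarrow> (x \<oplus>\<^bsub>M\<^esub> y) \<ominus>\<^bsub>M\<^esub> (u \<oplus>\<^bsub>M\<^esub> v) = (x \<ominus>\<^bsub>M\<^esub> u) \<oplus>\<^bsub>M\<^esub> (y \<ominus>\<^bsub>M\<^esub> v)"
  by (simp add: M.minus_eq M.minus_add M.a_ac)

lemma smult_l_diff:
  "a \<in> carrier R \<Longrightarrow> b \<in> carrier R \<Longrightarrow> x \<in> carrier M \<Longrightarrow> (a \<ominus> b) \<odot>\<^bsub>M\<^esub> x = a \<odot>\<^bsub>M\<^esub> x \<ominus>\<^bsub>M\<^esub> b \<odot>\<^bsub>M\<^esub> x"
  by (simp add: R.minus_eq M.minus_eq smult_l_distr smult_l_minus)

lemma smult_r_diff:
  "a \<in> carrier R \<Longrightarrow> x \<in> carrier M \<Longrightarrow> y \<in> carrier M \<Longrightarrow> a \<odot>\<^bsub>M\<^esub> (x \<ominus>\<^bsub>M\<^esub> y) = a \<odot>\<^bsub>M\<^esub> x \<ominus>\<^bsub>M\<^esub> a \<odot>\<^bsub>M\<^esub> y"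
  by (simp add: M.minus_eq smult_r_distr smult_r_minus)

lemma smult_lcomm:
  "a \<in> carrier R \<Longrightarrow> b \<in> carrier R \<Longrightarrow> x \<in> carrier M \<Longrightarrow> a \<odot>\<^bsub>M\<^esub> (b \<odot>\<^bsub>M\<^esub> x) = b \<odot>\<^bsub>M\<^esub> (a \<odot>\<^bsub>M\<^esub> x)"
  by (simp add: smult_assoc1[symmetric] m_comm)

definition acc :: "'a set \<Rightarrow> 'c set \<Rightarrow> bool" where
  "acc A H \<longleftrightarrow> (\<forall>C::nat \<Rightarrow> 'c set. (\<forall>i. C i \<subseteq> H \<and> closed_sub A (C i) \<and> C i \<subseteq> C (Suc i)) \<longrightarrow> (\<exists>n. \<forall>m\<ge>n. C m = C n))"

lemma accD:
  fixes C :: "nat \<Rightarrow> 'c set"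
  assumes "acc A H" "\<And>i. C i \<subseteq> H" "\<And>i. closed_sub A (C i)" "\<And>i. C i \<subseteq> C (Suc i)"
  obtains n where "\<And>m. m \<ge> n \<Longrightarrow> C m = C n"
  using assms unfolding acc_def by meson

subsection \<open>Finitely generated modules over noetherian rings\<close>

definition adjoin :: "'c set \<Rightarrow> 'c \<Rightarrow> 'c set" where
  "adjoin N x = {n \<oplus>\<^bsub>M\<^esub> r \<odot>\<^bsub>M\<^esub> x | n r. n \<in> N \<and> r \<in> carrier R}"

lemma adjoin_closed:
  assumes N: "closed_sub (carrier R) N" and x: "x \<in> carrier M"
  shows "closed_sub (carrier R) (adjoin N x)" "N \<subseteq> adjoin N x" "x \<in> adjoin N x"
proof -
  note D = closed_subD[OF N]
  show "closed_sub (carrier R) (adjoin N x)"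
  proof (rule closed_subI)
    show "y \<in> carrier M" if "y \<in> adjoin N x" for y using that D(1) x by (auto simp: adjoin_def)
    have "\<zero>\<^bsub>M\<^esub> = \<zero>\<^bsub>M\<^esub> \<oplus>\<^bsub>M\<^esub> \<zero> \<odot>\<^bsub>M\<^esub> x" using x by simp
    then show "\<zero>\<^bsub>M\<^esub> \<in> adjoin N x" using D(2) unfolding adjoin_def by blast
  next
    fix y y' assume "y \<in> adjoin N x" "y' \<in> adjoin N x"
    then obtain n r n' r' where y: "y = n \<oplus>\<^bsub>M\<^esub> r \<odot>\<^bsub>M\<^esub> x" "n \<in> N" "r \<in> carrier R"
      "y' = n' \<oplus>\<^bsub>M\<^esub> r' \<odot>\<^bsub>M\<^esub> x" "n' \<in> N" "r' \<in> carrier R" by (auto simp: adjoin_def)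
    then have "y \<ominus>\<^bsub>M\<^esub> y' = (n \<ominus>\<^bsub>M\<^esub> n') \<oplus>\<^bsub>M\<^esub> (r \<ominus> r') \<odot>\<^bsub>M\<^esub> x"
      using D(1) x by (simp add: add_minus_add smult_l_diff)
    moreover have "n \<ominus>\<^bsub>M\<^esub> n' \<in> N" "r \<ominus> r' \<in> carrier R" using y D(3) by auto
    ultimately show "y \<ominus>\<^bsub>M\<^esub> y' \<in> adjoin N x" unfolding adjoin_def by blast
  next
    fix a y assume a: "a \<in> carrier R" and "y \<in> adjoin N x"
    then obtain n r where y: "y = n \<oplus>\<^bsub>M\<^esub> r \<odot>\<^bsub>M\<^esub> x" "n \<in> N" "r \<in> carrier R" by (auto simp: adjoin_def)
    then have "a \<odot>\<^bsub>M\<^esub> y = a \<odot>\<^bsub>M\<^esub> n \<oplus>\<^bsub>M\<^esub> (a \<otimes> r) \<odot>\<^bsub>M\<^esub> x"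
      using D(1) x a by (simp add: smult_r_distr smult_assoc1)
    moreover have "a \<odot>\<^bsub>M\<^esub> n \<in> N" "a \<otimes> r \<in> carrier R" using y D(4) a by auto
    ultimately show "a \<odot>\<^bsub>M\<^esub> y \<in> adjoin N x" unfolding adjoin_def by blast
  qed
  show "N \<subseteq> adjoin N x"
  proof
    fix n assume n: "n \<in> N"
    have "n = n \<oplus>\<^bsub>M\<^esub> \<zero> \<odot>\<^bsub>M\<^esub> x" using D(1)[OF n] x by simp
    then show "n \<in> adjoin N x" using n unfolding adjoin_def by blast
  qed
  have "x = \<zero>\<^bsub>M\<^esub> \<oplus>\<^bsub>M\<^esub> \<one> \<odot>\<^bsub>M\<^esub> x" using x by simp
  then show "x \<in> adjoin N x" using D(2) unfolding adjoin_def by blast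
qed

lemma adjoin_subset:
  assumes "closed_sub (carrier R) K" "N \<subseteq> K" "x \<in> K"
  shows "adjoin N x \<subseteq> K"
proof
  fix y assume "y \<in> adjoin N x"
  then obtain n r where y: "y = n \<oplus>\<^bsub>M\<^esub> r \<odot>\<^bsub>M\<^esub> x" "n \<in> N" "r \<in> carrier R" by (auto simp: adjoin_def)
  then show "y \<in> K"
    using closed_sub_add[OF assms(1), of n "r \<odot>\<^bsub>M\<^esub> x"] closed_subD(4)[OF assms(1) y(3) assms(3)] assms(2) by auto
qed

lemma (in noetherian_ring) ideal_acc:
  fixes I :: "nat \<Rightarrow> 'a set"
  assumes "\<And>i. ideal (I i) R" "\<And>i. I i \<subseteq> I (Suc i)"
  obtains n where "\<And>m. m \<ge> n \<Longrightarrow> I m = I n"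
proof -
  have mono: "I i \<subseteq> I j" if "i \<le> j" for i j
    using lift_Suc_mono_le[of I i j] assms(2) that by blast
  have "I i \<subseteq> I j \<or> I j \<subseteq> I i" for i j using mono by (cases "i \<le> j") auto
  then have "subset.chain {I. ideal I R} (range I)"
    using assms(1) by (auto simp: pred_on.chain_def)
  from ideal_chain_is_trivial[OF _ this] obtain n where n: "\<Union> (range I) = I n" by auto
  show thesis
  proof (rule that[of n])
    fix m assume "m \<ge> n"
    then show "I m = I n" using mono[of n m] n by blast
  qed
qed

text \<open>A chain in N + Rx is controlled by its intersections with N and by the ideals of
  coefficients of x that occur. Once both are stable, an element of a later member differs from one
  in the stable member, with the same coefficient of x, by an element of N.\<close>

lemma acc_adjoin:
  assumes noeth: "noetherian_ring R" and N: "closed_sub (carrier R) N" "acc (carrier R) N" and x: "x \<in> carrier M"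
  shows "acc (carrier R) (adjoin N x)"
  unfolding acc_def
proof (intro allI impI)
  fix C :: "nat \<Rightarrow> 'c set"
  assume asm: "\<forall>i. C i \<subseteq> adjoin N x \<and> closed_sub (carrier R) (C i) \<and> C i \<subseteq> C (Suc i)"
  then have C: "\<And>i. C i \<subseteq> adjoin N x" "\<And>i. closed_sub (carrier R) (C i)" "\<And>i. C i \<subseteq> C (Suc i)" by auto
  have mono: "C i \<subseteq> C j" if "i \<le> j" for i j using lift_Suc_mono_le[of C i j] C(3) that by blast
  note D = closed_subD[OF N(1)]
  note CD = closed_subD[OF C(2)]
  define I where "I i = {r \<in> carrier R. \<exists>n\<in>N. n \<oplus>\<^bsub>M\<^esub> r \<odot>\<^bsub>M\<^esub> x \<in> C i}" for i
  have "ideal (I i) R" for i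
  proof (rule idealI[OF R.ring_axioms])
    have "\<zero>\<^bsub>M\<^esub> \<oplus>\<^bsub>M\<^esub> \<zero> \<odot>\<^bsub>M\<^esub> x \<in> C i" using CD(2) x by simp
    then have z: "\<zero> \<in> I i" unfolding I_def using D(2) by blast
    have diff: "a \<ominus> b \<in> I i" if ab: "a \<in> I i" "b \<in> I i" for a b
    proof -
      obtain n n' where n: "a \<in> carrier R" "b \<in> carrier R" "n \<in> N" "n' \<in> N"
        "n \<oplus>\<^bsub>M\<^esub> a \<odot>\<^bsub>M\<^esub> x \<in> C i" "n' \<oplus>\<^bsub>M\<^esub> b \<odot>\<^bsub>M\<^esub> x \<in> C i" using ab by (auto simp: I_def)
      have "(n \<oplus>\<^bsub>M\<^esub> a \<odot>\<^bsub>M\<^esub> x) \<ominus>\<^bsub>M\<^esub> (n' \<oplus>\<^bsub>M\<^esub> b \<odot>\<^bsub>M\<^esub> x) = (n \<ominus>\<^bsub>M\<^esub> n') \<oplus>\<^bsub>M\<^esub> (a \<ominus> b) \<odot>\<^bsub>M\<^esub> x"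
        using n D(1) x by (simp add: add_minus_add smult_l_diff)
      then have "(n \<ominus>\<^bsub>M\<^esub> n') \<oplus>\<^bsub>M\<^esub> (a \<ominus> b) \<odot>\<^bsub>M\<^esub> x \<in> C i" using CD(3)[OF n(5,6)] by simp
      moreover have "n \<ominus>\<^bsub>M\<^esub> n' \<in> N" using D(3) n by blast
      ultimately show ?thesis unfolding I_def using n by auto
    qed
    show "subgroup (I i) (add_monoid R)"
    proof (rule group.subgroupI[OF R.add.is_group])
      show "I i \<subseteq> carrier (add_monoid R)" by (auto simp: I_def)
      show "I i \<noteq> {}" using z by auto
      have neg: "\<ominus> a \<in> I i" if "a \<in> I i" for a
        using diff[OF z that] that by (simp add: I_def R.minus_eq)
      then show "inv\<^bsub>add_monoid R\<^esub> a \<in> I i" if "a \<in> I i" for a using that by (simp add: a_inv_def)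
      show "a \<otimes>\<^bsub>add_monoid R\<^esub> b \<in> I i" if "a \<in> I i" "b \<in> I i" for a b
        using diff[OF that(1) neg[OF that(2)]] that by (simp add: I_def R.minus_eq)
    qed
    fix a r assume a: "a \<in> I i" and r: "r \<in> carrier R"
    then obtain n where n: "a \<in> carrier R" "n \<in> N" "n \<oplus>\<^bsub>M\<^esub> a \<odot>\<^bsub>M\<^esub> x \<in> C i" by (auto simp: I_def)
    have "r \<odot>\<^bsub>M\<^esub> (n \<oplus>\<^bsub>M\<^esub> a \<odot>\<^bsub>M\<^esub> x) = r \<odot>\<^bsub>M\<^esub> n \<oplus>\<^bsub>M\<^esub> (r \<otimes> a) \<odot>\<^bsub>M\<^esub> x"
      using n D(1) x r by (simp add: smult_r_distr smult_assoc1)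
    then have "r \<odot>\<^bsub>M\<^esub> n \<oplus>\<^bsub>M\<^esub> (r \<otimes> a) \<odot>\<^bsub>M\<^esub> x \<in> C i" using CD(4)[OF r n(3)] by simp
    then show "r \<otimes> a \<in> I i" unfolding I_def using D(4)[OF r n(2)] r n(1) by auto
    then show "a \<otimes> r \<in> I i" using r n(1) by (simp add: m_comm)
  qed
  moreover have "I i \<subseteq> I (Suc i)" for i using C(3) unfolding I_def by blast
  ultimately obtain p where p: "\<And>m. m \<ge> p \<Longrightarrow> I m = I p"
    using noetherian_ring.ideal_acc[OF noeth, of I] by blast
  have "closed_sub (carrier R) (C i \<inter> N)" for i
    by (rule closed_subI) (use CD D in auto)
  then obtain q where q: "\<And>m. m \<ge> q \<Longrightarrow> C m \<inter> N = C q \<inter> N"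
    using accD[OF N(2), of "\<lambda>i. C i \<inter> N"] C(3) by (metis Int_lower2 Int_mono order_refl)
  have "C m = C (max p q)" if m: "m \<ge> max p q" for m
  proof
    show "C (max p q) \<subseteq> C m" using mono m by blast
    show "C m \<subseteq> C (max p q)"
    proof
      fix y assume y: "y \<in> C m"
      then obtain n r where yn: "y = n \<oplus>\<^bsub>M\<^esub> r \<odot>\<^bsub>M\<^esub> x" "n \<in> N" "r \<in> carrier R"
        using C(1) unfolding adjoin_def by blast
      then have "r \<in> I m" using y by (auto simp: I_def)
      then have "r \<in> I (max p q)" using p[of m] p[of "max p q"] m by simp
      then obtain n' where n': "n' \<in> N" "n' \<oplus>\<^bsub>M\<^esub> r \<odot>\<^bsub>M\<^esub> x \<in> C (max p q)" by (auto simp: I_def)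
      have "y \<ominus>\<^bsub>M\<^esub> (n' \<oplus>\<^bsub>M\<^esub> r \<odot>\<^bsub>M\<^esub> x) \<in> C m" using CD(3)[OF y] n'(2) mono[OF m] by blast
      moreover have eq: "y \<ominus>\<^bsub>M\<^esub> (n' \<oplus>\<^bsub>M\<^esub> r \<odot>\<^bsub>M\<^esub> x) = n \<ominus>\<^bsub>M\<^esub> n'"
        using yn n'(1) D(1) x by (simp add: add_minus_add) (simp add: M.minus_eq M.r_neg)
      ultimately have "n \<ominus>\<^bsub>M\<^esub> n' \<in> C m \<inter> N" using D(3)[OF yn(2) n'(1)] by simp
      then have "n \<ominus>\<^bsub>M\<^esub> n' \<in> C (max p q)" using q[of m] q[of "max p q"] m by auto
      from closed_sub_add[OF C(2) this n'(2)]
      have "(n \<ominus>\<^bsub>M\<^esub> n') \<oplus>\<^bsub>M\<^esub> (n' \<oplus>\<^bsub>M\<^esub> r \<odot>\<^bsub>M\<^esub> x) \<in> C (max p q)" .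
      moreover have "(n \<ominus>\<^bsub>M\<^esub> n') \<oplus>\<^bsub>M\<^esub> (n' \<oplus>\<^bsub>M\<^esub> r \<odot>\<^bsub>M\<^esub> x) = y"
        using yn n'(1) D(1) x by (simp add: M.minus_eq M.a_assoc M.r_neg1)
      ultimately show "y \<in> C (max p q)" by simp
    qed
  qed
  then show "\<exists>n. \<forall>m\<ge>n. C m = C n" by blast
qed

text \<open>The generators are adjoined one at a time, starting from the zero submodule.\<close>

lemma noetherian_imp_acc:
  assumes noeth: "noetherian_ring R" and fg: "finitely_generated_module R M"
  shows "acc (carrier R) (carrier M)"
proof -
  obtain G where G: "finite G" "G \<subseteq> carrier M" "\<And>H. submodule H R M \<Longrightarrow> G \<subseteq> H \<Longrightarrow> H = carrier M"
    using fg unfolding finitely_generated_module_def by blast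
  from G(1,2) have "\<exists>H. closed_sub (carrier R) H \<and> G \<subseteq> H \<and> acc (carrier R) H"
  proof induction
    case empty
    have "closed_sub (carrier R) {\<zero>\<^bsub>M\<^esub>}" by (rule closed_subI) (auto simp: M.minus_eq M.r_neg)
    moreover have "acc (carrier R) {\<zero>\<^bsub>M\<^esub>}"
      unfolding acc_def
    proof (intro allI impI)
      fix C :: "nat \<Rightarrow> 'c set"
      assume "\<forall>i. C i \<subseteq> {\<zero>\<^bsub>M\<^esub>} \<and> closed_sub (carrier R) (C i) \<and> C i \<subseteq> C (Suc i)"
      then have "C i = {\<zero>\<^bsub>M\<^esub>}" for i using closed_subD(2)[of "carrier R" "C i"] by blast
      then show "\<exists>n. \<forall>m\<ge>n. C m = C n" by simp
    qed
    ultimately show ?case by blast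
  next
    case (insert x F)
    then obtain H where H: "closed_sub (carrier R) H" "F \<subseteq> H" "acc (carrier R) H" by auto
    have x: "x \<in> carrier M" using insert by simp
    show ?case
      using adjoin_closed[OF H(1) x] acc_adjoin[OF noeth H(1,3) x] H(2) by blast
  qed
  then show ?thesis using G(3) by (metis submodule_iff)
qed

subsection \<open>Hilbert's basis theorem\<close>

text \<open>The elements v_0 + z v_1 + ... + z^(n-1) v_(n-1) with coefficients in \<open>H\<close>.
  The index bounds the degree strictly, so index zero leaves only zero.\<close>

primrec poly_span :: "'a \<Rightarrow> 'c set \<Rightarrow> nat \<Rightarrow> 'c set" where
  "poly_span z H 0 = {\<zero>\<^bsub>M\<^esub>}"
| "poly_span z H (Suc n) = {d \<oplus>\<^bsub>M\<^esub> (z [^] n) \<odot>\<^bsub>M\<^esub> v | d v. d \<in> poly_span z H n \<and> v \<in> H}"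

definition poly_closure :: "'a \<Rightarrow> 'c set \<Rightarrow> 'c set" where
  "poly_closure z H = (\<Union>n. poly_span z H n)"

context
  fixes A z H
  assumes A: "A \<subseteq> carrier R" and z: "z \<in> carrier R" and H: "closed_sub A H"
begin

private lemma zn: "z [^] (n::nat) \<in> carrier R" using z by simp

private lemma span_sub: "closed_sub A (poly_span z H n)"
proof (induction n)
  case 0
  show ?case by (rule closed_subI) (use A in \<open>auto simp: M.minus_eq M.r_neg subset_iff\<close>)
next
  case (Suc n)
  note D = closed_subD[OF Suc] and HD = closed_subD[OF H]
  show ?case
  proof (rule closed_subI)
    show "x \<in> carrier M" if "x \<in> poly_span z H (Suc n)" for x
      using that D(1) HD(1) zn by auto
    have "\<zero>\<^bsub>M\<^esub> = \<zero>\<^bsub>M\<^esub> \<oplus>\<^bsub>M\<^esub> (z [^] n) \<odot>\<^bsub>M\<^esub> \<zero>\<^bsub>M\<^esub>" using zn by simp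
    then show "\<zero>\<^bsub>M\<^esub> \<in> poly_span z H (Suc n)" using D(2) HD(2) by (simp only: poly_span.simps) blast
  next
    fix x y assume "x \<in> poly_span z H (Suc n)" "y \<in> poly_span z H (Suc n)"
    then obtain d v d' v' where x: "x = d \<oplus>\<^bsub>M\<^esub> (z [^] n) \<odot>\<^bsub>M\<^esub> v" "d \<in> poly_span z H n" "v \<in> H"
      "y = d' \<oplus>\<^bsub>M\<^esub> (z [^] n) \<odot>\<^bsub>M\<^esub> v'" "d' \<in> poly_span z H n" "v' \<in> H" by auto
    then have "x \<ominus>\<^bsub>M\<^esub> y = (d \<ominus>\<^bsub>M\<^esub> d') \<oplus>\<^bsub>M\<^esub> (z [^] n) \<odot>\<^bsub>M\<^esub> (v \<ominus>\<^bsub>M\<^esub> v')"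
      using D(1) HD(1) zn by (simp add: add_minus_add smult_r_diff)
    moreover have "d \<ominus>\<^bsub>M\<^esub> d' \<in> poly_span z H n" "v \<ominus>\<^bsub>M\<^esub> v' \<in> H" using x D(3) HD(3) by auto
    ultimately show "x \<ominus>\<^bsub>M\<^esub> y \<in> poly_span z H (Suc n)" by (simp only: poly_span.simps) blast
  next
    fix a x assume a: "a \<in> A" and "x \<in> poly_span z H (Suc n)"
    then obtain d v where x: "x = d \<oplus>\<^bsub>M\<^esub> (z [^] n) \<odot>\<^bsub>M\<^esub> v" "d \<in> poly_span z H n" "v \<in> H" by auto
    then have "a \<odot>\<^bsub>M\<^esub> x = a \<odot>\<^bsub>M\<^esub> d \<oplus>\<^bsub>M\<^esub> (z [^] n) \<odot>\<^bsub>M\<^esub> (a \<odot>\<^bsub>M\<^esub> v)"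
      using D(1) HD(1) zn[of n] subsetD[OF A a] by (simp add: smult_r_distr smult_lcomm[of a "z [^] n"])
    moreover have "a \<odot>\<^bsub>M\<^esub> d \<in> poly_span z H n" "a \<odot>\<^bsub>M\<^esub> v \<in> H" using x D(4) HD(4) a by auto
    ultimately show "a \<odot>\<^bsub>M\<^esub> x \<in> poly_span z H (Suc n)" by (simp only: poly_span.simps) blast
  qed
qed

private lemma span_Suc: "poly_span z H n \<subseteq> poly_span z H (Suc n)"
proof
  fix d assume d: "d \<in> poly_span z H n"
  have "d = d \<oplus>\<^bsub>M\<^esub> (z [^] n) \<odot>\<^bsub>M\<^esub> \<zero>\<^bsub>M\<^esub>" using closed_subD(1)[OF span_sub d] zn by simp
  then show "d \<in> poly_span z H (Suc n)"
    using d closed_subD(2)[OF H] by (simp only: poly_span.simps) blast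
qed

private lemma span_mono: "i \<le> j \<Longrightarrow> poly_span z H i \<subseteq> poly_span z H j"
  using lift_Suc_mono_le[of "poly_span z H" i j] span_Suc by blast

private lemma span_z: "d \<in> poly_span z H n \<Longrightarrow> z \<odot>\<^bsub>M\<^esub> d \<in> poly_span z H (Suc n)"
proof (induction n arbitrary: d)
  case 0
  then show ?case using closed_subD(2)[OF span_sub, of "Suc 0"] z by (simp del: poly_span.simps(2))
next
  case (Suc n)
  then obtain e v where d: "d = e \<oplus>\<^bsub>M\<^esub> (z [^] n) \<odot>\<^bsub>M\<^esub> v" "e \<in> poly_span z H n" "v \<in> H" by auto
  have "z \<odot>\<^bsub>M\<^esub> d = z \<odot>\<^bsub>M\<^esub> e \<oplus>\<^bsub>M\<^esub> (z [^] Suc n) \<odot>\<^bsub>M\<^esub> v"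
    using d(1) closed_subD(1)[OF span_sub d(2)] closed_subD(1)[OF H d(3)] z zn[of n]
    by (simp add: smult_r_distr smult_assoc1[symmetric] m_comm)
  then show ?case using Suc.IH[OF d(2)] d(3) by (subst poly_span.simps(2)) blast
qed

lemma poly_closure_closed: "closed_sub (insert z A) (poly_closure z H)"
proof (rule closed_subI)
  show "x \<in> carrier M" if "x \<in> poly_closure z H" for x
    using that closed_subD(1)[OF span_sub] by (auto simp: poly_closure_def)
  show "\<zero>\<^bsub>M\<^esub> \<in> poly_closure z H"
    using closed_subD(2)[OF span_sub] by (auto simp: poly_closure_def)
next
  fix x y assume "x \<in> poly_closure z H" "y \<in> poly_closure z H"
  then obtain i j where "x \<in> poly_span z H i" "y \<in> poly_span z H j" by (auto simp: poly_closure_def)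
  then have "x \<in> poly_span z H (max i j)" "y \<in> poly_span z H (max i j)"
    using span_mono[of i "max i j"] span_mono[of j "max i j"] by auto
  from closed_subD(3)[OF span_sub this] show "x \<ominus>\<^bsub>M\<^esub> y \<in> poly_closure z H"
    by (auto simp: poly_closure_def)
next
  fix a x assume a: "a \<in> insert z A" and "x \<in> poly_closure z H"
  then obtain i where x: "x \<in> poly_span z H i" by (auto simp: poly_closure_def)
  from a show "a \<odot>\<^bsub>M\<^esub> x \<in> poly_closure z H"
  proof
    assume "a = z"
    then show ?thesis using span_z[OF x] unfolding poly_closure_def by blast
  next
    assume "a \<in> A"
    then show ?thesis using closed_subD(4)[OF span_sub _ x] unfolding poly_closure_def by blast
  qed
qed

lemma poly_closure_incl: "H \<subseteq> poly_closure z H"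
proof
  fix v assume v: "v \<in> H"
  have "v = \<zero>\<^bsub>M\<^esub> \<oplus>\<^bsub>M\<^esub> (z [^] (0::nat)) \<odot>\<^bsub>M\<^esub> v" using closed_subD(1)[OF H v] by simp
  then have "v \<in> poly_span z H (Suc 0)" using v by (simp only: poly_span.simps) blast
  then show "v \<in> poly_closure z H" unfolding poly_closure_def by blast
qed

text \<open>The coefficient sets \<open>LC N n\<close> of leading terms of degree \<open>n\<close> grow with both \<open>N\<close> and \<open>n\<close>;
  along an ascending chain the diagonal and finitely many rows stabilize, and a submodule is determined
  by its leading coefficients within any larger one.\<close>

lemma hilbert_basis_step:
  assumes accH: "acc A H" shows "acc (insert z A) (poly_closure z H)"
  unfolding acc_def
proof (intro allI impI)
  fix C :: "nat \<Rightarrow> 'c set"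
  assume asm: "\<forall>i. C i \<subseteq> poly_closure z H \<and> closed_sub (insert z A) (C i) \<and> C i \<subseteq> C (Suc i)"
  then have C: "\<And>i. C i \<subseteq> poly_closure z H" "\<And>i. closed_sub (insert z A) (C i)" "\<And>i. C i \<subseteq> C (Suc i)" by auto
  have mono: "C i \<subseteq> C j" if "i \<le> j" for i j using lift_Suc_mono_le[of C i j] C(3) that by blast
  note CD = closed_subD[OF C(2)] and HD = closed_subD[OF H] and SD = closed_subD[OF span_sub]
  \<comment> \<open>The lower part \<open>d\<close> is existentially quantified, so elements with
    several expansions in powers of \<open>z\<close> cause no trouble.\<close>
  define LC where "LC N n = {v \<in> H. \<exists>d\<in>poly_span z H n. d \<oplus>\<^bsub>M\<^esub> (z [^] n) \<odot>\<^bsub>M\<^esub> v \<in> N}" for N and n :: nat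
  have LC_sub: "closed_sub A (LC (C i) n)" for i n
  proof (rule closed_subI)
    show "x \<in> carrier M" if "x \<in> LC (C i) n" for x using that HD(1) by (auto simp: LC_def)
    have "\<zero>\<^bsub>M\<^esub> \<oplus>\<^bsub>M\<^esub> (z [^] n) \<odot>\<^bsub>M\<^esub> \<zero>\<^bsub>M\<^esub> \<in> C i" using CD(2) zn by simp
    then show "\<zero>\<^bsub>M\<^esub> \<in> LC (C i) n" using SD(2) HD(2) unfolding LC_def by blast
  next
    fix v v' assume "v \<in> LC (C i) n" "v' \<in> LC (C i) n"
    then obtain d d' where v: "v \<in> H" "v' \<in> H" "d \<in> poly_span z H n" "d' \<in> poly_span z H n"
      "d \<oplus>\<^bsub>M\<^esub> (z [^] n) \<odot>\<^bsub>M\<^esub> v \<in> C i" "d' \<oplus>\<^bsub>M\<^esub> (z [^] n) \<odot>\<^bsub>M\<^esub> v' \<in> C i" by (auto simp: LC_def)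
    have "(d \<oplus>\<^bsub>M\<^esub> (z [^] n) \<odot>\<^bsub>M\<^esub> v) \<ominus>\<^bsub>M\<^esub> (d' \<oplus>\<^bsub>M\<^esub> (z [^] n) \<odot>\<^bsub>M\<^esub> v')
        = (d \<ominus>\<^bsub>M\<^esub> d') \<oplus>\<^bsub>M\<^esub> (z [^] n) \<odot>\<^bsub>M\<^esub> (v \<ominus>\<^bsub>M\<^esub> v')"
      using SD(1)[OF v(3)] SD(1)[OF v(4)] HD(1)[OF v(1)] HD(1)[OF v(2)] zn[of n] by (simp add: add_minus_add smult_r_diff)
    then have "(d \<ominus>\<^bsub>M\<^esub> d') \<oplus>\<^bsub>M\<^esub> (z [^] n) \<odot>\<^bsub>M\<^esub> (v \<ominus>\<^bsub>M\<^esub> v') \<in> C i"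
      using CD(3)[OF v(5,6)] by simp
    then show "v \<ominus>\<^bsub>M\<^esub> v' \<in> LC (C i) n"
      using SD(3)[OF v(3,4)] HD(3)[OF v(1,2)] unfolding LC_def by blast
  next
    fix a v assume a: "a \<in> A" and "v \<in> LC (C i) n"
    then obtain d where v: "v \<in> H" "d \<in> poly_span z H n" "d \<oplus>\<^bsub>M\<^esub> (z [^] n) \<odot>\<^bsub>M\<^esub> v \<in> C i"
      by (auto simp: LC_def)
    have "a \<odot>\<^bsub>M\<^esub> (d \<oplus>\<^bsub>M\<^esub> (z [^] n) \<odot>\<^bsub>M\<^esub> v) = a \<odot>\<^bsub>M\<^esub> d \<oplus>\<^bsub>M\<^esub> (z [^] n) \<odot>\<^bsub>M\<^esub> (a \<odot>\<^bsub>M\<^esub> v)"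
      using SD(1)[OF v(2)] HD(1)[OF v(1)] zn[of n] subsetD[OF A a]
      by (simp add: smult_r_distr smult_lcomm[of a "z [^] n"])
    then have "a \<odot>\<^bsub>M\<^esub> d \<oplus>\<^bsub>M\<^esub> (z [^] n) \<odot>\<^bsub>M\<^esub> (a \<odot>\<^bsub>M\<^esub> v) \<in> C i"
      using CD(4)[OF _ v(3), of a] a by simp
    then show "a \<odot>\<^bsub>M\<^esub> v \<in> LC (C i) n"
      using SD(4)[OF a v(2)] HD(4)[OF a v(1)] unfolding LC_def by blast
  qed
  have LC_H: "LC N n \<subseteq> H" for N n by (auto simp: LC_def)
  have LC_Suc: "LC (C i) n \<subseteq> LC (C i) (Suc n)" for i n
  proof
    fix v assume "v \<in> LC (C i) n"
    then obtain d where v: "v \<in> H" "d \<in> poly_span z H n" "d \<oplus>\<^bsub>M\<^esub> (z [^] n) \<odot>\<^bsub>M\<^esub> v \<in> C i"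
      by (auto simp: LC_def)
    have "z \<odot>\<^bsub>M\<^esub> (d \<oplus>\<^bsub>M\<^esub> (z [^] n) \<odot>\<^bsub>M\<^esub> v) = z \<odot>\<^bsub>M\<^esub> d \<oplus>\<^bsub>M\<^esub> (z [^] Suc n) \<odot>\<^bsub>M\<^esub> v"
      using SD(1)[OF v(2)] HD(1)[OF v(1)] zn[of n] z by (simp add: smult_r_distr smult_assoc1[symmetric] m_comm)
    then have "z \<odot>\<^bsub>M\<^esub> d \<oplus>\<^bsub>M\<^esub> (z [^] Suc n) \<odot>\<^bsub>M\<^esub> v \<in> C i" using CD(4)[OF _ v(3), of z] by simp
    then show "v \<in> LC (C i) (Suc n)" using span_z[OF v(2)] v(1) unfolding LC_def by blast
  qed
  have LC_mono: "LC (C i) n \<subseteq> LC (C j) m" if "i \<le> j" "n \<le> m" for i j n m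
  proof -
    have "LC (C i) n \<subseteq> LC (C i) m" using lift_Suc_mono_le[of "LC (C i)" n m] LC_Suc that by blast
    also have "\<dots> \<subseteq> LC (C j) m" using mono[OF that(1)] unfolding LC_def by blast
    finally show ?thesis .
  qed
  obtain r0 where r0: "\<And>m. m \<ge> r0 \<Longrightarrow> LC (C m) m = LC (C r0) r0"
    using accD[OF accH, of "\<lambda>i. LC (C i) i"] LC_H LC_sub LC_mono by (metis le_Suc_eq order_refl)
  have "\<exists>r. \<forall>m\<ge>r. LC (C m) j = LC (C r) j" for j
    using accD[OF accH, of "\<lambda>i. LC (C i) j"] LC_H LC_sub LC_mono by (metis le_Suc_eq order_refl)
  then obtain rr where rr: "\<And>j m. m \<ge> rr j \<Longrightarrow> LC (C m) j = LC (C (rr j)) j" by metis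
  define r where "r = Max (insert r0 (rr ` {..<r0}))"
  have r: "r0 \<le> r" "j < r0 \<Longrightarrow> rr j \<le> r" for j by (auto simp: r_def)
  have stable: "LC (C i) j = LC (C r) j" if "i \<ge> r" for i j
  proof (cases "j < r0")
    case True
    then show ?thesis using rr[of j i] rr[of j r] r(2)[OF True] that by simp
  next
    case False
    \<comment> \<open>A row with index at least \<open>r0\<close> lies below a late diagonal entry
      and above the stable one, and these two are equal.\<close>
    have "LC (C i) j \<subseteq> LC (C (max i j)) (max i j)" by (rule LC_mono) auto
    also have "\<dots> = LC (C r0) r0" using False by (intro r0) auto
    also have "\<dots> \<subseteq> LC (C r) j" using False r by (intro LC_mono) auto
    finally show ?thesis using LC_mono[OF that order_refl, of j] by blast
  qed
  have "C i = C r" if i: "i \<ge> r" for i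
  proof
    show "C r \<subseteq> C i" by (rule mono[OF i])
    \<comment> \<open>Induction on the degree bound: subtracting a member of \<open>C r\<close> with
      the same leading coefficient lowers it.\<close>
    have "C i \<inter> poly_span z H n \<subseteq> C r" for n
    proof (induction n)
      case 0
      then show ?case using CD(2) by auto
    next
      case (Suc n)
      show ?case
      proof
        fix x assume x: "x \<in> C i \<inter> poly_span z H (Suc n)"
        then obtain d v where d: "x = d \<oplus>\<^bsub>M\<^esub> (z [^] n) \<odot>\<^bsub>M\<^esub> v" "d \<in> poly_span z H n" "v \<in> H" by auto
        then have "v \<in> LC (C i) n" using x unfolding LC_def by blast
        then have "v \<in> LC (C r) n" using stable[OF i, of n] by simp
        then obtain d' where d': "d' \<in> poly_span z H n" "d' \<oplus>\<^bsub>M\<^esub> (z [^] n) \<odot>\<^bsub>M\<^esub> v \<in> C r"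
          by (auto simp: LC_def)
        have cl: "d \<in> carrier M" "d' \<in> carrier M" "(z [^] n) \<odot>\<^bsub>M\<^esub> v \<in> carrier M"
          using SD(1)[OF d(2)] SD(1)[OF d'(1)] HD(1)[OF d(3)] zn by auto
        have "x \<ominus>\<^bsub>M\<^esub> (d' \<oplus>\<^bsub>M\<^esub> (z [^] n) \<odot>\<^bsub>M\<^esub> v) = d \<ominus>\<^bsub>M\<^esub> d'"
          using cl d(1) by (simp add: add_minus_add) (simp add: M.minus_eq M.r_neg)
        moreover have "x \<ominus>\<^bsub>M\<^esub> (d' \<oplus>\<^bsub>M\<^esub> (z [^] n) \<odot>\<^bsub>M\<^esub> v) \<in> C i"
          using CD(3) x d'(2) mono[OF i] by blast
        ultimately have "d \<ominus>\<^bsub>M\<^esub> d' \<in> C r" using SD(3)[OF d(2) d'(1)] Suc by auto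
        from closed_sub_add[OF C(2) this d'(2)]
        show "x \<in> C r" using cl d(1) by (simp add: M.minus_eq M.a_assoc M.r_neg1)
      qed
    qed
    then show "C i \<subseteq> C r" using C(1)[of i] unfolding poly_closure_def by blast
  qed
  then show "\<exists>n. \<forall>m\<ge>n. C m = C n" by blast
qed

end

lemma acc_maximal:
  assumes acc: "acc (carrier R) (carrier M)" and Q: "Q \<noteq> {}" "\<And>V. V \<in> Q \<Longrightarrow> closed_sub (carrier R) V"
  obtains V where "V \<in> Q" "\<And>V'. V' \<in> Q \<Longrightarrow> V \<subseteq> V' \<Longrightarrow> V' = V"
proof (rule ccontr)
  assume no: "\<not> thesis"
  then have "\<exists>V'. V' \<in> Q \<and> V \<subset> V'" if "V \<in> Q" for V using that \<open>\<And>V. V \<in> Q \<Longrightarrow> (\<And>V'. V' \<in> Q \<Longrightarrow> V \<subseteq> V' \<Longrightarrow> V' = V) \<Longrightarrow> thesis\<close> by blast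
  then obtain g where g: "\<And>V. V \<in> Q \<Longrightarrow> g V \<in> Q \<and> V \<subset> g V" by metis
  obtain V0 where V0: "V0 \<in> Q" using Q by auto
  define C where "C i = (g ^^ i) V0" for i
  have CQ: "C i \<in> Q" for i by (induction i) (use V0 g in \<open>auto simp: C_def\<close>)
  have strict: "C i \<subset> C (Suc i)" for i using g[OF CQ[of i]] by (simp add: C_def)
  obtain n where n: "\<And>m. m \<ge> n \<Longrightarrow> C m = C n"
    using accD[OF acc, of C] closed_subD(5)[OF Q(2)[OF CQ]] Q(2)[OF CQ] strict by blast
  have "C (Suc n) = C n" by (rule n) simp
  then show False using strict[of n] by simp
qed

end

section \<open>Chains of saturated submodules\<close>

context module
begin

definition mult_set :: "'a set \<Rightarrow> bool" where
  "mult_set W \<longleftrightarrow> W \<subseteq> carrier R \<and> \<one> \<in> W \<and> (\<forall>a\<in>W. \<forall>b\<in>W. a \<otimes> b \<in> W)"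

lemma mult_setD:
  assumes "mult_set W"
  shows "w \<in> W \<Longrightarrow> w \<in> carrier R" "\<one> \<in> W" "a \<in> W \<Longrightarrow> b \<in> W \<Longrightarrow> a \<otimes> b \<in> W"
  using assms unfolding mult_set_def by auto

text \<open>For a submodule \<open>U\<close> of \<open>K\<close>, this says that K / U has no
  \<open>W\<close>-torsion, so that \<open>U\<close> is contracted from the localization. The
  condition is relative to \<open>K\<close> because \<open>sat_chain_step\<close> descends from
  \<open>K\<close> to the next member of the chain.\<close>

definition saturated :: "'a set \<Rightarrow> 'c set \<Rightarrow> 'c set \<Rightarrow> bool" where
  "saturated W K U \<longleftrightarrow> (\<forall>w\<in>W. \<forall>x\<in>K. w \<odot>\<^bsub>M\<^esub> x \<in> U \<longrightarrow> x \<in> U)"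

lemma saturatedD: "saturated W K U \<Longrightarrow> w \<in> W \<Longrightarrow> x \<in> K \<Longrightarrow> w \<odot>\<^bsub>M\<^esub> x \<in> U \<Longrightarrow> x \<in> U"
  unfolding saturated_def by blast

lemma saturated_mono: "saturated W K U \<Longrightarrow> W' \<subseteq> W \<Longrightarrow> K' \<subseteq> K \<Longrightarrow> saturated W' K' U"
  unfolding saturated_def by blast

text \<open>The contraction to \<open>K\<close> of the extension of \<open>U\<close> to the
  localization at \<open>W\<close>.\<close>

definition saturation :: "'a set \<Rightarrow> 'c set \<Rightarrow> 'c set \<Rightarrow> 'c set" where
  "saturation W K U = {x \<in> K. \<exists>w\<in>W. w \<odot>\<^bsub>M\<^esub> x \<in> U}"

lemma saturationI: "x \<in> K \<Longrightarrow> w \<in> W \<Longrightarrow> w \<odot>\<^bsub>M\<^esub> x \<in> U \<Longrightarrow> x \<in> saturation W K U"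
  unfolding saturation_def by blast

lemma saturation_least: "saturated W K V \<Longrightarrow> U \<subseteq> V \<Longrightarrow> saturation W K U \<subseteq> V"
  unfolding saturation_def saturated_def by blast

lemma saturation_sub: "saturation W K U \<subseteq> K"
  unfolding saturation_def by blast

context
  fixes W K assumes W: "mult_set W" and K: "closed_sub (carrier R) K"
begin

lemma saturation_closed:
  assumes U: "closed_sub (carrier R) U"
  shows "closed_sub (carrier R) (saturation W K U)"
proof (rule closed_subI)
  note WD = mult_setD[OF W] and KD = closed_subD[OF K] and UD = closed_subD[OF U]
  show "x \<in> carrier M" if "x \<in> saturation W K U" for x
    using that KD(1) by (auto simp: saturation_def)
  show "\<zero>\<^bsub>M\<^esub> \<in> saturation W K U"
    by (rule saturationI[OF KD(2) WD(2)]) (use UD(2) in simp)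
  fix x assume "x \<in> saturation W K U"
  then obtain w where x: "x \<in> K" "w \<in> W" "w \<odot>\<^bsub>M\<^esub> x \<in> U" by (auto simp: saturation_def)
  note cl = KD(1)[OF x(1)] WD(1)[OF x(2)]
  {
    fix y assume "y \<in> saturation W K U"
    then obtain w' where y: "y \<in> K" "w' \<in> W" "w' \<odot>\<^bsub>M\<^esub> y \<in> U" by (auto simp: saturation_def)
    note cl' = KD(1)[OF y(1)] WD(1)[OF y(2)]
    have "(w \<otimes> w') \<odot>\<^bsub>M\<^esub> (x \<ominus>\<^bsub>M\<^esub> y) = w' \<odot>\<^bsub>M\<^esub> (w \<odot>\<^bsub>M\<^esub> x) \<ominus>\<^bsub>M\<^esub> w \<odot>\<^bsub>M\<^esub> (w' \<odot>\<^bsub>M\<^esub> y)"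
      using cl cl' by (simp add: smult_r_diff smult_assoc1[symmetric] R.m_comm)
    also have "\<dots> \<in> U" using UD(3)[OF UD(4)[OF cl'(2) x(3)] UD(4)[OF cl(2) y(3)]] .
    finally show "x \<ominus>\<^bsub>M\<^esub> y \<in> saturation W K U"
      by (rule saturationI[OF KD(3)[OF x(1) y(1)] WD(3)[OF x(2) y(2)]])
  next
    fix a assume a: "a \<in> carrier R"
    have "w \<odot>\<^bsub>M\<^esub> (a \<odot>\<^bsub>M\<^esub> x) = a \<odot>\<^bsub>M\<^esub> (w \<odot>\<^bsub>M\<^esub> x)" using cl a by (simp add: smult_lcomm)
    also have "\<dots> \<in> U" using UD(4)[OF a x(3)] .
    finally show "a \<odot>\<^bsub>M\<^esub> x \<in> saturation W K U"
      by (rule saturationI[OF KD(4)[OF a x(1)] x(2)])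
  }
qed

lemma saturation_incl: "U \<subseteq> K \<Longrightarrow> U \<subseteq> saturation W K U"
proof
  fix x assume "U \<subseteq> K" "x \<in> U"
  moreover from this have "\<one> \<odot>\<^bsub>M\<^esub> x = x" using closed_subD(1)[OF K] by auto
  ultimately show "x \<in> saturation W K U"
    using mult_setD(2)[OF W] by (intro saturationI[of x K \<one>]) auto
qed

lemma saturation_saturated: "saturated W K (saturation W K U)"
  unfolding saturated_def
proof (intro ballI impI)
  fix w x assume w: "w \<in> W" and x: "x \<in> K" and "w \<odot>\<^bsub>M\<^esub> x \<in> saturation W K U"
  then obtain w' where w': "w' \<in> W" "w' \<odot>\<^bsub>M\<^esub> (w \<odot>\<^bsub>M\<^esub> x) \<in> U" by (auto simp: saturation_def)
  then have "(w' \<otimes> w) \<odot>\<^bsub>M\<^esub> x \<in> U"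
    using mult_setD(1)[OF W] w closed_subD(1)[OF K x] by (simp add: smult_assoc1)
  then show "x \<in> saturation W K U"
    using mult_setD(3)[OF W w'(1) w] by (intro saturationI[OF x])
qed

text \<open>Nakayama's lemma: a maximal saturated proper submodule of \<open>K\<close> above \<open>U\<close> gives a simple
  quotient of \<open>K\<close> (up to \<open>W\<close>), which is killed by \<open>z\<close>.\<close>

lemma nakayama:
  assumes acc: "acc (carrier R) (carrier M)" and z: "z \<in> carrier R"
    and Wz: "\<And>w r. w \<in> W \<Longrightarrow> r \<in> carrier R \<Longrightarrow> w \<ominus> r \<otimes> z \<in> W"
    and U: "closed_sub (carrier R) U" "U \<subset> K" "saturated W K U"
  obtains V where "closed_sub (carrier R) V" "U \<subseteq> V" "V \<subset> K" "saturated W K V" "\<And>x. x \<in> K \<Longrightarrow> z \<odot>\<^bsub>M\<^esub> x \<in> V"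
proof -
  let ?Q = "{V. closed_sub (carrier R) V \<and> U \<subseteq> V \<and> V \<subset> K \<and> saturated W K V}"
  have "U \<in> ?Q" using U by simp
  then have "?Q \<noteq> {}" by (metis empty_iff)
  then obtain V where V: "V \<in> ?Q" and max: "\<And>V'. V' \<in> ?Q \<Longrightarrow> V \<subseteq> V' \<Longrightarrow> V' = V"
    using acc_maximal[OF acc, of ?Q] by (metis (no_types, lifting) mem_Collect_eq)
  then have V': "closed_sub (carrier R) V" "U \<subseteq> V" "V \<subset> K" "saturated W K V" by auto
  have "z \<odot>\<^bsub>M\<^esub> x \<in> V" if x: "x \<in> K" for x
  proof (rule ccontr)
    assume no: "z \<odot>\<^bsub>M\<^esub> x \<notin> V"
    have zx: "z \<odot>\<^bsub>M\<^esub> x \<in> K" "z \<odot>\<^bsub>M\<^esub> x \<in> carrier M"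
      using closed_subD(4)[OF K z x] closed_subD(1)[OF K] by auto
    note ad = adjoin_closed[OF V'(1) zx(2)]
    have adK: "adjoin V (z \<odot>\<^bsub>M\<^esub> x) \<subseteq> K" using adjoin_subset[OF K _ zx(1)] V'(3) by auto
    let ?P = "saturation W K (adjoin V (z \<odot>\<^bsub>M\<^esub> x))"
    have "V \<subseteq> ?P" "z \<odot>\<^bsub>M\<^esub> x \<in> ?P" using saturation_incl[OF adK] ad(2,3) by auto
    moreover have "?P \<subseteq> K" by (rule saturation_sub)
    ultimately have "?P = K"
      using max[of ?P] saturation_closed[OF ad(1)] saturation_saturated V'(2) no by blast
    then obtain w where w: "w \<in> W" "w \<odot>\<^bsub>M\<^esub> x \<in> adjoin V (z \<odot>\<^bsub>M\<^esub> x)"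
      using x by (auto simp: saturation_def)
    then obtain n r where n: "w \<odot>\<^bsub>M\<^esub> x = n \<oplus>\<^bsub>M\<^esub> r \<odot>\<^bsub>M\<^esub> (z \<odot>\<^bsub>M\<^esub> x)" "n \<in> V" "r \<in> carrier R"
      by (auto simp: adjoin_def)
    note cl = mult_setD(1)[OF W w(1)] closed_subD(1)[OF K x] closed_subD(1)[OF V'(1) n(2)]
    \<comment> \<open>Collecting the multiples of \<open>x\<close> gives the coefficient w - rz. It
      is again a denominator by \<open>Wz\<close>, which expresses that z lies in the Jacobson
      radical of the localization.\<close>
    have "(w \<ominus> r \<otimes> z) \<odot>\<^bsub>M\<^esub> x = w \<odot>\<^bsub>M\<^esub> x \<ominus>\<^bsub>M\<^esub> r \<odot>\<^bsub>M\<^esub> (z \<odot>\<^bsub>M\<^esub> x)"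
      using cl n(3) z by (simp add: smult_l_diff smult_assoc1)
    also have "\<dots> = n" using n cl z by (simp add: minus_cancel_right)
    finally have "(w \<ominus> r \<otimes> z) \<odot>\<^bsub>M\<^esub> x \<in> V" using n(2) by simp
    then have "x \<in> V" using saturatedD[OF V'(4) Wz[OF w(1) n(3)] x] by simp
    then show False using no closed_subD(4)[OF V'(1) z] by simp
  qed
  then show thesis using that[OF V'(1-4)] by blast
qed

end

text \<open>The number \<open>n\<close> counts strict inclusions, not members, so it is the length
  that the chain contributes.\<close>

definition sat_chain :: "'a set \<Rightarrow> 'c set \<Rightarrow> nat \<Rightarrow> (nat \<Rightarrow> 'c set) \<Rightarrow> bool" where
  "sat_chain W K n C \<longleftrightarrow>
     (\<forall>i\<le>n. closed_sub (carrier R) (C i) \<and> C i \<subseteq> K \<and> saturated W K (C i)) \<and> (\<forall>i<n. C i \<subset> C (Suc i))"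

lemma sat_chainD:
  assumes "sat_chain W K n C"
  shows "i \<le> n \<Longrightarrow> closed_sub (carrier R) (C i)" "i \<le> n \<Longrightarrow> C i \<subseteq> K" "i \<le> n \<Longrightarrow> saturated W K (C i)"
    "i < n \<Longrightarrow> C i \<subset> C (Suc i)"
  using assms unfolding sat_chain_def by auto

lemma sat_chain_mono:
  assumes C: "sat_chain W K n C" shows "i \<le> j \<Longrightarrow> j \<le> n \<Longrightarrow> C i \<subseteq> C j"
proof (induction j)
  case (Suc j)
  then show ?case using sat_chainD(4)[OF C, of j] by (cases "i = Suc j") auto
qed simp

definition plus_mult :: "'c set \<Rightarrow> 'a \<Rightarrow> 'c set \<Rightarrow> 'c set" where
  "plus_mult E z K = {e \<oplus>\<^bsub>M\<^esub> z \<odot>\<^bsub>M\<^esub> k | e k. e \<in> E \<and> k \<in> K}"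

lemma plus_mult_closed:
  assumes E: "closed_sub (carrier R) E" and K: "closed_sub (carrier R) K" and z: "z \<in> carrier R"
  shows "closed_sub (carrier R) (plus_mult E z K)" "E \<subseteq> plus_mult E z K" "k \<in> K \<Longrightarrow> z \<odot>\<^bsub>M\<^esub> k \<in> plus_mult E z K"
proof -
  note D = closed_subD[OF E] and KD = closed_subD[OF K]
  show zk: "z \<odot>\<^bsub>M\<^esub> k \<in> plus_mult E z K" if k: "k \<in> K" for k
  proof -
    have "z \<odot>\<^bsub>M\<^esub> k = \<zero>\<^bsub>M\<^esub> \<oplus>\<^bsub>M\<^esub> z \<odot>\<^bsub>M\<^esub> k" using KD(1)[OF k] z by simp
    then show ?thesis using D(2) k unfolding plus_mult_def by blast
  qed
  show "E \<subseteq> plus_mult E z K"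
  proof
    fix e assume e: "e \<in> E"
    have "e = e \<oplus>\<^bsub>M\<^esub> z \<odot>\<^bsub>M\<^esub> \<zero>\<^bsub>M\<^esub>" using D(1)[OF e] z by simp
    then show "e \<in> plus_mult E z K" using e KD(2) unfolding plus_mult_def by blast
  qed
  show "closed_sub (carrier R) (plus_mult E z K)"
  proof (rule closed_subI)
    show "y \<in> carrier M" if "y \<in> plus_mult E z K" for y using that D(1) KD(1) z by (auto simp: plus_mult_def)
    show "\<zero>\<^bsub>M\<^esub> \<in> plus_mult E z K" using zk[OF KD(2)] z by simp
  next
    fix y y' assume "y \<in> plus_mult E z K" "y' \<in> plus_mult E z K"
    then obtain n r n' r' where y: "y = n \<oplus>\<^bsub>M\<^esub> z \<odot>\<^bsub>M\<^esub> r" "n \<in> E" "r \<in> K"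
      "y' = n' \<oplus>\<^bsub>M\<^esub> z \<odot>\<^bsub>M\<^esub> r'" "n' \<in> E" "r' \<in> K" by (auto simp: plus_mult_def)
    then have "y \<ominus>\<^bsub>M\<^esub> y' = (n \<ominus>\<^bsub>M\<^esub> n') \<oplus>\<^bsub>M\<^esub> z \<odot>\<^bsub>M\<^esub> (r \<ominus>\<^bsub>M\<^esub> r')"
      using D(1) KD(1) z by (simp add: add_minus_add smult_r_diff)
    moreover have "n \<ominus>\<^bsub>M\<^esub> n' \<in> E" "r \<ominus>\<^bsub>M\<^esub> r' \<in> K" using y D(3) KD(3) by auto
    ultimately show "y \<ominus>\<^bsub>M\<^esub> y' \<in> plus_mult E z K" unfolding plus_mult_def by blast
  next
    fix a y assume a: "a \<in> carrier R" and "y \<in> plus_mult E z K"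
    then obtain n r where y: "y = n \<oplus>\<^bsub>M\<^esub> z \<odot>\<^bsub>M\<^esub> r" "n \<in> E" "r \<in> K" by (auto simp: plus_mult_def)
    then have "a \<odot>\<^bsub>M\<^esub> y = a \<odot>\<^bsub>M\<^esub> n \<oplus>\<^bsub>M\<^esub> z \<odot>\<^bsub>M\<^esub> (a \<odot>\<^bsub>M\<^esub> r)"
      using D(1) KD(1) z a by (simp add: smult_r_distr smult_lcomm[of a z])
    moreover have "a \<odot>\<^bsub>M\<^esub> n \<in> E" "a \<odot>\<^bsub>M\<^esub> r \<in> K" using y D(4) KD(4) a by auto
    ultimately show "a \<odot>\<^bsub>M\<^esub> y \<in> plus_mult E z K" unfolding plus_mult_def by blast
  qed
qed

lemma plus_mult_subset:
  assumes "closed_sub (carrier R) V" "E \<subseteq> V" "\<And>k. k \<in> K \<Longrightarrow> z \<odot>\<^bsub>M\<^esub> k \<in> V"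
  shows "plus_mult E z K \<subseteq> V"
  using assms(2,3) closed_sub_add[OF assms(1)] unfolding plus_mult_def by blast

text \<open>The top quotient \<open>K / U\<close> of the chain, with \<open>U = C n\<close>, has no \<open>z\<close>-torsion because \<open>z \<in> W\<close>.
  Hence \<open>U \<inter> zK = zU\<close>, and a chain above \<open>N + zU\<close> in \<open>U\<close> extends to one above \<open>N + zK\<close> in \<open>K\<close>;
  by Nakayama's lemma its top member is proper.\<close>

lemma sat_chain_step:
  assumes acc: "acc (carrier R) (carrier M)"
    and W: "mult_set W" and W': "mult_set W'" "W' \<subseteq> W" and z: "z \<in> W"
    and Wz: "\<And>w r. w \<in> W' \<Longrightarrow> r \<in> carrier R \<Longrightarrow> w \<ominus> r \<otimes> z \<in> W'"
  shows "closed_sub (carrier R) K \<Longrightarrow> sat_chain W K n C \<Longrightarrow> N \<subseteq> C 0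
    \<Longrightarrow> \<exists>E. sat_chain W' K n E \<and> N \<subseteq> E 0 \<and> (\<forall>x\<in>K. z \<odot>\<^bsub>M\<^esub> x \<in> E 0)"
proof (induction n arbitrary: K)
  note zR = mult_setD(1)[OF W z]
  {
    case 0
    have "sat_chain W' K 0 (\<lambda>_. K)" using 0 by (auto simp: sat_chain_def saturated_def)
    moreover have "N \<subseteq> K" using 0(3) sat_chainD(2)[OF 0(2), of 0] by auto
    moreover have "\<forall>x\<in>K. z \<odot>\<^bsub>M\<^esub> x \<in> K" using closed_subD(4)[OF 0(1) zR] by simp
    ultimately show ?case by blast
  }
  case (Suc n)
  note CD = sat_chainD[OF Suc.prems(2)]
  define U where "U = C n"
  have U: "closed_sub (carrier R) U" "U \<subset> K" "saturated W K U"
    using CD(1)[of n] CD(3)[of n] CD(4)[of n] CD(2)[of "Suc n"] by (auto simp: U_def)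
  have "C i \<subseteq> U" if "i \<le> n" for i using sat_chain_mono[OF Suc.prems(2) that] by (simp add: U_def)
  then have "sat_chain W U n C"
    unfolding sat_chain_def using CD(1,3,4) saturated_mono[OF _ order_refl, of W K _ U] U(2) by auto
  from Suc.IH[OF U(1) this Suc.prems(3)]
  obtain E where E: "sat_chain W' U n E" "N \<subseteq> E 0" "\<And>x. x \<in> U \<Longrightarrow> z \<odot>\<^bsub>M\<^esub> x \<in> E 0" by blast
  note ED = sat_chainD[OF E(1)]
  note KD = closed_subD[OF Suc.prems(1)]
  define P where "P i = plus_mult (E i) z K" for i
  \<comment> \<open>The saturations of E_i + zK occupy the indices up to \<open>n\<close>, and
    \<open>K\<close> itself is added as the member with index \<open>Suc n\<close>.\<close>
  define F where "F i = (if i \<le> n then saturation W' K (P i) else K)" for i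
  have P: "closed_sub (carrier R) (P i)" "E i \<subseteq> P i" "P i \<subseteq> K" if "i \<le> n" for i
  proof -
    show "closed_sub (carrier R) (P i)" "E i \<subseteq> P i"
      unfolding P_def using plus_mult_closed(1,2)[OF ED(1)[OF that] Suc.prems(1) zR] .
    show "P i \<subseteq> K"
      unfolding P_def by (rule plus_mult_subset[OF Suc.prems(1)]) (use ED(2)[OF that] U(2) KD(4)[OF zR] in auto)
  qed
  have F: "closed_sub (carrier R) (F i)" "P i \<subseteq> F i" "saturated W' K (F i)" if "i \<le> n" for i
    using saturation_closed[OF W'(1) Suc.prems(1) P(1)[OF that]] saturation_incl[OF W'(1) Suc.prems(1) P(3)[OF that]]
      saturation_saturated[OF W'(1) Suc.prems(1)] that by (simp_all add: F_def)
  \<comment> \<open>Intersecting \<open>F i\<close> with \<open>U\<close> gives back only elements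
    of \<open>E i\<close>, so the strict inclusions of the old chain persist. The equation for
    \<open>w x\<close> puts zk into \<open>U\<close>, and saturation by \<open>z\<close> then puts k
    into \<open>U\<close>.\<close>
  have FU: "x \<in> E i" if i: "i \<le> n" and x: "x \<in> F i" "x \<in> U" for i x
  proof -
    obtain w where w: "x \<in> K" "w \<in> W'" "w \<odot>\<^bsub>M\<^esub> x \<in> P i" using x i by (auto simp: F_def saturation_def)
    then obtain e k where e: "w \<odot>\<^bsub>M\<^esub> x = e \<oplus>\<^bsub>M\<^esub> z \<odot>\<^bsub>M\<^esub> k" "e \<in> E i" "k \<in> K"
      by (auto simp: P_def plus_mult_def)
    have wR: "w \<in> carrier R" using mult_setD(1)[OF W'(1) w(2)] .
    have wx: "w \<odot>\<^bsub>M\<^esub> x \<in> U" using closed_subD(4)[OF U(1) wR x(2)] .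
    have eU: "e \<in> U" using ED(2)[OF i] e(2) by auto
    have ce: "e \<in> carrier M" "z \<odot>\<^bsub>M\<^esub> k \<in> carrier M" using closed_subD(1)[OF U(1) eU] KD(1)[OF e(3)] zR by auto
    have "z \<odot>\<^bsub>M\<^esub> k = w \<odot>\<^bsub>M\<^esub> x \<ominus>\<^bsub>M\<^esub> e"
      unfolding e(1) using minus_cancel_right[of "z \<odot>\<^bsub>M\<^esub> k" e] ce by (simp add: M.a_comm)
    then have "z \<odot>\<^bsub>M\<^esub> k \<in> U" using closed_subD(3)[OF U(1) wx eU] by simp
    then have "k \<in> U" using saturatedD[OF U(3) z e(3)] by simp
    then have "z \<odot>\<^bsub>M\<^esub> k \<in> E i" using E(3) sat_chain_mono[OF E(1) _ i, of 0] by auto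
    then have "w \<odot>\<^bsub>M\<^esub> x \<in> E i" using closed_sub_add[OF ED(1)[OF i] e(2)] e(1) by simp
    then show "x \<in> E i" using saturatedD[OF ED(3)[OF i] w(2) x(2)] by simp
  qed
  have "sat_chain W' K (Suc n) F"
    unfolding sat_chain_def
  proof (intro conjI allI impI)
    fix i assume "i \<le> Suc n"
    show "closed_sub (carrier R) (F i)" using F(1)[of i] Suc.prems(1) by (cases "i \<le> n") (auto simp: F_def)
    show "F i \<subseteq> K" by (auto simp: F_def saturation_def)
    show "saturated W' K (F i)" using F(3)[of i] by (cases "i \<le> n") (auto simp: F_def saturated_def)
  next
    fix i assume "i < Suc n"
    show "F i \<subset> F (Suc i)"
    proof (cases "i < n")
      case True
      then have i: "i \<le> n" "Suc i \<le> n" by auto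
      have "P i \<subseteq> P (Suc i)" using ED(4)[OF True] unfolding P_def plus_mult_def by blast
      then have "F i \<subseteq> F (Suc i)" using i by (auto simp: F_def saturation_def)
      moreover obtain x where x: "x \<in> E (Suc i)" "x \<notin> E i" using ED(4)[OF True] by auto
      moreover have "x \<in> F (Suc i)" using F(2)[OF i(2)] P(2)[OF i(2)] x by auto
      moreover have "x \<notin> F i" using FU[OF i(1), of x] x ED(2)[OF i(2)] by auto
      ultimately show ?thesis by auto
    next
      case False
      then have i: "i = n" using \<open>i < Suc n\<close> by simp
      obtain V where V: "closed_sub (carrier R) V" "U \<subseteq> V" "V \<subset> K" "saturated W' K V" "\<And>x. x \<in> K \<Longrightarrow> z \<odot>\<^bsub>M\<^esub> x \<in> V"
        using nakayama[OF W'(1) Suc.prems(1) acc zR Wz U(1,2) saturated_mono[OF U(3) W'(2) order_refl]] by blast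
      have "P n \<subseteq> V" unfolding P_def
        by (rule plus_mult_subset[OF V(1)]) (use V(2,5) ED(2)[of n] in auto)
      then have "F n \<subseteq> V" using saturation_least[OF V(4)] by (simp add: F_def)
      then show ?thesis using V(3) i by (auto simp: F_def)
    qed
  qed
  moreover have "N \<subseteq> F 0" using E(2) P(2)[of 0] F(2)[of 0] by auto
  moreover have "\<forall>x\<in>K. z \<odot>\<^bsub>M\<^esub> x \<in> F 0"
    using plus_mult_closed(3)[OF ED(1)[of 0] Suc.prems(1) zR] F(2)[of 0] unfolding P_def by auto
  ultimately show ?case by blast
qed

subsection \<open>Composition series\<close>

text \<open>The position \<open>k\<close> includes both ends, below \<open>C 0\<close> and above
  \<open>C d\<close>, so a chain of maximal length can be tested at every gap by one rule.\<close>

lemma sat_chain_insert: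
  assumes C: "sat_chain W K d C" and k: "k \<le> Suc d"
    and P: "closed_sub (carrier R) P" "P \<subseteq> K" "saturated W K P"
    and lo: "k > 0 \<Longrightarrow> C (k - 1) \<subset> P" and hi: "k \<le> d \<Longrightarrow> P \<subset> C k"
  shows "sat_chain W K (Suc d) (\<lambda>j. if j < k then C j else if j = k then P else C (j - 1))"
  unfolding sat_chain_def
proof (intro conjI allI impI)
  note CD = sat_chainD[OF C]
  fix i
  let ?C = "\<lambda>j. if j < k then C j else if j = k then P else C (j - 1)"
  {
    assume "i \<le> Suc d"
    then have "i < k \<and> i \<le> d \<or> i = k \<or> k < i \<and> i - 1 \<le> d" using k by linarith
    then show "closed_sub (carrier R) (?C i)" "?C i \<subseteq> K" "saturated W K (?C i)"
      using CD(1-3)[of i] CD(1-3)[of "i - 1"] P by auto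
  next
    assume i: "i < Suc d"
    consider "Suc i < k" | "Suc i = k" | "i = k" | "k < i" by linarith
    then show "?C i \<subset> ?C (Suc i)"
    proof cases
      case 1
      then show ?thesis using CD(4)[of i] k by simp
    next
      case 2
      then show ?thesis using lo by auto
    next
      case 3
      then show ?thesis using hi i by simp
    next
      case 4
      then show ?thesis using CD(4)[of "i - 1"] i by simp
    qed
  }
qed

primrec adjoins :: "'c set \<Rightarrow> (nat \<Rightarrow> 'c) \<Rightarrow> nat \<Rightarrow> 'c set" where
  "adjoins N x 0 = N"
| "adjoins N x (Suc i) = adjoin (adjoins N x i) (x i)"

lemma adjoins_closed:
  assumes "closed_sub (carrier R) N" "\<And>j. j < i \<Longrightarrow> x j \<in> carrier M"
  shows "closed_sub (carrier R) (adjoins N x i)"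
  using assms(2) by (induction i) (use assms(1) adjoin_closed(1) in auto)

text \<open>A chain of maximal length is a composition series, and one element from each gap
  generates it up to denominators. The conclusions speak of \<open>adjoins\<close>, not of the
  saturated members, because membership in a saturation names an individual denominator and can thus
  be evaluated.\<close>

lemma composition_elements:
  assumes W: "mult_set W" and N: "closed_sub (carrier R) N"
    and C: "sat_chain W (carrier M) d C" "N \<subseteq> C 0"
    and max: "\<And>D. sat_chain W (carrier M) (Suc d) D \<Longrightarrow> \<not> N \<subseteq> D 0"
  obtains x where "\<And>i. i < d \<Longrightarrow> x i \<in> carrier M"
    "\<And>i. i \<le> d \<Longrightarrow> closed_sub (carrier R) (adjoins N x i)"
    "\<And>i m. i < d \<Longrightarrow> m \<in> carrier R \<Longrightarrow> (\<And>w r. w \<in> W \<Longrightarrow> r \<in> carrier R \<Longrightarrow> w \<ominus> r \<otimes> m \<in> W)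
        \<Longrightarrow> m \<odot>\<^bsub>M\<^esub> x i \<in> saturation W (carrier M) (adjoins N x i)"
    "saturation W (carrier M) (adjoins N x d) = carrier M"
proof -
  note CD = sat_chainD[OF C(1)]
  have K: "closed_sub (carrier R) (carrier M)"
    using carrier_is_submodule by (simp add: submodule_iff)
  \<comment> \<open>Maximality of the length: no saturated submodule above \<open>N\<close> fits
    strictly into a gap or beyond either end.\<close>
  have noinsert: False if "k \<le> Suc d" "closed_sub (carrier R) P" "saturated W (carrier M) P"
     "k > 0 \<Longrightarrow> C (k - 1) \<subset> P" "k \<le> d \<Longrightarrow> P \<subset> C k" "N \<subseteq> P" for k P
  proof -
    have "sat_chain W (carrier M) (Suc d) (\<lambda>j. if j < k then C j else if j = k then P else C (j - 1))"
      by (rule sat_chain_insert[OF C(1) that(1,2) closed_subD(5)[OF that(2)] that(3)]) (use that(4,5) in auto)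
    from max[OF this] show False using C(2) that(6) by (cases "k = 0") auto
  qed
  have between: "P = C (Suc i)" if "i < d" "closed_sub (carrier R) P" "saturated W (carrier M) P"
    "C i \<subset> P" "P \<subseteq> C (Suc i)" for i P
  proof (rule ccontr)
    assume "P \<noteq> C (Suc i)"
    moreover have "N \<subseteq> P" using sat_chain_mono[OF C(1), of 0 i] that C(2) by auto
    ultimately show False using noinsert[of "Suc i" P] that by auto
  qed
  have bot: "C 0 = saturation W (carrier M) N"
  proof (rule ccontr)
    assume "C 0 \<noteq> saturation W (carrier M) N"
    moreover have "saturation W (carrier M) N \<subseteq> C 0" using saturation_least[OF CD(3) C(2)] by simp
    ultimately show False
      using noinsert[of 0 "saturation W (carrier M) N"] saturation_closed[OF W K N] saturation_saturated[OF W K]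
        saturation_incl[OF W K closed_subD(5)[OF N]] by auto
  qed
  have top: "C d = carrier M"
  proof (rule ccontr)
    assume "C d \<noteq> carrier M"
    then have "C d \<subset> carrier M" using CD(2)[of d] by auto
    moreover have "saturated W (carrier M) (carrier M)" by (simp add: saturated_def)
    ultimately show False using noinsert[of "Suc d" "carrier M"] K closed_subD(5)[OF N] by auto
  qed
  have "\<exists>x. \<forall>i<d. x i \<in> C (Suc i) \<and> x i \<notin> C i"
    using CD(4) by (intro choice allI) (metis psubsetE subsetI)
  then obtain x where x: "\<And>i. i < d \<Longrightarrow> x i \<in> C (Suc i)" "\<And>i. i < d \<Longrightarrow> x i \<notin> C i" by blast
  have xM: "x i \<in> carrier M" if "i < d" for i using x(1)[OF that] CD(2)[of "Suc i"] that by auto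
  have cl: "closed_sub (carrier R) (adjoins N x i)" if "i \<le> d" for i
    by (rule adjoins_closed[OF N]) (use xM that in auto)
  \<comment> \<open>Nothing lies strictly between neighbours, so every element of the gap generates
    the upper member over the lower one, up to denominators.\<close>
  have gen: "saturation W (carrier M) (adjoin (C i) y) = C (Suc i)" if i: "i < d" and y: "y \<in> C (Suc i)" "y \<notin> C i" for i y
  proof (rule between[OF i])
    have yM: "y \<in> carrier M" using y(1) CD(2)[of "Suc i"] i by auto
    have Ci: "closed_sub (carrier R) (C i)" using CD(1) i by simp
    note ad = adjoin_closed[OF Ci yM]
    show "closed_sub (carrier R) (saturation W (carrier M) (adjoin (C i) y))" by (rule saturation_closed[OF W K ad(1)])
    show "saturated W (carrier M) (saturation W (carrier M) (adjoin (C i) y))" by (rule saturation_saturated[OF W K])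
    have "adjoin (C i) y \<subseteq> saturation W (carrier M) (adjoin (C i) y)" by (rule saturation_incl[OF W K closed_subD(5)[OF ad(1)]])
    then show "C i \<subset> saturation W (carrier M) (adjoin (C i) y)" using ad(2,3) y(2) by blast
    have "adjoin (C i) y \<subseteq> C (Suc i)" by (rule adjoin_subset) (use CD(1)[of "Suc i"] CD(4)[OF i] y(1) i in auto)
    then show "saturation W (carrier M) (adjoin (C i) y) \<subseteq> C (Suc i)" using saturation_least[OF CD(3)[of "Suc i"]] i by simp
  qed
  have sat: "i \<le> d \<Longrightarrow> C i = saturation W (carrier M) (adjoins N x i)" for i
  proof (induction i)
    case 0
    then show ?case using bot by simp
  next
    case (Suc i)
    let ?A = "saturation W (carrier M) (adjoins N x (Suc i))"
    have i: "i < d" "i \<le> d" using Suc.prems by simp_all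
    note ad = adjoin_closed[OF cl[OF i(2)] xM[OF i(1)]]
    have incl: "adjoins N x (Suc i) \<subseteq> ?A" by (rule saturation_incl[OF W K closed_subD(5)[OF cl[OF Suc.prems]]])
    have A: "closed_sub (carrier R) ?A" "saturated W (carrier M) ?A"
      using saturation_closed[OF W K cl[OF Suc.prems]] saturation_saturated[OF W K] by auto
    have "C i \<subseteq> ?A"
      unfolding Suc.IH[OF i(2)] by (rule saturation_least[OF A(2)]) (use incl ad(2) in auto)
    then have "adjoin (C i) (x i) \<subseteq> ?A"
      by (intro adjoin_subset[OF A(1)]) (use incl ad(3) in auto)
    then have 1: "C (Suc i) \<subseteq> ?A"
      using gen[OF i(1) x(1)[OF i(1)] x(2)[OF i(1)]] saturation_least[OF A(2)] by metis
    have "adjoins N x i \<subseteq> C i"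
      using Suc.IH[OF i(2)] saturation_incl[OF W K closed_subD(5)[OF cl[OF i(2)]]] by simp
    then have "adjoins N x (Suc i) \<subseteq> C (Suc i)"
      unfolding adjoins.simps
      by (intro adjoin_subset[OF CD(1)[OF Suc.prems]]) (use CD(4)[OF i(1)] x(1)[OF i(1)] in auto)
    then have "?A \<subseteq> C (Suc i)" by (rule saturation_least[OF CD(3)[OF Suc.prems]])
    with 1 show ?case by simp
  qed
  \<comment> \<open>If m x_i were outside \<open>C i\<close>, it would generate the upper member,
    and a denominator of the form w - rm would carry x_i into \<open>C i\<close>, contradicting
    saturation.\<close>
  have kill: "m \<odot>\<^bsub>M\<^esub> x i \<in> C i" if i: "i < d" and m: "m \<in> carrier R"
    and mW: "\<And>w r. w \<in> W \<Longrightarrow> r \<in> carrier R \<Longrightarrow> w \<ominus> r \<otimes> m \<in> W" for i m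
  proof (rule ccontr)
    assume no: "m \<odot>\<^bsub>M\<^esub> x i \<notin> C i"
    have "m \<odot>\<^bsub>M\<^esub> x i \<in> C (Suc i)" using closed_subD(4)[OF CD(1)[of "Suc i"] m x(1)[OF i]] i by simp
    from gen[OF i this no] x(1)[OF i] obtain w where w: "w \<in> W" "w \<odot>\<^bsub>M\<^esub> x i \<in> adjoin (C i) (m \<odot>\<^bsub>M\<^esub> x i)"
      unfolding saturation_def by blast
    then obtain n r where n: "w \<odot>\<^bsub>M\<^esub> x i = n \<oplus>\<^bsub>M\<^esub> r \<odot>\<^bsub>M\<^esub> (m \<odot>\<^bsub>M\<^esub> x i)" "n \<in> C i" "r \<in> carrier R"
      by (auto simp: adjoin_def)
    note c = mult_setD(1)[OF W w(1)] xM[OF i] closed_subD(1)[OF CD(1)[of i] n(2)]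
    have "(w \<ominus> r \<otimes> m) \<odot>\<^bsub>M\<^esub> x i = w \<odot>\<^bsub>M\<^esub> x i \<ominus>\<^bsub>M\<^esub> r \<odot>\<^bsub>M\<^esub> (m \<odot>\<^bsub>M\<^esub> x i)"
      using c(1,2) n(3) m by (simp add: smult_l_diff smult_assoc1)
    also have "\<dots> = n" using n c m i by (simp add: minus_cancel_right)
    finally have "(w \<ominus> r \<otimes> m) \<odot>\<^bsub>M\<^esub> x i \<in> C i" using n(2) by simp
    then have "x i \<in> C i" using saturatedD[OF CD(3)[of i] mW[OF w(1) n(3)] xM[OF i]] i by simp
    then show False using x(2)[OF i] by simp
  qed
  show thesis
    by (rule that[of x]) (use xM cl kill sat top in auto)
qed

text \<open>The product of the individual denominators works for every element of a finite
  set.\<close>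

lemma common_denominator:
  assumes W: "mult_set W" and K: "closed_sub (carrier R) K" and E: "finite E" "E \<subseteq> saturation W (carrier M) K"
  shows "\<exists>w\<in>W. \<forall>x\<in>E. w \<odot>\<^bsub>M\<^esub> x \<in> K"
  using E
proof (induction E)
  case empty
  then show ?case using mult_setD(2)[OF W] by blast
next
  case (insert x E)
  then obtain w where w: "w \<in> W" "\<And>y. y \<in> E \<Longrightarrow> w \<odot>\<^bsub>M\<^esub> y \<in> K" by auto
  obtain v where v: "v \<in> W" "v \<odot>\<^bsub>M\<^esub> x \<in> K" "x \<in> carrier M" using insert.prems by (auto simp: saturation_def)
  have cl: "w \<in> carrier R" "v \<in> carrier R" using mult_setD(1)[OF W] w v by auto
  have EM: "y \<in> carrier M" if "y \<in> E" for y using that insert.prems by (auto simp: saturation_def)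
  have "(w \<otimes> v) \<odot>\<^bsub>M\<^esub> y \<in> K" if "y \<in> insert x E" for y
  proof (cases "y = x")
    case True
    then show ?thesis using closed_subD(4)[OF K cl(1) v(2)] cl v by (simp add: smult_assoc1)
  next
    case False
    then have "y \<in> E" using that by simp
    then show ?thesis
      using closed_subD(4)[OF K cl(2) w(2)] EM cl by (simp add: smult_assoc1 R.m_comm[of w v])
  qed
  then show ?case using mult_setD(3)[OF W w(1) v(1)] by blast
qed

text \<open>Each step of the series contributes at most one step to any chain: a submodule \<open>D \<supseteq> Q 0\<close> is
  determined, within any larger one, by the set of \<open>i\<close> for which it meets the coset \<open>Q i + y i\<close>.\<close>

lemma chain_length_le:
  assumes units: "\<And>r. r \<in> carrier R \<Longrightarrow> r \<notin> \<mm> \<Longrightarrow> r \<in> Units R"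
    and Q: "\<And>i. i \<le> d \<Longrightarrow> closed_sub (carrier R) (Q i)" "\<And>i. i < d \<Longrightarrow> Q (Suc i) \<subseteq> adjoin (Q i) (y i)"
      "Q d = carrier M"
    and y: "\<And>i. i < d \<Longrightarrow> y i \<in> carrier M" "\<And>i r. i < d \<Longrightarrow> r \<in> \<mm> \<Longrightarrow> r \<odot>\<^bsub>M\<^esub> y i \<in> Q i"
    and D: "\<And>i. i \<le> n \<Longrightarrow> closed_sub (carrier R) (D i)" "\<And>i. i < n \<Longrightarrow> D i \<subset> D (Suc i)" "Q 0 \<subseteq> D 0"
  shows "n \<le> d"
proof -
  define I where "I H = {i. i < d \<and> (\<exists>q\<in>Q i. q \<oplus>\<^bsub>M\<^esub> y i \<in> H)}" for H
  have fin: "finite (I H)" "card (I H) \<le> d" for H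
  proof -
    have "I H \<subseteq> {..<d}" by (auto simp: I_def)
    then show "finite (I H)" "card (I H) \<le> d"
      using finite_subset card_mono[of "{..<d}" "I H"] by auto
  qed
  have strict: "I H \<subset> I H'" if H: "closed_sub (carrier R) H" "closed_sub (carrier R) H'" "H \<subset> H'" "Q 0 \<subseteq> H" for H H'
  proof (rule psubsetI)
    show "I H \<subseteq> I H'" using H(3) by (auto simp: I_def)
    show "I H \<noteq> I H'"
    proof
      assume eq: "I H = I H'"
      have "H' \<inter> Q i \<subseteq> H" if "i \<le> d" for i
        using that
      proof (induction i)
        case 0
        then show ?case using H(4) by auto
      next
        case (Suc i)
        have i: "i < d" "i \<le> d" using Suc.prems by auto
        show ?case
        proof
          fix x assume x: "x \<in> H' \<inter> Q (Suc i)"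
          then obtain q r where q: "x = q \<oplus>\<^bsub>M\<^esub> r \<odot>\<^bsub>M\<^esub> y i" "q \<in> Q i" "r \<in> carrier R"
            using Q(2)[OF i(1)] by (auto simp: adjoin_def)
          note Qi = closed_subD[OF Q(1)[OF i(2)]]
          have xM: "x \<in> carrier M" using x closed_subD(1)[OF H(2)] by auto
          show "x \<in> H"
          proof (cases "r \<in> \<mm>")
            case True
            then have "x \<in> Q i" using closed_sub_add[OF Q(1)[OF i(2)] q(2) y(2)[OF i(1) True]] q(1) by simp
            then show ?thesis using Suc.IH i x by auto
          next
            case False
            \<comment> \<open>A unit coefficient can be normalised to one. Thus \<open>i\<close>
              belongs to the index set of the larger submodule, hence to that of the smaller one,
              which supplies an element with the same coefficient to subtract.\<close>
            then have ru: "r \<in> Units R" using units q(3) by simp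
            have ri: "inv r \<in> carrier R" using ru by simp
            have qM: "q \<in> carrier M" "y i \<in> carrier M" using Qi(1) q(2) y(1) i by auto
            have "inv r \<odot>\<^bsub>M\<^esub> x = inv r \<odot>\<^bsub>M\<^esub> q \<oplus>\<^bsub>M\<^esub> y i"
              unfolding q(1) using qM ri q(3) ru by (simp add: smult_r_distr smult_assoc1[symmetric])
            moreover have "inv r \<odot>\<^bsub>M\<^esub> x \<in> H'" using closed_subD(4)[OF H(2) ri] x by simp
            ultimately have "i \<in> I H'" using Qi(4)[OF ri q(2)] i(1) by (auto simp: I_def)
            then have "i \<in> I H" using eq by simp
            then obtain p where p: "p \<in> Q i" "p \<oplus>\<^bsub>M\<^esub> y i \<in> H" by (auto simp: I_def)
            have pM: "p \<in> carrier M" using Qi(1) p(1) by simp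
            have rp: "r \<odot>\<^bsub>M\<^esub> (p \<oplus>\<^bsub>M\<^esub> y i) \<in> H" using closed_subD(4)[OF H(1) q(3) p(2)] .
            have "x \<ominus>\<^bsub>M\<^esub> r \<odot>\<^bsub>M\<^esub> (p \<oplus>\<^bsub>M\<^esub> y i) = q \<ominus>\<^bsub>M\<^esub> r \<odot>\<^bsub>M\<^esub> p"
              unfolding q(1) using qM pM q(3)
              by (simp add: smult_r_distr add_minus_add) (simp add: M.minus_eq M.r_neg)
            moreover have "x \<ominus>\<^bsub>M\<^esub> r \<odot>\<^bsub>M\<^esub> (p \<oplus>\<^bsub>M\<^esub> y i) \<in> H'"
              using closed_subD(3)[OF H(2)] x rp H(3) by auto
            moreover have "q \<ominus>\<^bsub>M\<^esub> r \<odot>\<^bsub>M\<^esub> p \<in> Q i" using Qi(3)[OF q(2) Qi(4)[OF q(3) p(1)]] .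
            ultimately have "x \<ominus>\<^bsub>M\<^esub> r \<odot>\<^bsub>M\<^esub> (p \<oplus>\<^bsub>M\<^esub> y i) \<in> H" using Suc.IH i by auto
            from closed_sub_add[OF H(1) this rp]
            show ?thesis using xM qM pM q(3) by (simp add: M.minus_eq M.a_assoc M.l_neg)
          qed
        qed
      qed
      from this[of d] have "H' \<subseteq> H" using Q(3) closed_subD(5)[OF H(2)] by auto
      then show False using H(3) by auto
    qed
  qed
  have D0: "Q 0 \<subseteq> D i" if "i \<le> n" for i
    using that
  proof (induction i)
    case (Suc i)
    then show ?case using D(2)[of i] by auto
  qed (use D(3) in simp)
  have "i \<le> card (I (D i))" if "i \<le> n" for i
    using that
  proof (induction i)
    case (Suc i)
    have "I (D i) \<subset> I (D (Suc i))"
      by (rule strict) (use Suc.prems D(1)[of i] D(1)[of "Suc i"] D(2)[of i] D0[of i] in auto)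
    then have "card (I (D i)) < card (I (D (Suc i)))" using fin(1) psubset_card_mono by blast
    then show ?case using Suc by simp
  qed simp
  from this[of n] fin(2)[of "D n"] show ?thesis by simp
qed

end

section \<open>Lengths of quotients and of localizations\<close>

text \<open>Lengths are handled through chains above \<open>N\<close>; the choice
  \<open>N = {}\<close> imposes no condition and recovers the chains in
  \<open>module_length\<close>.\<close>

definition has_chain :: "('a, 'r) ring_scheme \<Rightarrow> ('a, 'b, 'm) module_scheme \<Rightarrow> 'b set \<Rightarrow> nat \<Rightarrow> bool" where
  "has_chain A L N n \<longleftrightarrow>
     (\<exists>C. (\<forall>i\<le>n. submodule (C i) A L \<and> N \<subseteq> C i) \<and> (\<forall>i<n. C i \<subset> C (Suc i)))"

lemma has_chain_mono: "has_chain A L N n \<Longrightarrow> m \<le> n \<Longrightarrow> has_chain A L N m"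
  unfolding has_chain_def by (meson le_trans less_le_trans)

lemma module_length_SUP: "module_length A L = (SUP n\<in>{n. has_chain A L {} n}. enat n)"
  unfolding module_length_def has_chain_def by simp

lemma has_chain_le_length: "has_chain A L {} n \<Longrightarrow> enat n \<le> module_length A L"
  unfolding module_length_SUP by (rule SUP_upper) simp

text \<open>A finite supremum in \<open>enat\<close> is attained. The hypothesis excludes the empty
  supremum, which would be zero without any chain of length zero.\<close>

lemma module_length_eq:
  assumes "has_chain A L {} 0"
  shows "module_length A L = enat d \<longleftrightarrow> has_chain A L {} d \<and> \<not> has_chain A L {} (Suc d)"
proof
  assume len: "module_length A L = enat d"
  have le: "n \<le> d" if "has_chain A L {} n" for n
    using has_chain_le_length[OF that] len by simp
  have "has_chain A L {} d"
  proof (rule ccontr)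
    assume no: "\<not> has_chain A L {} d"
    with assms have d: "d > 0" by (cases d) auto
    have "module_length A L \<le> enat (d - 1)"
      unfolding module_length_SUP
    proof (rule SUP_least)
      fix n assume "n \<in> {n. has_chain A L {} n}"
      then have "n \<le> d" "n \<noteq> d" using le no by auto
      then show "enat n \<le> enat (d - 1)" by simp
    qed
    then show False using len d by simp
  qed
  moreover have "\<not> has_chain A L {} (Suc d)" using le[of "Suc d"] by auto
  ultimately show "has_chain A L {} d \<and> \<not> has_chain A L {} (Suc d)" by simp
next
  assume *: "has_chain A L {} d \<and> \<not> has_chain A L {} (Suc d)"
  show "module_length A L = enat d"
  proof (rule antisym)
    show "enat d \<le> module_length A L" using * has_chain_le_length by blast
    show "module_length A L \<le> enat d"
      unfolding module_length_SUP
    proof (rule SUP_least)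
      fix n assume "n \<in> {n. has_chain A L {} n}"
      then have "n \<le> d" using * has_chain_mono[of A L "{}" n "Suc d"] by (metis mem_Collect_eq not_less_eq_eq)
      then show "enat n \<le> enat d" by simp
    qed
  qed
qed

section \<open>The correspondence theorem for quotients\<close>

lemma submodule_iff_minus:
  fixes V :: "('a, 'b, 'm) module_scheme" (structure)
  assumes "abelian_group V"
  shows "submodule H A V \<longleftrightarrow> H \<subseteq> carrier V \<and> \<zero> \<in> H \<and> (\<forall>x\<in>H. \<forall>y\<in>H. x \<ominus> y \<in> H) \<and>
     (\<forall>a\<in>carrier A. \<forall>x\<in>H. a \<odot> x \<in> H)"
proof
  interpret abelian_group V by fact
  assume H: "submodule H A V"
  interpret H: submodule H A V by fact
  have neg: "\<ominus> x \<in> H" if "x \<in> H" for x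
    using H.m_inv_closed[OF that] by (simp add: a_inv_def)
  have "x \<ominus> y \<in> H" if "x \<in> H" "y \<in> H" for x y
    using H.m_closed[OF that(1) neg[OF that(2)]] by (simp add: minus_eq)
  then show "H \<subseteq> carrier V \<and> \<zero> \<in> H \<and> (\<forall>x\<in>H. \<forall>y\<in>H. x \<ominus> y \<in> H) \<and> (\<forall>a\<in>carrier A. \<forall>x\<in>H. a \<odot> x \<in> H)"
    using H.subset H.one_closed H.smult_closed by auto
next
  interpret abelian_group V by fact
  assume H: "H \<subseteq> carrier V \<and> \<zero> \<in> H \<and> (\<forall>x\<in>H. \<forall>y\<in>H. x \<ominus> y \<in> H) \<and> (\<forall>a\<in>carrier A. \<forall>x\<in>H. a \<odot> x \<in> H)"
  have cl: "x \<in> carrier V" if "x \<in> H" for x using H that by auto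
  have neg: "\<ominus> x \<in> H" if "x \<in> H" for x
  proof -
    have "\<zero> \<ominus> x \<in> H" using H that by blast
    then show ?thesis using cl[OF that] by (simp add: minus_eq)
  qed
  have add: "x \<oplus> y \<in> H" if "x \<in> H" "y \<in> H" for x y
  proof -
    have "x \<ominus> \<ominus> y \<in> H" using H that(1) neg[OF that(2)] by blast
    then show ?thesis using cl[OF that(2)] by (simp add: minus_eq)
  qed
  show "submodule H A V"
  proof (intro submodule.intro submodule_axioms.intro)
    show "subgroup H (add_monoid V)"
    proof (rule group.subgroupI[OF a_group])
      show "inv\<^bsub>add_monoid V\<^esub> x \<in> H" if "x \<in> H" for x using neg[OF that] by (simp add: a_inv_def)
    qed (use H add in auto)
  qed (use H in auto)
qed

text \<open>What the correspondence theorem for quotients needs of a module; for a localized module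
  this avoids establishing the ring structure on the localized ring.\<close>

locale additive_action = abelian_group V for A :: "('a, 'r) ring_scheme" and V :: "('a, 'b, 'm) module_scheme" (structure) +
  assumes act_closed: "a \<in> carrier A \<Longrightarrow> x \<in> carrier V \<Longrightarrow> a \<odot> x \<in> carrier V"
    and act_add: "a \<in> carrier A \<Longrightarrow> x \<in> carrier V \<Longrightarrow> y \<in> carrier V \<Longrightarrow> a \<odot> (x \<oplus> y) = a \<odot> x \<oplus> a \<odot> y"
begin

context
  fixes Y assumes Y: "submodule Y A V"
begin

private lemma Y_iff: "Y \<subseteq> carrier V" "\<zero> \<in> Y" "x \<in> Y \<Longrightarrow> y \<in> Y \<Longrightarrow> x \<ominus> y \<in> Y" "a \<in> carrier A \<Longrightarrow> x \<in> Y \<Longrightarrow> a \<odot> x \<in> Y"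
  using Y unfolding submodule_iff_minus[OF abelian_group_axioms] by auto

private lemma Y_sub: "abelian_subgroup Y V"
  by (rule abelian_subgroupI3[OF additive_subgroup.intro[OF submodule.axioms(1)[OF Y]] abelian_group_axioms])

private lemma Q_carrier: "carrier (quot_module V Y) = (\<lambda>x. Y +> x) ` carrier V"
  by (auto simp: quot_module_def A_RCOSETS_def RCOSETS_def a_r_coset_def)

private lemma Q_zero: "\<zero>\<^bsub>quot_module V Y\<^esub> = Y +> \<zero>"
  using abelian_subgroup.a_rcos_const[OF Y_sub Y_iff(2)] by (simp add: quot_module_def)

private lemma Q_add: "x \<in> carrier V \<Longrightarrow> y \<in> carrier V \<Longrightarrow> (Y +> x) \<oplus>\<^bsub>quot_module V Y\<^esub> (Y +> y) = Y +> (x \<oplus> y)"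
  using abelian_subgroup.a_rcos_sum[OF Y_sub] by (simp add: quot_module_def)

private lemma Q_mem: "x \<in> carrier V \<Longrightarrow> y \<in> carrier V \<Longrightarrow> y \<in> Y +> x \<longleftrightarrow> y \<ominus> x \<in> Y"
  using abelian_subgroup.a_rcos_module[OF Y_sub, of x y] by (simp add: minus_eq)

private lemma Q_sub: "x \<in> carrier V \<Longrightarrow> Y +> x \<subseteq> carrier V"
  using a_r_coset_subset_G[OF Y_iff(1)] .

private lemma Q_self: "x \<in> carrier V \<Longrightarrow> x \<in> Y +> x"
  using Q_mem Y_iff(2) by (simp add: minus_eq r_neg)

private lemma Q_eq:
  assumes x: "x \<in> carrier V" and y: "y \<in> carrier V"
  shows "Y +> x = Y +> y \<longleftrightarrow> x \<ominus> y \<in> Y"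
proof
  assume "Y +> x = Y +> y"
  then show "x \<ominus> y \<in> Y" using Q_self[OF x] Q_mem[OF y x] by simp
next
  assume "x \<ominus> y \<in> Y"
  then have "x \<in> Y +> y" using Q_mem[OF y x] by simp
  then show "Y +> x = Y +> y"
    using abelian_subgroup.a_repr_independence'[OF Y_sub _ y] by simp
qed

private lemma Q_smult:
  assumes a: "a \<in> carrier A" and x: "x \<in> carrier V"
  shows "a \<odot>\<^bsub>quot_module V Y\<^esub> (Y +> x) = Y +> (a \<odot> x)"
proof -
  have "Y +> (a \<odot> z) = Y +> (a \<odot> x)" if "z \<in> Y +> x" for z
  proof -
    have z: "z \<in> carrier V" using Q_sub[OF x] that by auto
    have zx: "z \<ominus> x \<in> Y" using Q_mem[OF x z] that by simp
    have "a \<odot> z = a \<odot> (z \<ominus> x) \<oplus> a \<odot> x"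
      using act_add[OF a, of "z \<ominus> x" x] x z by (simp add: minus_eq a_assoc l_neg)
    then have "a \<odot> z \<ominus> a \<odot> x = a \<odot> (z \<ominus> x)"
      using act_closed[OF a] x z by (simp add: minus_eq a_assoc r_neg)
    then show ?thesis using Q_eq act_closed[OF a] x z Y_iff(4)[OF a zx] by simp
  qed
  then have "(\<Union>z\<in>Y +> x. Y +> (a \<odot> z)) = Y +> (a \<odot> x)" using Q_self[OF x] by blast
  then show ?thesis by (simp add: quot_module_def)
qed

private lemma Q_abelian: "abelian_group (quot_module V Y)"
proof (rule abelian_groupI)
  fix C D E assume CD: "C \<in> carrier (quot_module V Y)" "D \<in> carrier (quot_module V Y)" "E \<in> carrier (quot_module V Y)"
  then obtain c d e where c: "c \<in> carrier V" "C = Y +> c" "d \<in> carrier V" "D = Y +> d" "e \<in> carrier V" "E = Y +> e"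
    by (auto simp: Q_carrier)
  show "C \<oplus>\<^bsub>quot_module V Y\<^esub> D \<in> carrier (quot_module V Y)" using c by (simp add: Q_add Q_carrier)
  show "C \<oplus>\<^bsub>quot_module V Y\<^esub> D = D \<oplus>\<^bsub>quot_module V Y\<^esub> C" using c by (simp add: Q_add a_comm)
  show "C \<oplus>\<^bsub>quot_module V Y\<^esub> D \<oplus>\<^bsub>quot_module V Y\<^esub> E = C \<oplus>\<^bsub>quot_module V Y\<^esub> (D \<oplus>\<^bsub>quot_module V Y\<^esub> E)"
    using c by (simp add: Q_add a_assoc)
  show "\<zero>\<^bsub>quot_module V Y\<^esub> \<oplus>\<^bsub>quot_module V Y\<^esub> C = C" using c by (simp add: Q_add Q_zero)
  show "\<exists>y\<in>carrier (quot_module V Y). y \<oplus>\<^bsub>quot_module V Y\<^esub> C = \<zero>\<^bsub>quot_module V Y\<^esub>"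
    using c by (intro bexI[of _ "Y +> (\<ominus> c)"]) (simp_all add: Q_add Q_zero Q_carrier l_neg)
qed (simp add: Q_zero Q_carrier)

private lemma Q_minus:
  assumes x: "x \<in> carrier V" and y: "y \<in> carrier V"
  shows "(Y +> x) \<ominus>\<^bsub>quot_module V Y\<^esub> (Y +> y) = Y +> (x \<ominus> y)"
proof -
  interpret Q: abelian_group "quot_module V Y" by (rule Q_abelian)
  have cl: "Y +> x \<in> carrier (quot_module V Y)" "Y +> y \<in> carrier (quot_module V Y)"
    "Y +> (x \<ominus> y) \<in> carrier (quot_module V Y)" using x y by (auto simp: Q_carrier)
  have "Y +> x = (Y +> (x \<ominus> y)) \<oplus>\<^bsub>quot_module V Y\<^esub> (Y +> y)"
    using x y by (simp add: Q_add minus_eq a_assoc l_neg)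
  then show ?thesis using cl by (simp add: Q.minus_eq Q.a_assoc Q.r_neg)
qed

text \<open>Members are pulled back along the projection in one direction and pushed forward in the
  other. Strictness survives the projection because all members upstairs contain
  \<open>Y\<close>.\<close>

lemma quot_has_chain: "has_chain A (quot_module V Y) {} n \<longleftrightarrow> has_chain A V Y n"
proof
  interpret Q: abelian_group "quot_module V Y" by (rule Q_abelian)
  assume "has_chain A (quot_module V Y) {} n"
  then obtain G where G: "\<And>i. i \<le> n \<Longrightarrow> submodule (G i) A (quot_module V Y)" "\<And>i. i < n \<Longrightarrow> G i \<subset> G (Suc i)"
    unfolding has_chain_def by auto
  note GD = G(1)[unfolded submodule_iff_minus[OF Q_abelian]]
  define C where "C i = {x \<in> carrier V. Y +> x \<in> G i}" for i
  have "submodule (C i) A V \<and> Y \<subseteq> C i" if i: "i \<le> n" for i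
  proof
    show "submodule (C i) A V"
      unfolding submodule_iff_minus[OF abelian_group_axioms]
    proof (intro conjI ballI)
      show "C i \<subseteq> carrier V" by (auto simp: C_def)
      show "\<zero> \<in> C i" using GD[OF i] by (auto simp: C_def Q_zero)
      show "x \<ominus> y \<in> C i" if xy: "x \<in> C i" "y \<in> C i" for x y
      proof -
        have "(Y +> x) \<ominus>\<^bsub>quot_module V Y\<^esub> (Y +> y) \<in> G i" using GD[OF i] xy by (simp add: C_def)
        then show ?thesis using Q_minus[of x y] xy by (simp add: C_def)
      qed
      show "a \<odot> x \<in> C i" if ax: "a \<in> carrier A" "x \<in> C i" for a x
      proof -
        have "a \<odot>\<^bsub>quot_module V Y\<^esub> (Y +> x) \<in> G i" using GD[OF i] ax by (simp add: C_def)
        then show ?thesis using Q_smult[of a x] act_closed[of a x] ax by (simp add: C_def)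
      qed
    qed
    show "Y \<subseteq> C i"
    proof
      fix y assume y: "y \<in> Y"
      then have "y \<in> carrier V" using Y_iff(1) by auto
      moreover from this have "Y +> y = Y +> \<zero>" using Q_eq[of y \<zero>] Y_iff(3)[OF y Y_iff(2)] by simp
      ultimately show "y \<in> C i" using GD[OF i] by (auto simp: C_def Q_zero)
    qed
  qed
  moreover have "C i \<subset> C (Suc i)" if i: "i < n" for i
  proof -
    obtain g where g: "g \<in> G (Suc i)" "g \<notin> G i" using G(2)[OF i] by auto
    then obtain x where "x \<in> carrier V" "g = Y +> x" using GD[of "Suc i"] i by (auto simp: Q_carrier)
    then have "x \<in> C (Suc i)" "x \<notin> C i" using g by (auto simp: C_def)
    moreover have "C i \<subseteq> C (Suc i)" using G(2)[OF i] by (auto simp: C_def)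
    ultimately show ?thesis by auto
  qed
  ultimately show "has_chain A V Y n" unfolding has_chain_def by blast
next
  interpret Q: abelian_group "quot_module V Y" by (rule Q_abelian)
  assume "has_chain A V Y n"
  then obtain C where C: "\<And>i. i \<le> n \<Longrightarrow> submodule (C i) A V" "\<And>i. i \<le> n \<Longrightarrow> Y \<subseteq> C i" "\<And>i. i < n \<Longrightarrow> C i \<subset> C (Suc i)"
    unfolding has_chain_def by auto
  note CD = C(1)[unfolded submodule_iff_minus[OF abelian_group_axioms]]
  define G where "G i = (\<lambda>x. Y +> x) ` C i" for i
  have "submodule (G i) A (quot_module V Y)" if i: "i \<le> n" for i
    unfolding submodule_iff_minus[OF Q_abelian]
  proof (intro conjI ballI)
    have Ci: "C i \<subseteq> carrier V" "\<zero> \<in> C i" "\<And>x y. x \<in> C i \<Longrightarrow> y \<in> C i \<Longrightarrow> x \<ominus> y \<in> C i"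
      "\<And>a x. a \<in> carrier A \<Longrightarrow> x \<in> C i \<Longrightarrow> a \<odot> x \<in> C i" using CD[OF i] by auto
    show "G i \<subseteq> carrier (quot_module V Y)" using Ci(1) by (auto simp: G_def Q_carrier)
    show "\<zero>\<^bsub>quot_module V Y\<^esub> \<in> G i" using Ci(2) by (auto simp: G_def Q_zero)
    show "g \<ominus>\<^bsub>quot_module V Y\<^esub> h \<in> G i" if gh: "g \<in> G i" "h \<in> G i" for g h
    proof -
      obtain x y where xy: "x \<in> C i" "y \<in> C i" "g = Y +> x" "h = Y +> y" using gh by (auto simp: G_def)
      then have "g \<ominus>\<^bsub>quot_module V Y\<^esub> h = Y +> (x \<ominus> y)" using Q_minus[of x y] Ci(1) by auto
      then show ?thesis using Ci(3)[OF xy(1,2)] by (simp add: G_def)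
    qed
    show "a \<odot>\<^bsub>quot_module V Y\<^esub> g \<in> G i" if a: "a \<in> carrier A" and g: "g \<in> G i" for a g
    proof -
      obtain x where x: "x \<in> C i" "g = Y +> x" using g by (auto simp: G_def)
      then have "a \<odot>\<^bsub>quot_module V Y\<^esub> g = Y +> (a \<odot> x)" using Q_smult[OF a, of x] Ci(1) by auto
      then show ?thesis using Ci(4)[OF a x(1)] by (simp add: G_def)
    qed
  qed
  moreover have "G i \<subset> G (Suc i)" if i: "i < n" for i
  proof -
    obtain x where x: "x \<in> C (Suc i)" "x \<notin> C i" using C(3)[OF i] by auto
    have xX: "x \<in> carrier V" using CD[of "Suc i"] i x(1) by auto
    have "Y +> x \<notin> G i"
    proof
      assume "Y +> x \<in> G i"
      then obtain y where y: "y \<in> C i" "Y +> x = Y +> y" by (auto simp: G_def)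
      have Ci: "C i \<subseteq> carrier V" "\<And>x y. x \<in> C i \<Longrightarrow> y \<in> C i \<Longrightarrow> x \<ominus> y \<in> C i" "\<zero> \<in> C i"
        using CD[of i] i by auto
      have yX: "y \<in> carrier V" using Ci y by auto
      have xy: "x \<ominus> y \<in> C i" using y(2) Q_eq[OF xX yX] C(2)[of i] i by auto
      have "\<zero> \<ominus> y \<in> C i" using Ci y by auto
      then have "(x \<ominus> y) \<ominus> (\<zero> \<ominus> y) \<in> C i" using Ci(2) xy by blast
      then show False using x(2) xX yX by (simp add: minus_eq a_assoc l_neg)
    qed
    moreover have "Y +> x \<in> G (Suc i)" using x by (simp add: G_def)
    moreover have "G i \<subseteq> G (Suc i)" using C(3)[OF i] by (auto simp: G_def)
    ultimately show ?thesis by auto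
  qed
  ultimately show "has_chain A (quot_module V Y) {} n" unfolding has_chain_def by blast
qed

lemma quot_length_eq:
  "module_length A (quot_module V Y) = enat d \<longleftrightarrow> has_chain A V Y d \<and> \<not> has_chain A V Y (Suc d)"
proof -
  have "has_chain A V Y 0" unfolding has_chain_def using Y by (intro exI[of _ "\<lambda>_. Y"]) simp
  then show ?thesis using module_length_eq[of A "quot_module V Y" d] by (simp add: quot_has_chain)
qed

lemma quot_length_ge: "has_chain A V Y n \<Longrightarrow> enat n \<le> module_length A (quot_module V Y)"
  using has_chain_le_length[of A "quot_module V Y" n] by (simp add: quot_has_chain)

end

end

lemma (in module) additive_action: "additive_action R M"
  by unfold_locales (auto simp: smult_r_distr)

section \<open>Fractions and the correspondence theorem for localizations\<close>

context module
begin

context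
  fixes P W N assumes W_def: "W = carrier R - P" and W: "mult_set W" and N: "closed_sub (carrier R) N"
begin

private abbreviation "fr \<equiv> mod_frac R W M"
private abbreviation "LM \<equiv> localized_module R P M"
private abbreviation "LR \<equiv> localized_ring R P"

private lemma WR: "w \<in> W \<Longrightarrow> w \<in> carrier R" using mult_setD(1)[OF W] .
private lemma W1: "\<one> \<in> W" using mult_setD(2)[OF W] .
private lemma Wm: "v \<in> W \<Longrightarrow> w \<in> W \<Longrightarrow> v \<otimes> w \<in> W" using mult_setD(3)[OF W] .

private lemma fr_mem: "(y, t) \<in> fr x s \<longleftrightarrow> y \<in> carrier M \<and> t \<in> W \<and> (\<exists>u\<in>W. u \<odot>\<^bsub>M\<^esub> (t \<odot>\<^bsub>M\<^esub> x) = u \<odot>\<^bsub>M\<^esub> (s \<odot>\<^bsub>M\<^esub> y))"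
  by (simp add: mod_frac_def)

private lemma fr_self: "x \<in> carrier M \<Longrightarrow> s \<in> W \<Longrightarrow> (x, s) \<in> fr x s"
  using W1 by (auto simp: fr_mem)

private lemma fr_trans:
  assumes x: "x \<in> carrier M" "s \<in> W" and y: "(y, t) \<in> fr x s" and z: "(z, r) \<in> fr y t"
  shows "(z, r) \<in> fr x s"
proof -
  obtain u v where u: "y \<in> carrier M" "t \<in> W" "u \<in> W" "u \<odot>\<^bsub>M\<^esub> (t \<odot>\<^bsub>M\<^esub> x) = u \<odot>\<^bsub>M\<^esub> (s \<odot>\<^bsub>M\<^esub> y)"
    and v: "z \<in> carrier M" "r \<in> W" "v \<in> W" "v \<odot>\<^bsub>M\<^esub> (r \<odot>\<^bsub>M\<^esub> y) = v \<odot>\<^bsub>M\<^esub> (t \<odot>\<^bsub>M\<^esub> z)"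
    using y z by (auto simp: fr_mem)
  note cl = WR[OF x(2)] WR[OF u(2)] WR[OF u(3)] WR[OF v(2)] WR[OF v(3)]
  \<comment> \<open>The extra factor \<open>t\<close> allows the two equations about
    \<open>y\<close> to be applied one after the other.\<close>
  have "(u \<otimes> v \<otimes> t) \<odot>\<^bsub>M\<^esub> (r \<odot>\<^bsub>M\<^esub> x) = (v \<otimes> r) \<odot>\<^bsub>M\<^esub> (u \<odot>\<^bsub>M\<^esub> (t \<odot>\<^bsub>M\<^esub> x))"
    using cl x by (simp add: smult_assoc1[symmetric] R.m_ac)
  also have "\<dots> = (u \<otimes> s) \<odot>\<^bsub>M\<^esub> (v \<odot>\<^bsub>M\<^esub> (r \<odot>\<^bsub>M\<^esub> y))"
    unfolding u(4) using cl u(1) by (simp add: smult_assoc1[symmetric] R.m_ac)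
  also have "\<dots> = (u \<otimes> v \<otimes> t) \<odot>\<^bsub>M\<^esub> (s \<odot>\<^bsub>M\<^esub> z)"
    unfolding v(4) using cl v(1) by (simp add: smult_assoc1[symmetric] R.m_ac)
  finally show ?thesis using v(1,2) Wm[OF Wm[OF u(3) v(3)] u(2)] by (auto simp: fr_mem)
qed

private lemma fr_sym:
  assumes "x \<in> carrier M" "s \<in> W" "(y, t) \<in> fr x s" shows "(x, s) \<in> fr y t"
  using assms by (auto simp: fr_mem) metis

private lemma fr_eqI:
  assumes x: "x \<in> carrier M" "s \<in> W" and y: "(y, t) \<in> fr x s"
  shows "fr y t = fr x s"
proof -
  have y': "y \<in> carrier M" "t \<in> W" using y by (auto simp: fr_mem)
  have "p \<in> fr y t \<longleftrightarrow> p \<in> fr x s" for p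
    using fr_trans[OF x y, of "fst p" "snd p"] fr_trans[OF y' fr_sym[OF x y], of "fst p" "snd p"] by auto
  then show ?thesis by blast
qed

private lemma fr_eqD:
  assumes x: "x \<in> carrier M" "s \<in> W" and y: "y \<in> carrier M" "t \<in> W" and eq: "fr x s = fr y t"
  obtains u where "u \<in> W" "u \<odot>\<^bsub>M\<^esub> (t \<odot>\<^bsub>M\<^esub> x) = u \<odot>\<^bsub>M\<^esub> (s \<odot>\<^bsub>M\<^esub> y)"
  using fr_self[OF y] unfolding eq[symmetric] by (auto simp: fr_mem)

private lemma fr_expand:
  assumes x: "x \<in> carrier M" "s \<in> W" and r: "r \<in> W"
  shows "fr (r \<odot>\<^bsub>M\<^esub> x) (r \<otimes> s) = fr x s"
proof (rule fr_eqI[OF x])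
  have "\<one> \<odot>\<^bsub>M\<^esub> ((r \<otimes> s) \<odot>\<^bsub>M\<^esub> x) = \<one> \<odot>\<^bsub>M\<^esub> (s \<odot>\<^bsub>M\<^esub> (r \<odot>\<^bsub>M\<^esub> x))"
    using x(1) WR[OF x(2)] WR[OF r] by (simp add: smult_assoc1[symmetric] R.m_comm)
  then show "(r \<odot>\<^bsub>M\<^esub> x, r \<otimes> s) \<in> fr x s" using x WR[OF r] Wm[OF r x(2)] W1 by (auto simp: fr_mem)
qed

private lemma LM_carrier: "carrier LM = {fr x s | x s. x \<in> carrier M \<and> s \<in> W}"
  by (simp add: localized_module_def Let_def W_def)

private lemma LM_zero: "\<zero>\<^bsub>LM\<^esub> = fr \<zero>\<^bsub>M\<^esub> \<one>"
  by (simp add: localized_module_def Let_def W_def)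

text \<open>The sum is defined as a union over all representatives of both fractions, so the content
  is that every choice gives the same fraction.\<close>

private lemma LM_add:
  assumes x: "x \<in> carrier M" "s \<in> W" and y: "y \<in> carrier M" "t \<in> W"
  shows "fr x s \<oplus>\<^bsub>LM\<^esub> fr y t = fr (t \<odot>\<^bsub>M\<^esub> x \<oplus>\<^bsub>M\<^esub> s \<odot>\<^bsub>M\<^esub> y) (s \<otimes> t)"
proof -
  have eq: "fr (t' \<odot>\<^bsub>M\<^esub> x' \<oplus>\<^bsub>M\<^esub> s' \<odot>\<^bsub>M\<^esub> y') (s' \<otimes> t') = fr (t \<odot>\<^bsub>M\<^esub> x \<oplus>\<^bsub>M\<^esub> s \<odot>\<^bsub>M\<^esub> y) (s \<otimes> t)"
    if mem: "(x', s') \<in> fr x s" "(y', t') \<in> fr y t" for x' s' y' t'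
  proof (rule fr_eqI)
    obtain u v where u: "x' \<in> carrier M" "s' \<in> W" "u \<in> W" "u \<odot>\<^bsub>M\<^esub> (s' \<odot>\<^bsub>M\<^esub> x) = u \<odot>\<^bsub>M\<^esub> (s \<odot>\<^bsub>M\<^esub> x')"
      and v: "y' \<in> carrier M" "t' \<in> W" "v \<in> W" "v \<odot>\<^bsub>M\<^esub> (t' \<odot>\<^bsub>M\<^esub> y) = v \<odot>\<^bsub>M\<^esub> (t \<odot>\<^bsub>M\<^esub> y')"
      using mem by (auto simp: fr_mem)
    note cl = WR[OF x(2)] WR[OF y(2)] WR[OF u(2)] WR[OF u(3)] WR[OF v(2)] WR[OF v(3)] x(1) y(1) u(1) v(1)
    show "t \<odot>\<^bsub>M\<^esub> x \<oplus>\<^bsub>M\<^esub> s \<odot>\<^bsub>M\<^esub> y \<in> carrier M" "s \<otimes> t \<in> W" using cl Wm[OF x(2) y(2)] by auto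
    have "(u \<otimes> v) \<odot>\<^bsub>M\<^esub> ((s' \<otimes> t') \<odot>\<^bsub>M\<^esub> (t \<odot>\<^bsub>M\<^esub> x \<oplus>\<^bsub>M\<^esub> s \<odot>\<^bsub>M\<^esub> y))
      = (v \<otimes> t \<otimes> t') \<odot>\<^bsub>M\<^esub> (u \<odot>\<^bsub>M\<^esub> (s' \<odot>\<^bsub>M\<^esub> x)) \<oplus>\<^bsub>M\<^esub> (u \<otimes> s \<otimes> s') \<odot>\<^bsub>M\<^esub> (v \<odot>\<^bsub>M\<^esub> (t' \<odot>\<^bsub>M\<^esub> y))"
      using cl by (simp add: smult_r_distr smult_assoc1[symmetric] R.m_ac)
    also have "\<dots> = (u \<otimes> v) \<odot>\<^bsub>M\<^esub> ((s \<otimes> t) \<odot>\<^bsub>M\<^esub> (t' \<odot>\<^bsub>M\<^esub> x' \<oplus>\<^bsub>M\<^esub> s' \<odot>\<^bsub>M\<^esub> y'))"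
      unfolding u(4) v(4) using cl by (simp add: smult_r_distr smult_assoc1[symmetric] R.m_ac)
    finally show "(t' \<odot>\<^bsub>M\<^esub> x' \<oplus>\<^bsub>M\<^esub> s' \<odot>\<^bsub>M\<^esub> y', s' \<otimes> t') \<in> fr (t \<odot>\<^bsub>M\<^esub> x \<oplus>\<^bsub>M\<^esub> s \<odot>\<^bsub>M\<^esub> y) (s \<otimes> t)"
      using cl Wm[OF u(2) v(2)] Wm[OF u(3) v(3)] by (auto simp: fr_mem)
  qed
  have "(\<Union>(x', s')\<in>fr x s. \<Union>(y', t')\<in>fr y t. fr (t' \<odot>\<^bsub>M\<^esub> x' \<oplus>\<^bsub>M\<^esub> s' \<odot>\<^bsub>M\<^esub> y') (s' \<otimes> t'))
      = fr (t \<odot>\<^bsub>M\<^esub> x \<oplus>\<^bsub>M\<^esub> s \<odot>\<^bsub>M\<^esub> y) (s \<otimes> t)"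
    using fr_self[OF x] fr_self[OF y] eq by fast
  then show ?thesis by (simp add: localized_module_def Let_def W_def)
qed

private lemma LR_carrier: "carrier LR = {ring_frac R W a s | a s. a \<in> carrier R \<and> s \<in> W}"
  by (simp add: localized_ring_def Let_def W_def)

private lemma LM_smult:
  assumes a: "a \<in> carrier R" "r \<in> W" and y: "y \<in> carrier M" "t \<in> W"
  shows "ring_frac R W a r \<odot>\<^bsub>LM\<^esub> fr y t = fr (a \<odot>\<^bsub>M\<^esub> y) (r \<otimes> t)"
proof -
  have eq: "fr (b \<odot>\<^bsub>M\<^esub> y') (q \<otimes> t') = fr (a \<odot>\<^bsub>M\<^esub> y) (r \<otimes> t)"
    if mem: "(b, q) \<in> ring_frac R W a r" "(y', t') \<in> fr y t" for b q y' t'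
  proof (rule fr_eqI)
    obtain u v where u: "b \<in> carrier R" "q \<in> W" "u \<in> W" "u \<otimes> (q \<otimes> a) = u \<otimes> (r \<otimes> b)"
      and v: "y' \<in> carrier M" "t' \<in> W" "v \<in> W" "v \<odot>\<^bsub>M\<^esub> (t' \<odot>\<^bsub>M\<^esub> y) = v \<odot>\<^bsub>M\<^esub> (t \<odot>\<^bsub>M\<^esub> y')"
      using mem by (auto simp: fr_mem ring_frac_def)
    note cl = a(1) WR[OF a(2)] WR[OF y(2)] u(1) WR[OF u(2)] WR[OF u(3)] WR[OF v(2)] WR[OF v(3)] y(1) v(1)
    show "a \<odot>\<^bsub>M\<^esub> y \<in> carrier M" "r \<otimes> t \<in> W" using cl Wm[OF a(2) y(2)] by auto
    have "(u \<otimes> v) \<odot>\<^bsub>M\<^esub> ((q \<otimes> t') \<odot>\<^bsub>M\<^esub> (a \<odot>\<^bsub>M\<^esub> y)) = (u \<otimes> (q \<otimes> a)) \<odot>\<^bsub>M\<^esub> (v \<odot>\<^bsub>M\<^esub> (t' \<odot>\<^bsub>M\<^esub> y))"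
      using cl by (simp add: smult_assoc1[symmetric] R.m_ac)
    also have "\<dots> = (u \<otimes> v) \<odot>\<^bsub>M\<^esub> ((r \<otimes> t) \<odot>\<^bsub>M\<^esub> (b \<odot>\<^bsub>M\<^esub> y'))"
      unfolding u(4) v(4) using cl by (simp add: smult_assoc1[symmetric] R.m_ac)
    finally show "(b \<odot>\<^bsub>M\<^esub> y', q \<otimes> t') \<in> fr (a \<odot>\<^bsub>M\<^esub> y) (r \<otimes> t)"
      using cl Wm[OF u(2) v(2)] Wm[OF u(3) v(3)] by (auto simp: fr_mem)
  qed
  have self: "(a, r) \<in> ring_frac R W a r" using a W1 by (auto simp: ring_frac_def)
  have "(\<Union>(b, q)\<in>ring_frac R W a r. \<Union>(y', t')\<in>fr y t. fr (b \<odot>\<^bsub>M\<^esub> y') (q \<otimes> t')) = fr (a \<odot>\<^bsub>M\<^esub> y) (r \<otimes> t)"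
    using self fr_self[OF y] eq by fast
  then show ?thesis by (simp add: localized_module_def Let_def W_def)
qed

private lemma LM_add_same:
  assumes x: "x \<in> carrier M" and y: "y \<in> carrier M" and s: "s \<in> W"
  shows "fr x s \<oplus>\<^bsub>LM\<^esub> fr y s = fr (x \<oplus>\<^bsub>M\<^esub> y) s"
proof -
  have "fr x s \<oplus>\<^bsub>LM\<^esub> fr y s = fr (s \<odot>\<^bsub>M\<^esub> (x \<oplus>\<^bsub>M\<^esub> y)) (s \<otimes> s)"
    using LM_add[OF x s y s] x y WR[OF s] by (simp add: smult_r_distr)
  then show ?thesis using fr_expand[OF _ s s, of "x \<oplus>\<^bsub>M\<^esub> y"] x y by simp
qed

text \<open>Over a common denominator, addition acts on numerators alone by
  \<open>LM_add_same\<close>, and the laws of the localization reduce to those of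
  \<open>M\<close>.\<close>

private lemma common2:
  assumes "C \<in> carrier LM" "D \<in> carrier LM"
  obtains x y s where "x \<in> carrier M" "y \<in> carrier M" "s \<in> W" "C = fr x s" "D = fr y s"
proof -
  obtain x s y t where x: "x \<in> carrier M" "s \<in> W" "C = fr x s" and y: "y \<in> carrier M" "t \<in> W" "D = fr y t"
    using assms by (auto simp: LM_carrier)
  show thesis
  proof (rule that)
    show "C = fr (t \<odot>\<^bsub>M\<^esub> x) (s \<otimes> t)" using fr_expand[OF x(1,2) y(2)] x WR y by (simp add: R.m_comm)
    show "D = fr (s \<odot>\<^bsub>M\<^esub> y) (s \<otimes> t)" using fr_expand[OF y(1,2) x(2)] y by simp
  qed (use x y WR Wm in auto)
qed

private lemma fr_zero: "s \<in> W \<Longrightarrow> fr \<zero>\<^bsub>M\<^esub> s = \<zero>\<^bsub>LM\<^esub>"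
  using fr_expand[of "\<zero>\<^bsub>M\<^esub>" \<one> s] W1 WR by (simp add: LM_zero)

private lemma LM_abelian: "abelian_group LM"
proof (rule abelian_groupI)
  fix C D assume C: "C \<in> carrier LM" and D: "D \<in> carrier LM"
  obtain x y s where x: "x \<in> carrier M" "y \<in> carrier M" "s \<in> W" "C = fr x s" "D = fr y s"
    by (rule common2[OF C D])
  have xy: "x \<oplus>\<^bsub>M\<^esub> y \<in> carrier M" using x by simp
  then show "C \<oplus>\<^bsub>LM\<^esub> D \<in> carrier LM" using x by (auto simp: LM_add_same LM_carrier)
  show "C \<oplus>\<^bsub>LM\<^esub> D = D \<oplus>\<^bsub>LM\<^esub> C" using x by (simp add: LM_add_same M.a_comm)
  fix E assume E: "E \<in> carrier LM"
  then obtain z r where z: "z \<in> carrier M" "r \<in> W" "E = fr z r" by (auto simp: LM_carrier)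
  have rs: "r \<otimes> s \<in> W" using Wm z x by simp
  have eqs: "C = fr (r \<odot>\<^bsub>M\<^esub> x) (r \<otimes> s)" "D = fr (r \<odot>\<^bsub>M\<^esub> y) (r \<otimes> s)" "E = fr (s \<odot>\<^bsub>M\<^esub> z) (r \<otimes> s)"
    using fr_expand[OF x(1,3) z(2)] fr_expand[OF x(2,3) z(2)] fr_expand[OF z(1,2) x(3)] x z WR
    by (simp_all add: R.m_comm)
  show "C \<oplus>\<^bsub>LM\<^esub> D \<oplus>\<^bsub>LM\<^esub> E = C \<oplus>\<^bsub>LM\<^esub> (D \<oplus>\<^bsub>LM\<^esub> E)"
    unfolding eqs using x z rs WR by (simp add: LM_add_same M.a_assoc)
next
  show "\<zero>\<^bsub>LM\<^esub> \<in> carrier LM" using W1 by (auto simp: LM_zero LM_carrier)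
  fix C assume C: "C \<in> carrier LM"
  then obtain x s where x: "x \<in> carrier M" "s \<in> W" "C = fr x s" by (auto simp: LM_carrier)
  show "\<zero>\<^bsub>LM\<^esub> \<oplus>\<^bsub>LM\<^esub> C = C" using x by (simp add: fr_zero[OF x(2), symmetric] LM_add_same)
  have "fr (\<ominus>\<^bsub>M\<^esub> x) s \<in> carrier LM" using x by (auto simp: LM_carrier)
  moreover have "fr (\<ominus>\<^bsub>M\<^esub> x) s \<oplus>\<^bsub>LM\<^esub> C = \<zero>\<^bsub>LM\<^esub>" using x by (simp add: LM_add_same M.l_neg fr_zero)
  ultimately show "\<exists>D\<in>carrier LM. D \<oplus>\<^bsub>LM\<^esub> C = \<zero>\<^bsub>LM\<^esub>" by blast
qed

private lemma LM_action: "additive_action LR LM"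
proof (intro additive_action.intro LM_abelian additive_action_axioms.intro)
  fix A C assume A: "A \<in> carrier LR" and C: "C \<in> carrier LM"
  obtain a r where a: "a \<in> carrier R" "r \<in> W" "A = ring_frac R W a r" using A by (auto simp: LR_carrier)
  obtain x s where x: "x \<in> carrier M" "s \<in> W" "C = fr x s" using C by (auto simp: LM_carrier)
  show "A \<odot>\<^bsub>LM\<^esub> C \<in> carrier LM" using a x Wm[OF a(2) x(2)] by (auto simp: LM_smult LM_carrier)
  fix D assume D: "D \<in> carrier LM"
  obtain x y s where x: "x \<in> carrier M" "y \<in> carrier M" "s \<in> W" "C = fr x s" "D = fr y s"
    by (rule common2[OF C D])
  show "A \<odot>\<^bsub>LM\<^esub> (C \<oplus>\<^bsub>LM\<^esub> D) = A \<odot>\<^bsub>LM\<^esub> C \<oplus>\<^bsub>LM\<^esub> A \<odot>\<^bsub>LM\<^esub> D"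
    using a x Wm[OF a(2) x(3)] by (simp add: LM_add_same LM_smult smult_r_distr)
qed

private lemma LM_minus:
  assumes x: "x \<in> carrier M" and y: "y \<in> carrier M" and s: "s \<in> W"
  shows "fr x s \<ominus>\<^bsub>LM\<^esub> fr y s = fr (x \<ominus>\<^bsub>M\<^esub> y) s"
proof -
  interpret L: abelian_group LM by (rule LM_abelian)
  have cl: "fr x s \<in> carrier LM" "fr y s \<in> carrier LM" "fr (x \<ominus>\<^bsub>M\<^esub> y) s \<in> carrier LM"
    using x y s by (auto simp: LM_carrier)
  have "fr x s = fr (x \<ominus>\<^bsub>M\<^esub> y) s \<oplus>\<^bsub>LM\<^esub> fr y s"
    using x y s by (simp add: LM_add_same M.minus_eq M.a_assoc M.l_neg)
  then show ?thesis using cl by (simp add: L.minus_eq L.a_assoc L.r_neg)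
qed

private lemma localized_closed:
  assumes C: "closed_sub (carrier R) C"
  shows "submodule {fr x s | x s. x \<in> C \<and> s \<in> W} LR LM" (is "submodule ?L LR LM")
proof -
  interpret L: abelian_group LM by (rule LM_abelian)
  note CD = closed_subD[OF C]
  show ?thesis
    unfolding submodule_iff_minus[OF LM_abelian]
  proof (intro conjI ballI)
    show "?L \<subseteq> carrier LM" using CD(1) by (auto simp: LM_carrier)
    show "\<zero>\<^bsub>LM\<^esub> \<in> ?L" using CD(2) W1 unfolding LM_zero by blast
    fix g assume "g \<in> ?L"
    then obtain x s where x: "x \<in> C" "s \<in> W" "g = fr x s" by auto
    have xM: "x \<in> carrier M" using CD(1) x by simp
    {
      fix h assume "h \<in> ?L"
      then obtain y t where y: "y \<in> C" "t \<in> W" "h = fr y t" by auto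
      have yM: "y \<in> carrier M" using CD(1) y by simp
      have "g = fr (t \<odot>\<^bsub>M\<^esub> x) (s \<otimes> t)" "h = fr (s \<odot>\<^bsub>M\<^esub> y) (s \<otimes> t)"
        using fr_expand[OF xM x(2) y(2)] fr_expand[OF yM y(2) x(2)] x y WR by (simp_all add: R.m_comm)
      then have "g \<ominus>\<^bsub>LM\<^esub> h = fr (t \<odot>\<^bsub>M\<^esub> x \<ominus>\<^bsub>M\<^esub> s \<odot>\<^bsub>M\<^esub> y) (s \<otimes> t)"
        using LM_minus[of "t \<odot>\<^bsub>M\<^esub> x" "s \<odot>\<^bsub>M\<^esub> y" "s \<otimes> t"] xM yM WR[OF x(2)] WR[OF y(2)] Wm[OF x(2) y(2)] by simp
      moreover have "t \<odot>\<^bsub>M\<^esub> x \<ominus>\<^bsub>M\<^esub> s \<odot>\<^bsub>M\<^esub> y \<in> C"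
        using CD(3)[OF CD(4)[OF WR[OF y(2)] x(1)] CD(4)[OF WR[OF x(2)] y(1)]] .
      ultimately show "g \<ominus>\<^bsub>LM\<^esub> h \<in> ?L" using Wm[OF x(2) y(2)] by blast
    next
      fix A assume "A \<in> carrier LR"
      then obtain a r where a: "a \<in> carrier R" "r \<in> W" "A = ring_frac R W a r" by (auto simp: LR_carrier)
      have "A \<odot>\<^bsub>LM\<^esub> g = fr (a \<odot>\<^bsub>M\<^esub> x) (r \<otimes> s)" using a x xM by (simp add: LM_smult)
      then show "A \<odot>\<^bsub>LM\<^esub> g \<in> ?L" using CD(4)[OF a(1) x(1)] Wm[OF a(2) x(2)] by blast
    }
  qed
qed

private lemma localized_submodule_eq: "localized_submodule R P M N = {fr x s | x s. x \<in> N \<and> s \<in> W}"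
  by (simp add: localized_submodule_def W_def)

text \<open>Submodules of the localization are contracted along x to x / 1, and saturated submodules
  are extended to all their fractions. Contractions are saturated because denominators become
  invertible.\<close>

lemma localized_has_chain:
  "has_chain LR LM (localized_submodule R P M N) n \<longleftrightarrow> (\<exists>C. sat_chain W (carrier M) n C \<and> N \<subseteq> C 0)"
proof
  interpret L: abelian_group LM by (rule LM_abelian)
  assume "has_chain LR LM (localized_submodule R P M N) n"
  then obtain G where G: "\<And>i. i \<le> n \<Longrightarrow> submodule (G i) LR LM" "\<And>i. i \<le> n \<Longrightarrow> localized_submodule R P M N \<subseteq> G i"
    "\<And>i. i < n \<Longrightarrow> G i \<subset> G (Suc i)"
    unfolding has_chain_def by auto
  note GD = G(1)[unfolded submodule_iff_minus[OF LM_abelian]]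
  define C where "C i = {x \<in> carrier M. fr x \<one> \<in> G i}" for i
  have scale: "fr x s \<in> G i \<Longrightarrow> a \<in> carrier R \<Longrightarrow> r \<in> W \<Longrightarrow> x \<in> carrier M \<Longrightarrow> s \<in> W \<Longrightarrow> i \<le> n \<Longrightarrow> fr (a \<odot>\<^bsub>M\<^esub> x) (r \<otimes> s) \<in> G i" for i x s a r
  proof -
    assume *: "fr x s \<in> G i" "a \<in> carrier R" "r \<in> W" "x \<in> carrier M" "s \<in> W" "i \<le> n"
    have "ring_frac R W a r \<in> carrier LR" using * by (auto simp: LR_carrier)
    then have "ring_frac R W a r \<odot>\<^bsub>LM\<^esub> fr x s \<in> G i" using GD[OF *(6)] *(1) by blast
    then show ?thesis using LM_smult[OF *(2,3,4,5)] by simp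
  qed
  \<comment> \<open>Multiplying by s / 1 and by 1 / s shows that membership of a fraction depends on
    its numerator only.\<close>
  have iff: "fr x s \<in> G i \<longleftrightarrow> x \<in> C i" if x: "x \<in> carrier M" "s \<in> W" and i: "i \<le> n" for x s i
  proof
    assume "fr x s \<in> G i"
    from scale[OF this WR[OF x(2)] W1 x i] have "fr (s \<odot>\<^bsub>M\<^esub> x) (s \<otimes> \<one>) \<in> G i" using WR[OF x(2)] by simp
    then show "x \<in> C i" using fr_expand[OF x(1) W1 x(2)] x(1) by (simp add: C_def)
  next
    assume "x \<in> C i"
    then have "fr x \<one> \<in> G i" by (simp add: C_def)
    from scale[OF this R.one_closed x(2) x(1) W1 i] show "fr x s \<in> G i" using x WR by simp
  qed
  have "sat_chain W (carrier M) n C"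
    unfolding sat_chain_def
  proof (intro conjI allI impI)
    fix i assume i: "i \<le> n"
    show "closed_sub (carrier R) (C i)"
    proof (rule closed_subI)
      show "\<zero>\<^bsub>M\<^esub> \<in> C i" using GD[OF i] by (auto simp: C_def LM_zero)
      show "x \<ominus>\<^bsub>M\<^esub> y \<in> C i" if xy: "x \<in> C i" "y \<in> C i" for x y
      proof -
        have "fr x \<one> \<ominus>\<^bsub>LM\<^esub> fr y \<one> \<in> G i" using GD[OF i] xy by (simp add: C_def)
        then show ?thesis using LM_minus[OF _ _ W1, of x y] xy by (simp add: C_def)
      qed
      show "a \<odot>\<^bsub>M\<^esub> x \<in> C i" if "a \<in> carrier R" "x \<in> C i" for a x
        using scale[OF _ that(1) W1 _ W1 i, of x] that by (simp add: C_def)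
    qed (auto simp: C_def)
    show "C i \<subseteq> carrier M" by (auto simp: C_def)
    show "saturated W (carrier M) (C i)"
      unfolding saturated_def
    proof (intro ballI impI)
      fix w x assume w: "w \<in> W" and x: "x \<in> carrier M" and wx: "w \<odot>\<^bsub>M\<^esub> x \<in> C i"
      then have "fr (w \<odot>\<^bsub>M\<^esub> x) w \<in> G i" using iff[of "w \<odot>\<^bsub>M\<^esub> x" w i] i WR by simp
      moreover have "fr (w \<odot>\<^bsub>M\<^esub> x) w = fr x \<one>" using fr_expand[OF x W1 w] WR[OF w] by simp
      ultimately show "x \<in> C i" using x by (simp add: C_def)
    qed
  next
    fix i assume i: "i < n"
    obtain g where g: "g \<in> G (Suc i)" "g \<notin> G i" using G(3)[OF i] by auto
    then have "g \<in> carrier LM" using GD[of "Suc i"] i by auto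
    then obtain x s where x: "x \<in> carrier M" "s \<in> W" "g = fr x s" by (auto simp: LM_carrier)
    then have "x \<in> C (Suc i)" "x \<notin> C i" using g iff[OF x(1,2)] i by auto
    moreover have "C i \<subseteq> C (Suc i)" using G(3)[OF i] by (auto simp: C_def)
    ultimately show "C i \<subset> C (Suc i)" by auto
  qed
  moreover have "N \<subseteq> C 0"
    using G(2)[of 0] W1 closed_subD(1)[OF N] unfolding localized_submodule_eq C_def by blast
  ultimately show "\<exists>C. sat_chain W (carrier M) n C \<and> N \<subseteq> C 0" by blast
next
  assume "\<exists>C. sat_chain W (carrier M) n C \<and> N \<subseteq> C 0"
  then obtain C where C: "sat_chain W (carrier M) n C" "N \<subseteq> C 0" by blast
  note CD = sat_chainD[OF C(1)]
  define G where "G i = {fr x s | x s. x \<in> C i \<and> s \<in> W}" for i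
  have "submodule (G i) LR LM" if "i \<le> n" for i
    unfolding G_def by (rule localized_closed[OF CD(1)[OF that]])
  moreover have "localized_submodule R P M N \<subseteq> G i" if "i \<le> n" for i
    unfolding localized_submodule_eq G_def using sat_chain_mono[OF C(1) _ that, of 0] C(2) by blast
  moreover have "G i \<subset> G (Suc i)" if i: "i < n" for i
  proof -
    obtain x where x: "x \<in> C (Suc i)" "x \<notin> C i" using CD(4)[OF i] by auto
    have xM: "x \<in> carrier M" using CD(2)[of "Suc i"] i x by auto
    \<comment> \<open>Equality of fractions only puts a multiple of \<open>x\<close> by a
      denominator into \<open>C i\<close>; saturation then removes the denominator.\<close>
    have "fr x \<one> \<notin> G i"
    proof
      assume "fr x \<one> \<in> G i"
      then obtain y t where y: "y \<in> C i" "t \<in> W" "fr x \<one> = fr y t" by (auto simp: G_def)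
      have yM: "y \<in> carrier M" using CD(2)[of i] i y by auto
      obtain u where u: "u \<in> W" "u \<odot>\<^bsub>M\<^esub> (t \<odot>\<^bsub>M\<^esub> x) = u \<odot>\<^bsub>M\<^esub> (\<one> \<odot>\<^bsub>M\<^esub> y)"
        by (rule fr_eqD[OF xM W1 yM y(2,3)])
      have "(u \<otimes> t) \<odot>\<^bsub>M\<^esub> x \<in> C i"
        using u(2) closed_subD(4)[OF CD(1)[of i] WR[OF u(1)] y(1)] i xM yM WR[OF u(1)] WR[OF y(2)]
        by (simp add: smult_assoc1)
      then show False using saturatedD[OF CD(3)[of i] Wm[OF u(1) y(2)] xM] i x(2) by simp
    qed
    moreover have "fr x \<one> \<in> G (Suc i)" using x W1 unfolding G_def by blast
    moreover have "G i \<subseteq> G (Suc i)" using CD(4)[OF i] unfolding G_def by blast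
    ultimately show ?thesis by blast
  qed
  ultimately show "has_chain LR LM (localized_submodule R P M N) n" unfolding has_chain_def by blast
qed

lemma localized_length_eq:
  "module_length LR (quot_module LM (localized_submodule R P M N)) = enat d \<longleftrightarrow>
     (\<exists>C. sat_chain W (carrier M) d C \<and> N \<subseteq> C 0) \<and>
     (\<forall>C. sat_chain W (carrier M) (Suc d) C \<longrightarrow> \<not> N \<subseteq> C 0)"
  using additive_action.quot_length_eq[OF LM_action localized_closed[OF N]] localized_has_chain
  unfolding localized_submodule_eq by auto

end

end

section \<open>General vectors\<close>

text \<open>It lets statements about values modulo a prime be applied to a field with the zero
  ideal.\<close>

lemma (in cring) infinite_quot_zero:
  assumes "infinite (carrier R)" shows "infinite (carrier (R Quot {\<zero>}))"
proof -
  have "carrier (R Quot {\<zero>}) = (\<lambda>x. {x}) ` carrier R"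
    by (auto simp: FactRing_def A_RCOSETS_def RCOSETS_def r_coset_def)
  moreover have "inj_on (\<lambda>x. {x}) (carrier R)" by (auto intro: inj_onI)
  ultimately show ?thesis using assms finite_imageD by metis
qed

section \<open>The Zariski topology over an infinite field\<close>

context field
begin

text \<open>Generating sets are complements of zero loci of families, and one member of the family
  is enough near a given point. Intersections reduce to products of polynomials because a field has
  no zero divisors.\<close>

lemma zariski_open_contains_basic:
  assumes "openin (zariski_topology R t) U" "x \<in> U"
  shows "\<exists>g\<in>carrier (mpoly_ring R t). x \<in> vectors R t \<and> mpoly_eval R t x g \<noteq> \<zero> \<and>
    {y \<in> vectors R t. mpoly_eval R t y g \<noteq> \<zero>} \<subseteq> U"
proof -
  interpret S: cring "mpoly_ring R t" by (rule mpoly_cring)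
  have "generate_topology_on {{x \<in> vectors R t. \<not> (\<forall>f\<in>F. mpoly_eval R t x f = \<zero>)} | F. F \<subseteq> carrier (mpoly_ring R t)} U"
    using assms(1) unfolding zariski_topology_def openin_topology_generated_by_iff .
  then show ?thesis using assms(2)
  proof (induction arbitrary: x)
    case Empty
    then show ?case by simp
  next
    case (Int a b)
    obtain g where g: "g \<in> carrier (mpoly_ring R t)" "x \<in> vectors R t" "mpoly_eval R t x g \<noteq> \<zero>"
      "{y \<in> vectors R t. mpoly_eval R t y g \<noteq> \<zero>} \<subseteq> a" using Int.IH(1)[of x] Int.prems by auto
    obtain h where h: "h \<in> carrier (mpoly_ring R t)" "mpoly_eval R t x h \<noteq> \<zero>"
      "{y \<in> vectors R t. mpoly_eval R t y h \<noteq> \<zero>} \<subseteq> b" using Int.IH(2)[of x] Int.prems by auto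
    have ev: "mpoly_eval R t y (g \<otimes>\<^bsub>mpoly_ring R t\<^esub> h) \<noteq> \<zero> \<longleftrightarrow> mpoly_eval R t y g \<noteq> \<zero> \<and> mpoly_eval R t y h \<noteq> \<zero>"
      if "y \<in> vectors R t" for y
      using mpoly_eval_mult[OF vectors_Pi[OF that] g(1) h(1)] mpoly_eval_closed[OF vectors_Pi[OF that] g(1)]
        mpoly_eval_closed[OF vectors_Pi[OF that] h(1)] by (simp add: integral_iff)
    show ?case
      by (rule bexI[of _ "g \<otimes>\<^bsub>mpoly_ring R t\<^esub> h"]) (use g h ev in auto)
  next
    case (UN K)
    then obtain k where k: "k \<in> K" "x \<in> k" by auto
    from UN.IH[OF k] k(1) show ?case by blast
  next
    case (Basis s)
    then obtain F where F: "F \<subseteq> carrier (mpoly_ring R t)" "s = {x \<in> vectors R t. \<not> (\<forall>f\<in>F. mpoly_eval R t x f = \<zero>)}" by auto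
    then obtain f where "f \<in> F" "x \<in> vectors R t" "mpoly_eval R t x f \<noteq> \<zero>" using Basis.prems by auto
    then show ?case using F by blast
  qed
qed

text \<open>Two nonempty basic sets meet by \<open>common_nonvanishing_point\<close> for the zero
  ideal, since the field is infinite.\<close>

lemma zariski_basic_open_dense:
  assumes inf: "infinite (carrier R)" and f: "f \<in> carrier (mpoly_ring R t)"
    and x: "x \<in> vectors R t" "mpoly_eval R t x f \<noteq> \<zero>"
  defines "U \<equiv> {y \<in> vectors R t. mpoly_eval R t y f \<noteq> \<zero>}"
  shows "openin (zariski_topology R t) U" "zariski_topology R t closure_of U = vectors R t"
proof -
  interpret S: cring "mpoly_ring R t" by (rule mpoly_cring)
  let ?B = "{{x \<in> vectors R t. \<not> (\<forall>f\<in>F. mpoly_eval R t x f = \<zero>)} | F. F \<subseteq> carrier (mpoly_ring R t)}"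
  have "U = {x \<in> vectors R t. \<not> (\<forall>f\<in>{f}. mpoly_eval R t x f = \<zero>)}" by (auto simp: U_def)
  then have "U \<in> ?B" using f by blast
  then show "openin (zariski_topology R t) U"
    unfolding zariski_topology_def openin_topology_generated_by_iff by (rule generate_topology_on.Basis)
  \<comment> \<open>The constant one shows that the set of all vectors is itself a generating set,
    hence the underlying space.\<close>
  have "{x \<in> vectors R t. \<not> (\<forall>f\<in>{\<one>\<^bsub>mpoly_ring R t\<^esub>}. mpoly_eval R t x f = \<zero>)} = vectors R t"
    using ring_hom_one[OF mpoly_eval_hom[OF vectors_Pi]] by auto
  moreover have "{x \<in> vectors R t. \<not> (\<forall>f\<in>{\<one>\<^bsub>mpoly_ring R t\<^esub>}. mpoly_eval R t x f = \<zero>)} \<in> ?B"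
    by blast
  ultimately have top: "topspace (zariski_topology R t) = vectors R t"
    unfolding zariski_topology_def topology_generated_by_topspace by auto
  have "\<exists>y\<in>U. y \<in> T" if T: "openin (zariski_topology R t) T" "w \<in> T" for T w
  proof -
    obtain g where g: "g \<in> carrier (mpoly_ring R t)" "w \<in> vectors R t" "mpoly_eval R t w g \<noteq> \<zero>"
      "{y \<in> vectors R t. mpoly_eval R t y g \<noteq> \<zero>} \<subseteq> T"
      using zariski_open_contains_basic[OF T] by auto
    obtain z where "z \<in> vectors R t" "mpoly_eval R t z f \<notin> {\<zero>}" "mpoly_eval R t z g \<notin> {\<zero>}"
      using common_nonvanishing_point[OF zeroprimeideal infinite_quot_zero[OF inf] f g(1) x(1) _ g(2)] x(2) g(3)
      by (metis singletonD)
    then show ?thesis using g(4) by (auto simp: U_def)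
  qed
  then show "zariski_topology R t closure_of U = vectors R t"
    unfolding closure_of_def top by auto
qed

end

text \<open>One polynomial over \<open>R\<close> with some value outside \<mm> is enough to control
  a general property: its reduction modulo \<mm> defines a nonempty, hence dense, basic open set of
  vectors over the residue field.\<close>

lemma (in cring) general_vectorI:
  assumes m: "maximalideal \<mm> R" and inf: "infinite (carrier (R Quot \<mm>))"
    and f: "f \<in> carrier (mpoly_ring R t)" and x: "x \<in> vectors R t" "mpoly_eval R t x f \<notin> \<mm>"
    and P: "\<And>\<alpha>. \<alpha> \<in> vectors R t \<Longrightarrow> mpoly_eval R t \<alpha> f \<notin> \<mm> \<Longrightarrow> P \<alpha>"
  shows "general_vector R \<mm> t P"
proof -
  interpret m: maximalideal \<mm> R by fact
  interpret k: field "R Quot \<mm>" using m.quotient_is_field[OF is_cring] .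
  have proj: "(+>) \<mm> \<in> ring_hom R (R Quot \<mm>)" by (rule m.rcos_ring_hom)
  define red where "red p = (\<lambda>u. \<mm> +> p u)" for p :: "nat multiset \<Rightarrow> 'a"
  have zero: "\<mm> +> \<zero> = \<zero>\<^bsub>R Quot \<mm>\<^esub>" using ring_hom_zero[OF proj ring_axioms k.ring_axioms] .
  have red_const: "red (indexed_const c) = k.indexed_const (\<mm> +> c)" for c
    by (rule ext) (simp add: red_def indexed_const_def k.indexed_const_def zero)
  have red_add: "red (p \<Oplus> q) = k.indexed_padd (red p) (red q)" if "carrier_coeff p" "carrier_coeff q" for p q
    using that by (intro ext) (simp add: red_def indexed_padd_def k.indexed_padd_def carrier_coeff_def ring_hom_add[OF proj])
  have red_mult: "red (p \<Otimes> i) = k.indexed_pmult (red p) i" for p i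
    by (rule ext) (simp add: red_def indexed_pmult_def k.indexed_pmult_def zero)
  have res: "residue_vector R \<mm> t \<alpha> \<in> vectors (R Quot \<mm>) t" if "\<alpha> \<in> vectors R t" for \<alpha>
    using that ring_hom_closed[OF proj] by (auto simp: residue_vector_def vectors_def)
  \<comment> \<open>Reduction of coefficients commutes with evaluation. That the reduced function is
    again a polynomial belongs to the same induction, because the evaluation laws over the residue
    field require it.\<close>
  have red: "red p \<in> carrier (mpoly_ring (R Quot \<mm>) t) \<and>
      (\<forall>\<alpha>\<in>vectors R t. mpoly_eval (R Quot \<mm>) t (residue_vector R \<mm> t \<alpha>) (red p) = \<mm> +> mpoly_eval R t \<alpha> p)"
    if "p \<in> indexed_pset {..<t} (carrier R)" for p
    using that
  proof induction
    case (indexed_const c)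
    have c: "\<mm> +> c \<in> carrier (R Quot \<mm>)" using ring_hom_closed[OF proj indexed_const] .
    show ?case
      unfolding red_const
      using k.mpoly_eval_const[OF k.vectors_Pi[OF res] c] mpoly_eval_const[OF vectors_Pi indexed_const]
        k.indexed_pset.indexed_const[OF c] by (simp add: k.mpoly_ring_simps)
  next
    case (indexed_padd p q)
    note cl = indexed_padd(1,2)[folded mpoly_ring_simps(1)]
    note red_pq = red_add[OF pset_coeff[OF indexed_padd(1)] pset_coeff[OF indexed_padd(2)]]
    have "k.indexed_padd (red p) (red q) \<in> carrier (mpoly_ring (R Quot \<mm>) t)"
      using indexed_padd.IH by (simp add: k.mpoly_ring_simps k.indexed_pset.indexed_padd)
    moreover have "mpoly_eval (R Quot \<mm>) t (residue_vector R \<mm> t \<alpha>) (k.indexed_padd (red p) (red q))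
        = \<mm> +> mpoly_eval R t \<alpha> (p \<Oplus> q)" if \<alpha>: "\<alpha> \<in> vectors R t" for \<alpha>
    proof -
      have "mpoly_eval (R Quot \<mm>) t (residue_vector R \<mm> t \<alpha>) (k.indexed_padd (red p) (red q))
        = (\<mm> +> mpoly_eval R t \<alpha> p) \<oplus>\<^bsub>R Quot \<mm>\<^esub> (\<mm> +> mpoly_eval R t \<alpha> q)"
        using k.mpoly_eval_add[OF k.vectors_Pi[OF res[OF \<alpha>]], of "red p" "red q"] indexed_padd.IH \<alpha>
        by (simp add: k.mpoly_ring_simps)
      also have "\<dots> = \<mm> +> (mpoly_eval R t \<alpha> p \<oplus> mpoly_eval R t \<alpha> q)"
        using ring_hom_add[OF proj mpoly_eval_closed[OF vectors_Pi[OF \<alpha>] cl(1)] mpoly_eval_closed[OF vectors_Pi[OF \<alpha>] cl(2)]] ..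
      also have "mpoly_eval R t \<alpha> p \<oplus> mpoly_eval R t \<alpha> q = mpoly_eval R t \<alpha> (p \<Oplus> q)"
        using mpoly_eval_add[OF vectors_Pi[OF \<alpha>] cl] by (simp add: mpoly_ring_simps)
      finally show ?thesis .
    qed
    ultimately show ?case unfolding red_pq by blast
  next
    case (indexed_pmult p i)
    note cl = indexed_pmult(1)[folded mpoly_ring_simps(1)]
    have i: "i < t" using indexed_pmult by simp
    have "k.indexed_pmult (red p) i \<in> carrier (mpoly_ring (R Quot \<mm>) t)"
      using indexed_pmult.IH i by (simp add: k.mpoly_ring_simps k.indexed_pset.indexed_pmult)
    moreover have "mpoly_eval (R Quot \<mm>) t (residue_vector R \<mm> t \<alpha>) (k.indexed_pmult (red p) i)
        = \<mm> +> mpoly_eval R t \<alpha> (p \<Otimes> i)" if \<alpha>: "\<alpha> \<in> vectors R t" for \<alpha>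
    proof -
      have ai: "\<alpha> i \<in> carrier R" using vectors_Pi[OF \<alpha>] i by auto
      have ri: "residue_vector R \<mm> t \<alpha> i = \<mm> +> \<alpha> i" using i by (simp add: residue_vector_def)
      have "mpoly_eval (R Quot \<mm>) t (residue_vector R \<mm> t \<alpha>) (k.indexed_pmult (red p) i)
        = (\<mm> +> \<alpha> i) \<otimes>\<^bsub>R Quot \<mm>\<^esub> (\<mm> +> mpoly_eval R t \<alpha> p)"
        using k.mpoly_eval_pmult[OF k.vectors_Pi[OF res[OF \<alpha>]] _ i, of "red p"] indexed_pmult.IH \<alpha>
        by (simp add: ri)
      also have "\<dots> = \<mm> +> (\<alpha> i \<otimes> mpoly_eval R t \<alpha> p)"
        using ring_hom_mult[OF proj ai mpoly_eval_closed[OF vectors_Pi[OF \<alpha>] cl]] ..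
      also have "\<alpha> i \<otimes> mpoly_eval R t \<alpha> p = mpoly_eval R t \<alpha> (p \<Otimes> i)"
        using mpoly_eval_pmult[OF vectors_Pi[OF \<alpha>] cl i] by simp
      finally show ?thesis .
    qed
    ultimately show ?case unfolding red_mult by blast
  qed
  note redf = red[OF f[unfolded mpoly_ring_simps]]
  have nz: "mpoly_eval (R Quot \<mm>) t (residue_vector R \<mm> t \<alpha>) (red f) \<noteq> \<zero>\<^bsub>R Quot \<mm>\<^esub> \<longleftrightarrow> mpoly_eval R t \<alpha> f \<notin> \<mm>"
    if \<alpha>: "\<alpha> \<in> vectors R t" for \<alpha>
  proof -
    have c: "mpoly_eval R t \<alpha> f \<in> carrier R" using mpoly_eval_closed[OF vectors_Pi[OF \<alpha>] f] .
    have "\<mm> +> mpoly_eval R t \<alpha> f = \<mm> +> \<zero> \<longleftrightarrow> mpoly_eval R t \<alpha> f \<in> \<mm>"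
      using quotient_eq_iff_same_a_r_cos[OF m.is_ideal c zero_closed] c by (simp add: minus_eq)
    then show ?thesis using redf \<alpha> zero by simp
  qed
  define U where "U = {y \<in> vectors (R Quot \<mm>) t. mpoly_eval (R Quot \<mm>) t y (red f) \<noteq> \<zero>\<^bsub>R Quot \<mm>\<^esub>}"
  show ?thesis
    unfolding general_vector_def
  proof (intro exI conjI ballI impI)
    show "openin (zariski_topology (R Quot \<mm>) t) U" "zariski_topology (R Quot \<mm>) t closure_of U = vectors (R Quot \<mm>) t"
      unfolding U_def using k.zariski_basic_open_dense[OF inf _ res[OF x(1)], of "red f"] redf nz[OF x(1)] x(2) by auto
    fix \<alpha> assume "\<alpha> \<in> vectors R t" "residue_vector R \<mm> t \<alpha> \<in> U"
    then show "P \<alpha>" using P nz by (auto simp: U_def)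
  qed
qed

section \<open>Specialization\<close>

text \<open>A non-unit generates a proper ideal, which Zorn's lemma enlarges to a maximal one, and
  that must be \<mm>. Unions of chains stay in the family because a nonempty chain of ideals of a
  noetherian ring contains its union.\<close>

lemma (in noetherian_local_ring) unit_if_notin:
  assumes r: "r \<in> carrier R" "r \<notin> \<mm>" shows "r \<in> Units R"
proof (rule ccontr)
  assume no: "r \<notin> Units R"
  let ?Q = "{J. ideal J R \<and> J \<noteq> carrier R \<and> PIdl r \<subseteq> J}"
  have one: "\<one> \<notin> PIdl r"
  proof
    assume "\<one> \<in> PIdl r"
    then obtain s where "s \<in> carrier R" "s \<otimes> r = \<one>" by (auto simp: cgenideal_def)
    then show False using no r(1) by (auto simp: Units_def m_comm intro!: bexI[of _ s])
  qed
  have PI: "PIdl r \<in> ?Q" using cgenideal_ideal[OF r(1)] one one_closed by auto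
  have "\<exists>J\<in>?Q. \<forall>K\<in>?Q. J \<subseteq> K \<longrightarrow> K = J"
  proof (rule subset_Zorn_nonempty)
    show "?Q \<noteq> {}" using PI by blast
    fix \<C> assume C: "\<C> \<noteq> {}" "subset.chain ?Q \<C>"
    then have "subset.chain {I. ideal I R} \<C>" by (auto simp: pred_on.chain_def)
    from ideal_chain_is_trivial[OF C(1) this] show "\<Union>\<C> \<in> ?Q"
      using C(2) unfolding pred_on.chain_def by blast
  qed
  then obtain J where JQ: "J \<in> ?Q" and Jmax: "\<forall>K\<in>?Q. J \<subseteq> K \<longrightarrow> K = J" by (rule bexE)
  have J: "ideal J R" "J \<noteq> carrier R" "PIdl r \<subseteq> J" using JQ by simp_all
  have "maximalideal J R"
  proof (rule maximalidealI[OF J(1)])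
    show "carrier R \<noteq> J" using J(2) by simp
    fix K assume K: "ideal K R" "J \<subseteq> K" "K \<subseteq> carrier R"
    show "K = J \<or> K = carrier R"
    proof (rule disjCI)
      assume "K \<noteq> carrier R"
      then have "K \<in> ?Q" using K J(3) by auto
      then show "K = J" using Jmax K(2) by blast
    qed
  qed
  then have "r \<in> \<mm>" using unique_maximalideal cgenideal_self[OF r(1)] J(3) by blast
  then show False using r(2) by simp
qed

locale specialization_setup =
  fixes \<mm> and R :: "('a, 'r) ring_scheme" and t :: nat and M :: "('a, 'b, 'm) module_scheme"
  assumes local_ring: "noetherian_local_ring \<mm> R"
    and infinite_residue: "infinite (carrier (R Quot \<mm>))"
    and M_module: "module R M"
    and M_fg: "finitely_generated_module R M"
begin

sublocale R: noetherian_local_ring \<mm> R by (rule local_ring)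
sublocale M: module R M by (rule M_module)

abbreviation "S \<equiv> mpoly_ring R t"
abbreviation "ev \<equiv> mpoly_eval R t"
abbreviation "const \<equiv> mpoly_const R"
abbreviation zvar :: "nat \<Rightarrow> nat multiset \<Rightarrow> 'a" where "zvar \<equiv> R.indexed_var"
abbreviation "vecs \<equiv> vectors R t"
abbreviation "V \<equiv> poly_module R t M"

sublocale S: cring S by (rule R.mpoly_cring)
sublocale E: scalar_extension R S const M
  by (intro scalar_extension.intro M_module S.cring_axioms scalar_extension_axioms.intro R.mpoly_const_hom)

lemma V_eq: "V = E.BC" by (simp add: poly_module_def)

sublocale V: module S V unfolding V_eq by (rule E.BC_module)

abbreviation tens :: "'b \<Rightarrow> (nat multiset \<Rightarrow> 'a) \<Rightarrow> ('b \<times> (nat multiset \<Rightarrow> 'a) \<Rightarrow>\<^sub>0 int) set" where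
  "tens \<equiv> E.pt"

lemma prime_m: "primeideal \<mm> R"
  using R.maximalideal_prime[OF R.maximalideal_axioms] .

lemma const_closed [simp]: "r \<in> carrier R \<Longrightarrow> const r \<in> carrier S"
  using ring_hom_closed[OF R.mpoly_const_hom] .

lemma var_closed [simp]: "i < t \<Longrightarrow> zvar i \<in> carrier S"
  by (rule R.mpoly_var_closed)

lemma ev_closed [simp]: "\<alpha> \<in> vecs \<Longrightarrow> f \<in> carrier S \<Longrightarrow> ev \<alpha> f \<in> carrier R"
  by (rule R.mpoly_eval_closed[OF R.vectors_Pi])

lemma ev_hom: "\<alpha> \<in> vecs \<Longrightarrow> ev \<alpha> \<in> ring_hom S R"
  by (rule R.mpoly_eval_hom[OF R.vectors_Pi])

lemma ev_add: "\<alpha> \<in> vecs \<Longrightarrow> f \<in> carrier S \<Longrightarrow> g \<in> carrier S \<Longrightarrow> ev \<alpha> (f \<oplus>\<^bsub>S\<^esub> g) = ev \<alpha> f \<oplus>\<^bsub>R\<^esub> ev \<alpha> g"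
  using ring_hom_add[OF ev_hom] .

lemma ev_mult: "\<alpha> \<in> vecs \<Longrightarrow> f \<in> carrier S \<Longrightarrow> g \<in> carrier S \<Longrightarrow> ev \<alpha> (f \<otimes>\<^bsub>S\<^esub> g) = ev \<alpha> f \<otimes>\<^bsub>R\<^esub> ev \<alpha> g"
  using ring_hom_mult[OF ev_hom] .

lemma ev_one: "\<alpha> \<in> vecs \<Longrightarrow> ev \<alpha> \<one>\<^bsub>S\<^esub> = \<one>\<^bsub>R\<^esub>"
  using ring_hom_one[OF ev_hom] .

lemma ev_diff:
  assumes "\<alpha> \<in> vecs" "f \<in> carrier S" "g \<in> carrier S"
  shows "ev \<alpha> (f \<ominus>\<^bsub>S\<^esub> g) = ev \<alpha> f \<ominus>\<^bsub>R\<^esub> ev \<alpha> g"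
proof -
  have "ev \<alpha> f = ev \<alpha> (f \<ominus>\<^bsub>S\<^esub> g) \<oplus>\<^bsub>R\<^esub> ev \<alpha> g"
    using ev_add[OF assms(1), of "f \<ominus>\<^bsub>S\<^esub> g" g] assms by (simp add: S.minus_eq S.a_assoc S.l_neg)
  then show ?thesis using assms by (simp add: R.minus_eq R.a_assoc R.r_neg)
qed

lemma ev_const: "\<alpha> \<in> vecs \<Longrightarrow> r \<in> carrier R \<Longrightarrow> ev \<alpha> (const r) = r"
  by (rule R.mpoly_eval_const[OF R.vectors_Pi])

lemma ev_var: "\<alpha> \<in> vecs \<Longrightarrow> i < t \<Longrightarrow> ev \<alpha> (zvar i) = \<alpha> i"
  by (rule R.mpoly_eval_var[OF R.vectors_Pi])

lemma vec_closed: "\<alpha> \<in> vecs \<Longrightarrow> i < t \<Longrightarrow> \<alpha> i \<in> carrier R"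
  using R.vectors_Pi by auto

definition shift :: "(nat \<Rightarrow> 'a) \<Rightarrow> nat \<Rightarrow> (nat multiset \<Rightarrow> 'a)" where
  "shift \<alpha> i = zvar i \<ominus>\<^bsub>S\<^esub> const (\<alpha> i)"

lemma shift_closed [simp]: "\<alpha> \<in> vecs \<Longrightarrow> i < t \<Longrightarrow> shift \<alpha> i \<in> carrier S"
  by (simp add: shift_def vec_closed)

lemma ev_shift: "\<alpha> \<in> vecs \<Longrightarrow> \<beta> \<in> vecs \<Longrightarrow> i < t \<Longrightarrow> ev \<beta> (shift \<alpha> i) = \<beta> i \<ominus>\<^bsub>R\<^esub> \<alpha> i"
  by (simp add: shift_def ev_diff ev_var ev_const vec_closed)

subsection \<open>Multiplicative sets between the generic point and a closed point\<close>

text \<open>For i at most t, the complement of the prime \<mm>S + (z_j - \<alpha>_j : j < i),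
  described by values instead of ideal membership. Index 0 gives the generic point, and index t
  leaves the condition that f(\<alpha>) lies outside \<mm>.\<close>

definition nonvan :: "nat \<Rightarrow> (nat \<Rightarrow> 'a) \<Rightarrow> (nat multiset \<Rightarrow> 'a) set" where
  "nonvan i \<alpha> = {f \<in> carrier S. \<exists>\<beta>\<in>vecs. (\<forall>j<i. \<beta> j = \<alpha> j) \<and> ev \<beta> f \<notin> \<mm>}"

lemma nonvanI: "f \<in> carrier S \<Longrightarrow> \<beta> \<in> vecs \<Longrightarrow> (\<And>j. j < i \<Longrightarrow> \<beta> j = \<alpha> j) \<Longrightarrow> ev \<beta> f \<notin> \<mm> \<Longrightarrow> f \<in> nonvan i \<alpha>"
  unfolding nonvan_def by blast

text \<open>Since no coordinate is prescribed, the set does not depend on \<alpha>; a chain found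
  once at the generic point can be specialized to every vector.\<close>

lemma nonvan_0: "nonvan 0 \<alpha> = carrier S - extended_ideal R t \<mm>"
  using R.extended_ideal_iff[OF prime_m infinite_residue] by (auto simp: nonvan_def)

text \<open>This is the primeness of \<mm>S + (z_j - \<alpha>_j : j < i). Witnesses for f and g are
  joined by a line that keeps the first \<open>i\<close> coordinates, and some point on it is a
  witness for both.\<close>

lemma nonvan_mult_set:
  assumes \<alpha>: "\<alpha> \<in> vecs" shows "V.mult_set (nonvan i \<alpha>)"
  unfolding V.mult_set_def
proof (intro conjI ballI)
  interpret P: primeideal \<mm> R by (rule prime_m)
  show "nonvan i \<alpha> \<subseteq> carrier S" by (auto simp: nonvan_def)
  have "\<one>\<^bsub>R\<^esub> \<notin> \<mm>" using R.one_imp_carrier R.I_notcarr by auto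
  then show "\<one>\<^bsub>S\<^esub> \<in> nonvan i \<alpha>" by (intro nonvanI[OF _ \<alpha>]) (simp_all add: ev_one[OF \<alpha>])
  fix f g assume "f \<in> nonvan i \<alpha>" "g \<in> nonvan i \<alpha>"
  then obtain x y where x: "f \<in> carrier S" "x \<in> vecs" "\<And>j. j < i \<Longrightarrow> x j = \<alpha> j" "ev x f \<notin> \<mm>"
    and y: "g \<in> carrier S" "y \<in> vecs" "\<And>j. j < i \<Longrightarrow> y j = \<alpha> j" "ev y g \<notin> \<mm>"
    by (auto simp: nonvan_def)
  obtain z where z: "z \<in> vecs" "ev z f \<notin> \<mm>" "ev z g \<notin> \<mm>" "\<And>j. x j = y j \<Longrightarrow> z j = x j"
    by (rule R.common_nonvanishing_point[OF prime_m infinite_residue x(1) y(1) x(2,4) y(2,4)]) blast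
  show "f \<otimes>\<^bsub>S\<^esub> g \<in> nonvan i \<alpha>"
  proof (rule nonvanI)
    show "z j = \<alpha> j" if "j < i" for j using z(4)[of j] x(3)[OF that] y(3)[OF that] by simp
    show "ev z (f \<otimes>\<^bsub>S\<^esub> g) \<notin> \<mm>"
      using P.I_prime[of "ev z f" "ev z g"] z x(1) y(1) by (auto simp: ev_mult)
  qed (use x y z in auto)
qed

lemma nonvan_Suc_subset: "nonvan (Suc i) \<alpha> \<subseteq> nonvan i \<alpha>"
  unfolding nonvan_def using less_SucI by blast

lemma minus_notin_m:
  assumes "a \<in> carrier R" "b \<in> \<mm>" "a \<notin> \<mm>" shows "a \<ominus>\<^bsub>R\<^esub> b \<notin> \<mm>"
proof
  assume "a \<ominus>\<^bsub>R\<^esub> b \<in> \<mm>"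
  then have "(a \<ominus>\<^bsub>R\<^esub> b) \<oplus>\<^bsub>R\<^esub> b \<in> \<mm>" using assms(2) by simp
  then show False using assms R.Icarr[OF assms(2)] by (simp add: R.minus_eq R.a_assoc R.l_neg)
qed

text \<open>Raising coordinate \<open>i\<close> of \<alpha> by one gives a point with value one, and
  the coordinates before \<open>i\<close> are untouched.\<close>

lemma shift_nonvan:
  assumes \<alpha>: "\<alpha> \<in> vecs" and i: "i < t" shows "shift \<alpha> i \<in> nonvan i \<alpha>"
proof (rule nonvanI)
  let ?\<beta> = "\<alpha>(i := \<alpha> i \<oplus>\<^bsub>R\<^esub> \<one>\<^bsub>R\<^esub>)"
  show b: "?\<beta> \<in> vecs" using R.vectors_upd[OF \<alpha> i] vec_closed[OF \<alpha> i] by simp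
  have "ev ?\<beta> (shift \<alpha> i) = (\<alpha> i \<oplus>\<^bsub>R\<^esub> \<one>\<^bsub>R\<^esub>) \<ominus>\<^bsub>R\<^esub> \<alpha> i" using ev_shift[OF \<alpha> b i] by simp
  also have "\<dots> = \<one>\<^bsub>R\<^esub>" using vec_closed[OF \<alpha> i] R.a_comm[of "\<alpha> i" "\<one>\<^bsub>R\<^esub>"] by (simp add: R.minus_eq R.a_assoc R.r_neg)
  finally show "ev ?\<beta> (shift \<alpha> i) \<notin> \<mm>" using R.one_imp_carrier R.I_notcarr by auto
qed (use assms in auto)

text \<open>At every admissible witness the first i + 1 coordinates agree with \<alpha>, so z_i -
  \<alpha>_i vanishes there and values do not change. This is the Jacobson radical condition of
  \<open>nakayama\<close>.\<close>

lemma nonvan_minus_shift: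
  assumes \<alpha>: "\<alpha> \<in> vecs" and i: "i < t" and w: "w \<in> nonvan (Suc i) \<alpha>" and r: "r \<in> carrier S"
  shows "w \<ominus>\<^bsub>S\<^esub> r \<otimes>\<^bsub>S\<^esub> shift \<alpha> i \<in> nonvan (Suc i) \<alpha>"
proof -
  obtain \<beta> where b: "w \<in> carrier S" "\<beta> \<in> vecs" "\<And>j. j < Suc i \<Longrightarrow> \<beta> j = \<alpha> j" "ev \<beta> w \<notin> \<mm>"
    using w by (auto simp: nonvan_def)
  have "ev \<beta> (shift \<alpha> i) = \<zero>\<^bsub>R\<^esub>"
    using ev_shift[OF \<alpha> b(2) i] b(3)[of i] vec_closed[OF \<alpha> i] by (simp add: R.minus_eq R.r_neg)
  then have "ev \<beta> (w \<ominus>\<^bsub>S\<^esub> r \<otimes>\<^bsub>S\<^esub> shift \<alpha> i) = ev \<beta> w"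
    using b(1,2) r \<alpha> i by (simp add: ev_diff ev_mult R.minus_eq)
  then show ?thesis using b \<alpha> i r by (intro nonvanI[of _ \<beta>]) auto
qed

text \<open>Values change only by elements of \<mm>. The condition is what
  \<open>composition_elements\<close> asks for, so that \<mm> kills the factors of the
  series.\<close>

lemma nonvan_minus_m:
  assumes \<alpha>: "\<alpha> \<in> vecs" and w: "w \<in> nonvan i \<alpha>" and r: "r \<in> carrier S" and m: "m \<in> \<mm>"
  shows "w \<ominus>\<^bsub>S\<^esub> r \<otimes>\<^bsub>S\<^esub> const m \<in> nonvan i \<alpha>"
proof -
  obtain \<beta> where b: "w \<in> carrier S" "\<beta> \<in> vecs" "\<And>j. j < i \<Longrightarrow> \<beta> j = \<alpha> j" "ev \<beta> w \<notin> \<mm>"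
    using w by (auto simp: nonvan_def)
  have mR: "m \<in> carrier R" using R.Icarr[OF m] .
  have "ev \<beta> (w \<ominus>\<^bsub>S\<^esub> r \<otimes>\<^bsub>S\<^esub> const m) = ev \<beta> w \<ominus>\<^bsub>R\<^esub> ev \<beta> r \<otimes>\<^bsub>R\<^esub> m"
    using b(1,2) r mR by (simp add: ev_diff ev_mult ev_const)
  moreover have "ev \<beta> r \<otimes>\<^bsub>R\<^esub> m \<in> \<mm>" using R.I_l_closed[OF m] b(2) r by simp
  ultimately have "ev \<beta> (w \<ominus>\<^bsub>S\<^esub> r \<otimes>\<^bsub>S\<^esub> const m) \<notin> \<mm>"
    using minus_notin_m b by simp
  then show ?thesis using b r mR by (intro nonvanI[of _ \<beta>]) auto
qed

subsection \<open>The polynomial module is noetherian\<close>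

lemma tens_closed [simp]: "x \<in> carrier M \<Longrightarrow> f \<in> carrier S \<Longrightarrow> tens x f \<in> carrier V"
  unfolding V_eq by (rule E.pt_closed)

lemma tens_add_left:
  "x \<in> carrier M \<Longrightarrow> y \<in> carrier M \<Longrightarrow> f \<in> carrier S \<Longrightarrow> tens (x \<oplus>\<^bsub>M\<^esub> y) f = tens x f \<oplus>\<^bsub>V\<^esub> tens y f"
  unfolding V_eq by (rule E.pt_add_left)

lemma tens_smult_left:
  "r \<in> carrier R \<Longrightarrow> x \<in> carrier M \<Longrightarrow> tens (r \<odot>\<^bsub>M\<^esub> x) \<one>\<^bsub>S\<^esub> = const r \<odot>\<^bsub>V\<^esub> tens x \<one>\<^bsub>S\<^esub>"
  unfolding V_eq using E.pt_balance[of r x "\<one>\<^bsub>S\<^esub>"] E.smult_pt[of x "const r" "\<one>\<^bsub>S\<^esub>"] by simp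

lemma tens_smult: "x \<in> carrier M \<Longrightarrow> f \<in> carrier S \<Longrightarrow> tens x f = f \<odot>\<^bsub>V\<^esub> tens x \<one>\<^bsub>S\<^esub>"
  unfolding V_eq using E.smult_pt[of x f "\<one>\<^bsub>S\<^esub>"] by simp

lemma tens_diff_left:
  assumes "x \<in> carrier M" "y \<in> carrier M"
  shows "tens (x \<ominus>\<^bsub>M\<^esub> y) \<one>\<^bsub>S\<^esub> = tens x \<one>\<^bsub>S\<^esub> \<ominus>\<^bsub>V\<^esub> tens y \<one>\<^bsub>S\<^esub>"
proof -
  have "tens x \<one>\<^bsub>S\<^esub> = tens (x \<ominus>\<^bsub>M\<^esub> y) \<one>\<^bsub>S\<^esub> \<oplus>\<^bsub>V\<^esub> tens y \<one>\<^bsub>S\<^esub>"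
    using tens_add_left[of "x \<ominus>\<^bsub>M\<^esub> y" y "\<one>\<^bsub>S\<^esub>"] assms by (simp add: M.minus_eq M.a_assoc M.l_neg)
  then show ?thesis using assms by (simp add: V.M.minus_eq V.M.a_assoc V.M.r_neg)
qed

lemma tens_zero: "tens \<zero>\<^bsub>M\<^esub> \<one>\<^bsub>S\<^esub> = \<zero>\<^bsub>V\<^esub>"
  using tens_add_left[of "\<zero>\<^bsub>M\<^esub>" "\<zero>\<^bsub>M\<^esub>" "\<one>\<^bsub>S\<^esub>"] by simp

lemma V_induct [consumes 1, case_names zero tens add]:
  assumes "v \<in> carrier V" "P \<zero>\<^bsub>V\<^esub>" "\<And>x f. x \<in> carrier M \<Longrightarrow> f \<in> carrier S \<Longrightarrow> P (tens x f)"
    "\<And>v w. v \<in> carrier V \<Longrightarrow> w \<in> carrier V \<Longrightarrow> P v \<Longrightarrow> P w \<Longrightarrow> P (v \<oplus>\<^bsub>V\<^esub> w)"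
  shows "P v"
  using E.BC_induct[of v P] assms unfolding V_eq by blast

text \<open>This set only lists generators of the subring R[z_0, ..., z_(i-1)]; being closed under
  them as scalars amounts to being a submodule over that subring. The matching filtration
  \<open>init_module\<close> grows from M \<otimes> 1 to all of M'.\<close>

primrec init_scalars :: "nat \<Rightarrow> (nat multiset \<Rightarrow> 'a) set" where
  "init_scalars 0 = const ` carrier R"
| "init_scalars (Suc i) = insert (zvar i) (init_scalars i)"

primrec init_module :: "nat \<Rightarrow> ('b \<times> (nat multiset \<Rightarrow> 'a) \<Rightarrow>\<^sub>0 int) set set" where
  "init_module 0 = (\<lambda>x. tens x \<one>\<^bsub>S\<^esub>) ` carrier M"
| "init_module (Suc i) = V.poly_closure (zvar i) (init_module i)"

lemma init_scalars_closed: "i \<le> t \<Longrightarrow> init_scalars i \<subseteq> carrier S"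
  by (induction i) auto

lemma init_module_acc: "i \<le> t \<Longrightarrow> V.closed_sub (init_scalars i) (init_module i) \<and> V.acc (init_scalars i) (init_module i)"
proof (induction i)
  case 0
  have cl: "V.closed_sub (init_scalars 0) (init_module 0)"
  proof (rule V.closed_subI)
    show "\<zero>\<^bsub>V\<^esub> \<in> init_module 0" using tens_zero by (auto intro!: image_eqI[of _ _ "\<zero>\<^bsub>M\<^esub>"])
    show "v \<ominus>\<^bsub>V\<^esub> w \<in> init_module 0" if "v \<in> init_module 0" "w \<in> init_module 0" for v w
      using that by (auto simp: tens_diff_left[symmetric])
    show "a \<odot>\<^bsub>V\<^esub> v \<in> init_module 0" if "a \<in> init_scalars 0" "v \<in> init_module 0" for a v
      using that by (auto simp: tens_smult_left[symmetric])
  qed auto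
  moreover have "V.acc (init_scalars 0) (init_module 0)"
    unfolding V.acc_def
  proof (intro allI impI)
    fix C :: "nat \<Rightarrow> _"
    assume asm: "\<forall>i. C i \<subseteq> init_module 0 \<and> V.closed_sub (init_scalars 0) (C i) \<and> C i \<subseteq> C (Suc i)"
    \<comment> \<open>Chains are pulled back to the noetherian module \<open>M\<close>. Nothing is
      lost, since x to x \<otimes> 1 maps onto \<open>init_module 0\<close> by definition.\<close>
    define D where "D i = {x \<in> carrier M. tens x \<one>\<^bsub>S\<^esub> \<in> C i}" for i
    have "M.closed_sub (carrier R) (D i)" for i
    proof (rule M.closed_subI)
      note CD = V.closed_subD[of "init_scalars 0" "C i"]
      have Ci: "V.closed_sub (init_scalars 0) (C i)" using asm by blast
      show "\<zero>\<^bsub>M\<^esub> \<in> D i" using CD(2)[OF Ci] by (simp add: D_def tens_zero)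
      show "x \<ominus>\<^bsub>M\<^esub> y \<in> D i" if "x \<in> D i" "y \<in> D i" for x y
        using CD(3)[OF Ci] that by (simp add: D_def tens_diff_left)
      show "r \<odot>\<^bsub>M\<^esub> x \<in> D i" if "r \<in> carrier R" "x \<in> D i" for r x
        using CD(4)[OF Ci, of "const r"] that by (simp add: D_def tens_smult_left)
    qed (auto simp: D_def)
    moreover have "D i \<subseteq> D (Suc i)" for i using asm unfolding D_def by blast
    moreover have "D i \<subseteq> carrier M" for i by (auto simp: D_def)
    ultimately obtain n where n: "\<And>m. m \<ge> n \<Longrightarrow> D m = D n"
      using M.accD[OF M.noetherian_imp_acc[OF R.noetherian_ring_axioms M_fg], of D] by blast
    have CD: "C i = (\<lambda>x. tens x \<one>\<^bsub>S\<^esub>) ` D i" for i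
    proof
      show "C i \<subseteq> (\<lambda>x. tens x \<one>\<^bsub>S\<^esub>) ` D i"
      proof
        fix v assume v: "v \<in> C i"
        then have "v \<in> init_module 0" using asm by blast
        then obtain x where "x \<in> carrier M" "v = tens x \<one>\<^bsub>S\<^esub>" by auto
        then show "v \<in> (\<lambda>x. tens x \<one>\<^bsub>S\<^esub>) ` D i" using v by (simp add: D_def)
      qed
    qed (auto simp: D_def)
    show "\<exists>n. \<forall>m\<ge>n. C m = C n"
    proof (intro exI allI impI)
      fix m assume "m \<ge> n"
      from n[OF this] show "C m = C n" unfolding CD by simp
    qed
  qed
  ultimately show ?case ..
next
  case (Suc i)
  then have i: "i < t" "i \<le> t" by auto
  have IH: "V.closed_sub (init_scalars i) (init_module i)" "V.acc (init_scalars i) (init_module i)"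
    using Suc i by auto
  show ?case
    using V.poly_closure_closed[OF init_scalars_closed[OF i(2)] var_closed[OF i(1)] IH(1)]
      V.hilbert_basis_step[OF init_scalars_closed[OF i(2)] var_closed[OF i(1)] IH] by simp
qed

lemma init_module_mono: "i \<le> t \<Longrightarrow> init_module 0 \<subseteq> init_module i"
proof (induction i)
  case (Suc i)
  then have "init_module i \<subseteq> init_module (Suc i)"
    using V.poly_closure_incl[OF init_scalars_closed, of i "zvar i" "init_module i"] init_module_acc[of i] by simp
  then show ?case using Suc by auto
qed simp

lemma init_scalars_mem: "const ` carrier R \<subseteq> init_scalars i" "j < i \<Longrightarrow> zvar j \<in> init_scalars i"
  by (induction i) (auto simp: less_Suc_eq)

text \<open>After all variables have been adjoined the filtration exhausts M'. Submodules over
  \<open>S\<close> are closed under the smaller set \<open>init_scalars t\<close>, so its chain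
  condition covers them.\<close>

lemma V_acc: "V.acc (carrier S) (carrier V)"
proof -
  note cs = conjunct1[OF init_module_acc[OF order_refl]]
  note D = V.closed_subD[OF cs]
  have sm: "f \<odot>\<^bsub>V\<^esub> v \<in> init_module t" if f: "f \<in> carrier S" and v: "v \<in> init_module t" for f v
    using f
  proof (induction rule: R.mpoly_induct)
    case (const c)
    then show ?case using D(4)[OF _ v] init_scalars_mem(1) by auto
  next
    case (add p q)
    then show ?case using V.closed_sub_add[OF cs add(3,4)] D(1)[OF v] by (simp add: V.smult_l_distr)
  next
    case (mult p i)
    then show ?case using D(4)[OF init_scalars_mem(2)[OF mult(2)] mult(3)] D(1)[OF v] by (simp add: V.smult_assoc1)
  qed
  have "carrier V \<subseteq> init_module t"
  proof
    fix v assume "v \<in> carrier V"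
    then show "v \<in> init_module t"
    proof (induction rule: V_induct)
      case zero
      show ?case by (rule D(2))
    next
      case (tens x f)
      have "tens x \<one>\<^bsub>S\<^esub> \<in> init_module t" using init_module_mono[of t] tens(1) by auto
      then show ?case using sm[OF tens(2)] by (simp add: tens_smult[OF tens])
    next
      case (add v w)
      then show ?case by (intro V.closed_sub_add[OF cs])
    qed
  qed
  then have "init_module t = carrier V" using D(5) by auto
  then have acc: "V.acc (init_scalars t) (carrier V)" using init_module_acc[of t] by simp
  show ?thesis
    unfolding V.acc_def
  proof (intro allI impI)
    fix C :: "nat \<Rightarrow> _"
    assume asm: "\<forall>i. C i \<subseteq> carrier V \<and> V.closed_sub (carrier S) (C i) \<and> C i \<subseteq> C (Suc i)"
    have "V.closed_sub (init_scalars t) (C i)" for i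
      using asm init_scalars_closed[of t] unfolding V.closed_sub_def by blast
    then show "\<exists>n. \<forall>m\<ge>n. C m = C n" using asm acc unfolding V.acc_def by blast
  qed
qed

end

context specialization_setup
begin

subsection \<open>Evaluation of the polynomial module at a vector\<close>

text \<open>The ideal (z - \<alpha>) contains f - f(\<alpha>). The fact is used only through the
  action on M', where it is proved modulo any submodule that contains (z - \<alpha>)M'.\<close>

lemma shift_smult_mem:
  assumes \<alpha>: "\<alpha> \<in> vecs" and K: "V.closed_sub (carrier S) K"
    and z: "\<And>i v. i < t \<Longrightarrow> v \<in> carrier V \<Longrightarrow> shift \<alpha> i \<odot>\<^bsub>V\<^esub> v \<in> K"
    and f: "f \<in> carrier S" and v: "v \<in> carrier V"
  shows "(f \<ominus>\<^bsub>S\<^esub> const (ev \<alpha> f)) \<odot>\<^bsub>V\<^esub> v \<in> K"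
proof -
  note KD = V.closed_subD[OF K]
  have "f \<odot>\<^bsub>V\<^esub> v \<ominus>\<^bsub>V\<^esub> const (ev \<alpha> f) \<odot>\<^bsub>V\<^esub> v \<in> K"
    using f
  proof (induction rule: R.mpoly_induct)
    case (const c)
    then show ?case using KD(2) v by (simp add: ev_const[OF \<alpha>] V.M.minus_eq V.M.r_neg)
  next
    case (add p q)
    have c: "const (ev \<alpha> (p \<oplus>\<^bsub>S\<^esub> q)) = const (ev \<alpha> p) \<oplus>\<^bsub>S\<^esub> const (ev \<alpha> q)"
      using add \<alpha> ring_hom_add[OF R.mpoly_const_hom] by (simp add: ev_add)
    have "(p \<oplus>\<^bsub>S\<^esub> q) \<odot>\<^bsub>V\<^esub> v \<ominus>\<^bsub>V\<^esub> const (ev \<alpha> (p \<oplus>\<^bsub>S\<^esub> q)) \<odot>\<^bsub>V\<^esub> v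
      = (p \<odot>\<^bsub>V\<^esub> v \<ominus>\<^bsub>V\<^esub> const (ev \<alpha> p) \<odot>\<^bsub>V\<^esub> v) \<oplus>\<^bsub>V\<^esub> (q \<odot>\<^bsub>V\<^esub> v \<ominus>\<^bsub>V\<^esub> const (ev \<alpha> q) \<odot>\<^bsub>V\<^esub> v)"
      unfolding c using add(1,2) v \<alpha> by (simp add: V.smult_l_distr V.add_minus_add)
    then show ?case using V.closed_sub_add[OF K add(3,4)] by simp
  next
    case (mult p i)
    have ai: "\<alpha> i \<in> carrier R" using vec_closed[OF \<alpha> mult(2)] .
    have c: "const (ev \<alpha> (zvar i \<otimes>\<^bsub>S\<^esub> p)) = const (\<alpha> i) \<otimes>\<^bsub>S\<^esub> const (ev \<alpha> p)"
      using mult(1,2) \<alpha> ai ring_hom_mult[OF R.mpoly_const_hom] by (simp add: ev_mult ev_var)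
    define u where "u = p \<odot>\<^bsub>V\<^esub> v"
    have u: "u \<in> carrier V" using mult(1) v by (simp add: u_def)
    define w where "w = const (ev \<alpha> p) \<odot>\<^bsub>V\<^esub> v"
    have w: "w \<in> carrier V" using mult(1) v \<alpha> by (simp add: w_def)
    have "(zvar i \<otimes>\<^bsub>S\<^esub> p) \<odot>\<^bsub>V\<^esub> v \<ominus>\<^bsub>V\<^esub> const (ev \<alpha> (zvar i \<otimes>\<^bsub>S\<^esub> p)) \<odot>\<^bsub>V\<^esub> v
        = zvar i \<odot>\<^bsub>V\<^esub> u \<ominus>\<^bsub>V\<^esub> const (\<alpha> i) \<odot>\<^bsub>V\<^esub> w"
      unfolding c using mult(1,2) v \<alpha> ai by (simp add: V.smult_assoc1 u_def w_def)
    \<comment> \<open>Inserting \<alpha>_i u, with u = pv and w = p(\<alpha>)v, splits the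
      difference into (z_i - \<alpha>_i)u and \<alpha>_i(u - w); the induction hypothesis covers u -
      w.\<close>
    also have "\<dots> = (zvar i \<odot>\<^bsub>V\<^esub> u \<ominus>\<^bsub>V\<^esub> const (\<alpha> i) \<odot>\<^bsub>V\<^esub> u) \<oplus>\<^bsub>V\<^esub> (const (\<alpha> i) \<odot>\<^bsub>V\<^esub> u \<ominus>\<^bsub>V\<^esub> const (\<alpha> i) \<odot>\<^bsub>V\<^esub> w)"
      using u w ai mult(2) by (simp add: V.M.minus_eq V.M.a_assoc V.M.r_neg1)
    also have "\<dots> = shift \<alpha> i \<odot>\<^bsub>V\<^esub> u \<oplus>\<^bsub>V\<^esub> const (\<alpha> i) \<odot>\<^bsub>V\<^esub> (u \<ominus>\<^bsub>V\<^esub> w)"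
      using u w ai mult(2) by (simp add: shift_def V.smult_l_diff V.smult_r_diff)
    also have "\<dots> \<in> K"
      using V.closed_sub_add[OF K z[OF mult(2) u]] KD(4)[OF const_closed[OF ai] mult(3)] by (simp add: u_def w_def)
    finally show ?case .
  qed
  then show ?thesis using f v \<alpha> by (simp add: V.smult_l_diff)
qed

text \<open>A predicate, because the universal property supplies such a map only as an existence
  statement. On M' it is determined by x \<otimes> f going to f(\<alpha>)x.\<close>

definition evaluation :: "(nat \<Rightarrow> 'a) \<Rightarrow> (('b \<times> (nat multiset \<Rightarrow> 'a) \<Rightarrow>\<^sub>0 int) set \<Rightarrow> 'b) \<Rightarrow> bool" where
  "evaluation \<alpha> h \<longleftrightarrow> (\<forall>v\<in>carrier V. h v \<in> carrier M) \<and>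
     (\<forall>x\<in>carrier M. \<forall>f\<in>carrier S. h (tens x f) = ev \<alpha> f \<odot>\<^bsub>M\<^esub> x) \<and>
     (\<forall>v\<in>carrier V. \<forall>w\<in>carrier V. h (v \<oplus>\<^bsub>V\<^esub> w) = h v \<oplus>\<^bsub>M\<^esub> h w) \<and> h \<zero>\<^bsub>V\<^esub> = \<zero>\<^bsub>M\<^esub>"

lemma evaluation_exists:
  assumes \<alpha>: "\<alpha> \<in> vecs" obtains h where "evaluation \<alpha> h"
proof (rule E.BC_universal[of M "\<lambda>x f. ev \<alpha> f \<odot>\<^bsub>M\<^esub> x"])
  show "abelian_group M" by (rule M.abelian_group_axioms)
  show "ev \<alpha> f \<odot>\<^bsub>M\<^esub> x \<in> carrier M" if "x \<in> carrier M" "f \<in> carrier S" for x f using that \<alpha> by simp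
  show "ev \<alpha> f \<odot>\<^bsub>M\<^esub> (x \<oplus>\<^bsub>M\<^esub> y) = ev \<alpha> f \<odot>\<^bsub>M\<^esub> x \<oplus>\<^bsub>M\<^esub> ev \<alpha> f \<odot>\<^bsub>M\<^esub> y"
    if "x \<in> carrier M" "y \<in> carrier M" "f \<in> carrier S" for x y f using that \<alpha> by (simp add: M.smult_r_distr)
  show "ev \<alpha> (f \<oplus>\<^bsub>S\<^esub> g) \<odot>\<^bsub>M\<^esub> x = ev \<alpha> f \<odot>\<^bsub>M\<^esub> x \<oplus>\<^bsub>M\<^esub> ev \<alpha> g \<odot>\<^bsub>M\<^esub> x"
    if "x \<in> carrier M" "f \<in> carrier S" "g \<in> carrier S" for x f g
    using that \<alpha> by (simp add: ev_add M.smult_l_distr)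
  show "ev \<alpha> f \<odot>\<^bsub>M\<^esub> (r \<odot>\<^bsub>M\<^esub> x) = ev \<alpha> (const r \<otimes>\<^bsub>S\<^esub> f) \<odot>\<^bsub>M\<^esub> x"
    if "r \<in> carrier R" "x \<in> carrier M" "f \<in> carrier S" for r x f
    using that \<alpha> by (simp add: ev_mult ev_const M.smult_assoc1 M.smult_lcomm)
  fix h assume "\<And>C. C \<in> carrier E.BC \<Longrightarrow> h C \<in> carrier M"
    "\<And>x b. x \<in> carrier M \<Longrightarrow> b \<in> carrier S \<Longrightarrow> h (tens x b) = ev \<alpha> b \<odot>\<^bsub>M\<^esub> x"
    "\<And>C D. C \<in> carrier E.BC \<Longrightarrow> D \<in> carrier E.BC \<Longrightarrow> h (C \<oplus>\<^bsub>E.BC\<^esub> D) = h C \<oplus>\<^bsub>M\<^esub> h D"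
    "h \<zero>\<^bsub>E.BC\<^esub> = \<zero>\<^bsub>M\<^esub>"
  then have "evaluation \<alpha> h" unfolding evaluation_def V_eq by blast
  then show thesis by (rule that)
qed

context
  fixes \<alpha> h assumes \<alpha>: "\<alpha> \<in> vecs" and h: "evaluation \<alpha> h"
begin

lemma h_closed: "v \<in> carrier V \<Longrightarrow> h v \<in> carrier M"
  and h_tens: "x \<in> carrier M \<Longrightarrow> f \<in> carrier S \<Longrightarrow> h (tens x f) = ev \<alpha> f \<odot>\<^bsub>M\<^esub> x"
  and h_add: "v \<in> carrier V \<Longrightarrow> w \<in> carrier V \<Longrightarrow> h (v \<oplus>\<^bsub>V\<^esub> w) = h v \<oplus>\<^bsub>M\<^esub> h w"
  and h_zero: "h \<zero>\<^bsub>V\<^esub> = \<zero>\<^bsub>M\<^esub>"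
  using h unfolding evaluation_def by auto

lemma h_diff:
  assumes "v \<in> carrier V" "w \<in> carrier V" shows "h (v \<ominus>\<^bsub>V\<^esub> w) = h v \<ominus>\<^bsub>M\<^esub> h w"
proof -
  have "h v = h (v \<ominus>\<^bsub>V\<^esub> w) \<oplus>\<^bsub>M\<^esub> h w"
    using h_add[of "v \<ominus>\<^bsub>V\<^esub> w" w] assms by (simp add: V.M.minus_eq V.M.a_assoc V.M.l_neg)
  then show ?thesis using h_closed assms by (simp add: M.minus_eq M.a_assoc M.r_neg)
qed

lemma h_smult:
  assumes f: "f \<in> carrier S" and v: "v \<in> carrier V"
  shows "h (f \<odot>\<^bsub>V\<^esub> v) = ev \<alpha> f \<odot>\<^bsub>M\<^esub> h v"
  using v
proof (induction rule: V_induct)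
  case zero
  then show ?case using f \<alpha> by (simp add: h_zero)
next
  case (tens x g)
  have "f \<odot>\<^bsub>V\<^esub> tens x g = tens x (f \<otimes>\<^bsub>S\<^esub> g)"
    unfolding V_eq using E.smult_pt[OF tens(1) f tens(2)] .
  then show ?case using f tens \<alpha> by (simp add: h_tens ev_mult M.smult_assoc1)
next
  case (add v w)
  then show ?case using f \<alpha> by (simp add: h_add V.smult_r_distr M.smult_r_distr h_closed)
qed

lemma h_tens_one: "x \<in> carrier M \<Longrightarrow> h (tens x \<one>\<^bsub>S\<^esub>) = x"
  using \<alpha> by (simp add: h_tens ev_one)

text \<open>Modulo (z - \<alpha>)M' every element equals h(v) \<otimes> 1, so any submodule
  containing (z - \<alpha>)M' contains the kernel of h. Both the description of the specialization
  and the lower bound rely on it.\<close>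

lemma minus_tens_mem:
  assumes K: "V.closed_sub (carrier S) K"
    and z: "\<And>i v. i < t \<Longrightarrow> v \<in> carrier V \<Longrightarrow> shift \<alpha> i \<odot>\<^bsub>V\<^esub> v \<in> K"
    and v: "v \<in> carrier V"
  shows "v \<ominus>\<^bsub>V\<^esub> tens (h v) \<one>\<^bsub>S\<^esub> \<in> K"
  using v
proof (induction rule: V_induct)
  case zero
  then show ?case using V.closed_subD(2)[OF K] by (simp add: h_zero tens_zero V.M.minus_eq V.M.r_neg)
next
  case (tens x f)
  have "tens x f \<ominus>\<^bsub>V\<^esub> tens (h (tens x f)) \<one>\<^bsub>S\<^esub> = (f \<ominus>\<^bsub>S\<^esub> const (ev \<alpha> f)) \<odot>\<^bsub>V\<^esub> tens x \<one>\<^bsub>S\<^esub>"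
    unfolding h_tens[OF tens] unfolding tens_smult[OF tens] using tens \<alpha> by (simp add: tens_smult_left V.smult_l_diff)
  then show ?case using shift_smult_mem[OF \<alpha> K z tens(2), of "tens x \<one>\<^bsub>S\<^esub>"] tens(1) by simp
next
  case (add v w)
  have "(v \<oplus>\<^bsub>V\<^esub> w) \<ominus>\<^bsub>V\<^esub> tens (h (v \<oplus>\<^bsub>V\<^esub> w)) \<one>\<^bsub>S\<^esub>
      = (v \<ominus>\<^bsub>V\<^esub> tens (h v) \<one>\<^bsub>S\<^esub>) \<oplus>\<^bsub>V\<^esub> (w \<ominus>\<^bsub>V\<^esub> tens (h w) \<one>\<^bsub>S\<^esub>)"
    using add(1,2) h_closed by (simp add: h_add tens_add_left V.add_minus_add)
  then show ?case using V.closed_sub_add[OF K add(3,4)] by simp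
qed

lemma image_submodule:
  assumes K: "V.closed_sub (carrier S) K" shows "M.closed_sub (carrier R) (h ` K)"
proof (rule M.closed_subI)
  note KD = V.closed_subD[OF K]
  show "x \<in> carrier M" if "x \<in> h ` K" for x using that KD(1) h_closed by auto
  show "\<zero>\<^bsub>M\<^esub> \<in> h ` K" using h_zero KD(2) by (metis image_eqI)
  show "x \<ominus>\<^bsub>M\<^esub> y \<in> h ` K" if xy: "x \<in> h ` K" "y \<in> h ` K" for x y
  proof -
    obtain v w where v: "v \<in> K" "w \<in> K" "x = h v" "y = h w" using xy by auto
    then have "x \<ominus>\<^bsub>M\<^esub> y = h (v \<ominus>\<^bsub>V\<^esub> w)" using h_diff KD(1) by simp
    then show ?thesis using KD(3)[OF v(1,2)] by simp
  qed
  show "r \<odot>\<^bsub>M\<^esub> x \<in> h ` K" if r: "r \<in> carrier R" and x: "x \<in> h ` K" for r x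
  proof -
    obtain v where v: "v \<in> K" "x = h v" using x by auto
    then have "r \<odot>\<^bsub>M\<^esub> x = h (const r \<odot>\<^bsub>V\<^esub> v)" using h_smult[of "const r" v] KD(1) r \<alpha> by (simp add: ev_const)
    then show ?thesis using KD(4)[OF const_closed[OF r] v(1)] by simp
  qed
qed

lemma point_ideal_ideal: "ideal (point_ideal R t \<alpha>) S"
  unfolding point_ideal_def by (rule S.genideal_ideal) (use \<alpha> vec_closed in auto)

lemma shift_in_point_ideal: "i < t \<Longrightarrow> shift \<alpha> i \<in> point_ideal R t \<alpha>"
proof -
  assume i: "i < t"
  have "{zvar i \<ominus>\<^bsub>S\<^esub> const (\<alpha> i) | i. i < t} \<subseteq> carrier S" using \<alpha> vec_closed by auto
  from S.genideal_self[OF this] show ?thesis unfolding point_ideal_def shift_def using i by blast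
qed

lemma ev_point_ideal: "f \<in> point_ideal R t \<alpha> \<Longrightarrow> ev \<alpha> f = \<zero>\<^bsub>R\<^esub>"
proof -
  assume f: "f \<in> point_ideal R t \<alpha>"
  have zero: "ev \<alpha> (shift \<alpha> i) = \<zero>\<^bsub>R\<^esub>" if "i < t" for i
    using ev_shift[OF \<alpha> \<alpha> that] vec_closed[OF \<alpha> that] by (simp add: R.minus_eq R.r_neg)
  interpret e: ring_hom_ring S R "ev \<alpha>"
    by (rule ring_hom_ringI2[OF S.ring_axioms R.ring_axioms ev_hom[OF \<alpha>]])
  have "{zvar i \<ominus>\<^bsub>S\<^esub> const (\<alpha> i) | i. i < t} \<subseteq> a_kernel S R (ev \<alpha>)"
  proof
    fix g assume "g \<in> {zvar i \<ominus>\<^bsub>S\<^esub> const (\<alpha> i) | i. i < t}"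
    then obtain i where i: "i < t" "g = shift \<alpha> i" unfolding shift_def by blast
    show "g \<in> a_kernel S R (ev \<alpha>)"
      unfolding i(2) a_kernel_def' using zero[OF i(1)] shift_closed[OF \<alpha> i(1)] by blast
  qed
  then have "point_ideal R t \<alpha> \<subseteq> a_kernel S R (ev \<alpha>)"
    unfolding point_ideal_def by (rule S.genideal_minimal[OF e.kernel_is_ideal])
  then show ?thesis using f unfolding a_kernel_def' by blast
qed

text \<open>It replaces the nested tensor products by a map to \<open>M\<close>. One inclusion needs
  x to be recoverable from its image in the specialization, which \<open>g\<close> achieves; the
  other needs v and h(v) \<otimes> 1 to become equal there, which is \<open>pt_h\<close>.\<close>

lemma specialized_submodule_eq:
  assumes N: "submodule N S V"
  shows "specialized_submodule R t \<alpha> M N = h ` N"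
proof -
  interpret I: ideal "point_ideal R t \<alpha>" S by (rule point_ideal_ideal)
  let ?B = "point_ring R t \<alpha>" and ?\<phi> = "point_proj R t \<alpha>"
  interpret B: cring ?B by (rule I.quotient_is_cring[OF S.cring_axioms])
  have proj: "?\<phi> \<in> ring_hom S ?B" by (rule I.rcos_ring_hom)
  interpret Q: scalar_extension S ?B ?\<phi> V
    by (intro scalar_extension.intro V.module_axioms B.cring_axioms scalar_extension_axioms.intro proj)
  interpret QV: module ?B Q.BC by (rule Q.BC_module)
  have surj: "?\<phi> ` carrier S = carrier ?B"
    by (auto simp: FactRing_def A_RCOSETS_def RCOSETS_def a_r_coset_def)
  have NV: "N \<subseteq> carrier V" using V.submoduleE(1)[OF N] .
  \<comment> \<open>Evaluation on the cosets of (z - \<alpha>), through a chosen representative; it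
    is well defined because the ideal evaluates to zero.\<close>
  define \<epsilon> where "\<epsilon> P = ev \<alpha> (SOME p. p \<in> carrier S \<and> ?\<phi> p = P)" for P
  have eps: "\<epsilon> (?\<phi> p) = ev \<alpha> p" if p: "p \<in> carrier S" for p
  proof -
    let ?q = "SOME q. q \<in> carrier S \<and> ?\<phi> q = ?\<phi> p"
    have q: "?q \<in> carrier S" "?\<phi> ?q = ?\<phi> p" using someI[of "\<lambda>q. q \<in> carrier S \<and> ?\<phi> q = ?\<phi> p" p] p by auto
    then have "?q \<ominus>\<^bsub>S\<^esub> p \<in> point_ideal R t \<alpha>" using S.quotient_eq_iff_same_a_r_cos[OF point_ideal_ideal q(1) p] by simp
    from ev_point_ideal[OF this] have "ev \<alpha> ?q \<ominus>\<^bsub>R\<^esub> ev \<alpha> p = \<zero>\<^bsub>R\<^esub>" using ev_diff[OF \<alpha> q(1) p] by simp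
    then show ?thesis using q p \<alpha> by (simp add: \<epsilon>_def)
  qed
  have B_cases: "\<exists>p\<in>carrier S. P = ?\<phi> p" if "P \<in> carrier ?B" for P using that surj by blast
  have spec: "specialization_map R t \<alpha> V (\<lambda>n. n) ` carrier (specialization R t \<alpha> (V\<lparr>carrier := N\<rparr>))
      = (\<lambda>n. Q.pt n \<one>\<^bsub>?B\<^esub>) ` N"
    using Q.base_change_map_image[OF N surj]
    by (simp add: specialization_map_def specialization_def restrict_scalars_def)
  have iso: "specialization_iso R t \<alpha> M x = Q.pt (tens x \<one>\<^bsub>S\<^esub>) \<one>\<^bsub>?B\<^esub>" for x
    by (simp add: specialization_iso_def)
  \<comment> \<open>A map from the specialization of M' back to \<open>M\<close>. It recovers h(v)
    from v \<otimes> 1, so equal pure tensors have equal evaluations.\<close>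
  obtain g where g: "\<And>v P. v \<in> carrier V \<Longrightarrow> P \<in> carrier ?B \<Longrightarrow> g (Q.pt v P) = \<epsilon> P \<odot>\<^bsub>M\<^esub> h v"
  proof (rule Q.BC_universal[of M "\<lambda>v P. \<epsilon> P \<odot>\<^bsub>M\<^esub> h v"])
    show "abelian_group M" by (rule M.abelian_group_axioms)
    fix v P assume v: "v \<in> carrier V" and P: "P \<in> carrier ?B"
    obtain p where p: "p \<in> carrier S" "P = ?\<phi> p" using B_cases[OF P] by blast
    show "\<epsilon> P \<odot>\<^bsub>M\<^esub> h v \<in> carrier M" using p v h_closed \<alpha> by (simp add: eps)
    show "\<epsilon> P \<odot>\<^bsub>M\<^esub> h (f \<odot>\<^bsub>V\<^esub> v) = \<epsilon> (?\<phi> f \<otimes>\<^bsub>?B\<^esub> P) \<odot>\<^bsub>M\<^esub> h v" if f: "f \<in> carrier S" for f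
    proof -
      have "\<epsilon> (?\<phi> f \<otimes>\<^bsub>?B\<^esub> P) = ev \<alpha> f \<otimes>\<^bsub>R\<^esub> ev \<alpha> p"
        using eps[of "f \<otimes>\<^bsub>S\<^esub> p"] ring_hom_mult[OF proj f p(1)] p f by (simp add: ev_mult[OF \<alpha>])
      then show ?thesis using p v f h_closed \<alpha> by (simp add: eps h_smult M.smult_assoc1 M.smult_lcomm)
    qed
    show "\<epsilon> P \<odot>\<^bsub>M\<^esub> h (v \<oplus>\<^bsub>V\<^esub> w) = \<epsilon> P \<odot>\<^bsub>M\<^esub> h v \<oplus>\<^bsub>M\<^esub> \<epsilon> P \<odot>\<^bsub>M\<^esub> h w" if "w \<in> carrier V" for w
      using p v that h_closed \<alpha> by (simp add: eps h_add M.smult_r_distr)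
    show "\<epsilon> (P \<oplus>\<^bsub>?B\<^esub> P') \<odot>\<^bsub>M\<^esub> h v = \<epsilon> P \<odot>\<^bsub>M\<^esub> h v \<oplus>\<^bsub>M\<^esub> \<epsilon> P' \<odot>\<^bsub>M\<^esub> h v" if P': "P' \<in> carrier ?B" for P'
    proof -
      obtain p' where p': "p' \<in> carrier S" "P' = ?\<phi> p'" using B_cases[OF P'] by blast
      have "\<epsilon> (P \<oplus>\<^bsub>?B\<^esub> P') = ev \<alpha> p \<oplus>\<^bsub>R\<^esub> ev \<alpha> p'"
        using eps[of "p \<oplus>\<^bsub>S\<^esub> p'"] ring_hom_add[OF proj p(1) p'(1)] p p' by (simp add: ev_add[OF \<alpha>])
      then show ?thesis using p p' v h_closed \<alpha> by (simp add: eps M.smult_l_distr)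
    qed
  qed blast
  have "\<epsilon> \<one>\<^bsub>?B\<^esub> = \<one>\<^bsub>R\<^esub>" using eps[OF S.one_closed] ring_hom_one[OF proj] ev_one[OF \<alpha>] by simp
  then have g1: "g (Q.pt v \<one>\<^bsub>?B\<^esub>) = h v" if "v \<in> carrier V" for v
    using g[OF that B.one_closed] h_closed[OF that] by simp
  \<comment> \<open>The kernel of v to v \<otimes> 1 contains (z - \<alpha>)M', so
    \<open>minus_tens_mem\<close> applies with it in place of \<open>K\<close>.\<close>
  define Z where "Z = {v \<in> carrier V. Q.pt v \<one>\<^bsub>?B\<^esub> = \<zero>\<^bsub>Q.BC\<^esub>}"
  have pt_diff: "Q.pt (v \<ominus>\<^bsub>V\<^esub> w) \<one>\<^bsub>?B\<^esub> = Q.pt v \<one>\<^bsub>?B\<^esub> \<ominus>\<^bsub>Q.BC\<^esub> Q.pt w \<one>\<^bsub>?B\<^esub>"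
    if "v \<in> carrier V" "w \<in> carrier V" for v w
  proof -
    have "Q.pt v \<one>\<^bsub>?B\<^esub> = Q.pt (v \<ominus>\<^bsub>V\<^esub> w) \<one>\<^bsub>?B\<^esub> \<oplus>\<^bsub>Q.BC\<^esub> Q.pt w \<one>\<^bsub>?B\<^esub>"
      using Q.pt_add_left[of "v \<ominus>\<^bsub>V\<^esub> w" w "\<one>\<^bsub>?B\<^esub>"] that by (simp add: V.M.minus_eq V.M.a_assoc V.M.l_neg)
    then show ?thesis using that by (simp add: QV.M.minus_eq QV.M.a_assoc QV.M.r_neg)
  qed
  have pt_smult: "Q.pt (f \<odot>\<^bsub>V\<^esub> v) \<one>\<^bsub>?B\<^esub> = ?\<phi> f \<odot>\<^bsub>Q.BC\<^esub> Q.pt v \<one>\<^bsub>?B\<^esub>"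
    if "f \<in> carrier S" "v \<in> carrier V" for f v
    using Q.pt_balance[OF that, of "\<one>\<^bsub>?B\<^esub>"] Q.smult_pt[OF that(2), of "?\<phi> f" "\<one>\<^bsub>?B\<^esub>"] that by simp
  have Z: "V.closed_sub (carrier S) Z"
  proof (rule V.closed_subI)
    have "Q.pt \<zero>\<^bsub>V\<^esub> \<one>\<^bsub>?B\<^esub> \<oplus>\<^bsub>Q.BC\<^esub> Q.pt \<zero>\<^bsub>V\<^esub> \<one>\<^bsub>?B\<^esub> = Q.pt \<zero>\<^bsub>V\<^esub> \<one>\<^bsub>?B\<^esub>"
      using Q.pt_add_left[of "\<zero>\<^bsub>V\<^esub>" "\<zero>\<^bsub>V\<^esub>" "\<one>\<^bsub>?B\<^esub>"] by simp
    then show "\<zero>\<^bsub>V\<^esub> \<in> Z" by (simp add: Z_def)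
    show "v \<ominus>\<^bsub>V\<^esub> w \<in> Z" if "v \<in> Z" "w \<in> Z" for v w
      using that by (simp add: Z_def pt_diff) (simp add: QV.M.minus_eq QV.M.r_neg)
    show "f \<odot>\<^bsub>V\<^esub> v \<in> Z" if "f \<in> carrier S" "v \<in> Z" for f v
      using that by (simp add: Z_def pt_smult)
  qed (simp add: Z_def)
  have zZ: "shift \<alpha> i \<odot>\<^bsub>V\<^esub> v \<in> Z" if i: "i < t" and v: "v \<in> carrier V" for i v
  proof -
    have "?\<phi> (shift \<alpha> i) = \<zero>\<^bsub>?B\<^esub>"
      using I.a_rcos_const[OF shift_in_point_ideal[OF i]] by (simp add: FactRing_def)
    then show ?thesis using i v \<alpha> by (simp add: Z_def pt_smult)
  qed
  have pt_h: "Q.pt v \<one>\<^bsub>?B\<^esub> = Q.pt (tens (h v) \<one>\<^bsub>S\<^esub>) \<one>\<^bsub>?B\<^esub>" if v: "v \<in> carrier V" for v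
  proof -
    have "v \<ominus>\<^bsub>V\<^esub> tens (h v) \<one>\<^bsub>S\<^esub> \<in> Z" by (rule minus_tens_mem[OF Z zZ v])
    then have "Q.pt v \<one>\<^bsub>?B\<^esub> \<ominus>\<^bsub>Q.BC\<^esub> Q.pt (tens (h v) \<one>\<^bsub>S\<^esub>) \<one>\<^bsub>?B\<^esub> = \<zero>\<^bsub>Q.BC\<^esub>"
      using v h_closed[OF v] by (simp add: Z_def pt_diff)
    then have "Q.pt v \<one>\<^bsub>?B\<^esub> \<ominus>\<^bsub>Q.BC\<^esub> Q.pt (tens (h v) \<one>\<^bsub>S\<^esub>) \<one>\<^bsub>?B\<^esub> \<oplus>\<^bsub>Q.BC\<^esub> Q.pt (tens (h v) \<one>\<^bsub>S\<^esub>) \<one>\<^bsub>?B\<^esub>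
        = Q.pt (tens (h v) \<one>\<^bsub>S\<^esub>) \<one>\<^bsub>?B\<^esub>"
      using h_closed[OF v] by simp
    then show ?thesis using v h_closed[OF v] by (simp add: QV.M.minus_eq QV.M.a_assoc QV.M.l_neg)
  qed
  show ?thesis
  proof
    show "specialized_submodule R t \<alpha> M N \<subseteq> h ` N"
    proof
      fix x assume "x \<in> specialized_submodule R t \<alpha> M N"
      then obtain n where x: "x \<in> carrier M" and n: "n \<in> N" "Q.pt (tens x \<one>\<^bsub>S\<^esub>) \<one>\<^bsub>?B\<^esub> = Q.pt n \<one>\<^bsub>?B\<^esub>"
        unfolding specialized_submodule_def iso spec by auto
      have "h (tens x \<one>\<^bsub>S\<^esub>) = h n" using g1[of "tens x \<one>\<^bsub>S\<^esub>"] g1[of n] n NV x by auto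
      then show "x \<in> h ` N" using h_tens_one[OF x] n(1) by auto
    qed
    show "h ` N \<subseteq> specialized_submodule R t \<alpha> M N"
    proof
      fix x assume "x \<in> h ` N"
      then obtain n where n: "n \<in> N" "x = h n" by auto
      then have "n \<in> carrier V" using NV by auto
      then show "x \<in> specialized_submodule R t \<alpha> M N"
        unfolding specialized_submodule_def iso spec using pt_h[of n] n h_closed[of n] by auto
    qed
  qed
qed

subsection \<open>Length bounds\<close>

text \<open>One application of \<open>sat_chain_step\<close> per variable keeps the number of steps.
  In the end every member contains (z - \<alpha>)M', hence the kernel of h, and distinct members
  have distinct images in \<open>M\<close>.\<close>

lemma length_lower_bound:
  assumes C: "V.sat_chain (nonvan 0 \<alpha>) (carrier V) d C" "N \<subseteq> C 0"
  shows "has_chain R M (h ` N) d"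
proof -
  have VV: "V.closed_sub (carrier S) (carrier V)" using V.carrier_is_submodule by (simp add: V.submodule_iff)
  have "\<exists>C. V.sat_chain (nonvan i \<alpha>) (carrier V) d C \<and> N \<subseteq> C 0 \<and> (\<forall>j<i. \<forall>v\<in>carrier V. shift \<alpha> j \<odot>\<^bsub>V\<^esub> v \<in> C 0)"
    if "i \<le> t" for i
    using that
  proof (induction i)
    case 0
    then show ?case using C by auto
  next
    case (Suc i)
    then obtain C' where C': "V.sat_chain (nonvan i \<alpha>) (carrier V) d C'" "N \<subseteq> C' 0"
      "\<And>j v. j < i \<Longrightarrow> v \<in> carrier V \<Longrightarrow> shift \<alpha> j \<odot>\<^bsub>V\<^esub> v \<in> C' 0" by auto
    have i: "i < t" using Suc.prems by simp
    \<comment> \<open>With \<open>C' 0\<close> in the role of \<open>N\<close>, the new bottom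
      member keeps both \<open>N\<close> and the multiples gathered so far.\<close>
    obtain E where "V.sat_chain (nonvan (Suc i) \<alpha>) (carrier V) d E" "C' 0 \<subseteq> E 0"
      "\<And>v. v \<in> carrier V \<Longrightarrow> shift \<alpha> i \<odot>\<^bsub>V\<^esub> v \<in> E 0"
      using V.sat_chain_step[OF V_acc nonvan_mult_set[OF \<alpha>] nonvan_mult_set[OF \<alpha>] nonvan_Suc_subset
          shift_nonvan[OF \<alpha> i] nonvan_minus_shift[OF \<alpha> i] VV C'(1) order_refl] by blast
    then show ?case using C'(2,3) by (intro exI[of _ E]) (auto simp: less_Suc_eq)
  qed
  from this[OF order_refl] obtain C where C: "V.sat_chain (nonvan t \<alpha>) (carrier V) d C" "N \<subseteq> C 0"
    "\<And>j v. j < t \<Longrightarrow> v \<in> carrier V \<Longrightarrow> shift \<alpha> j \<odot>\<^bsub>V\<^esub> v \<in> C 0" by blast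
  note CD = V.sat_chainD[OF C(1)]
  have C0: "C 0 \<subseteq> C i" if "i \<le> d" for i using V.sat_chain_mono[OF C(1) _ that, of 0] by simp
  show ?thesis
    unfolding has_chain_def
  proof (intro exI[of _ "\<lambda>i. h ` C i"] conjI allI impI)
    fix i assume i: "i \<le> d"
    show "submodule (h ` C i) R M" using image_submodule[OF CD(1)[OF i]] by (simp add: M.submodule_iff)
    show "h ` N \<subseteq> h ` C i" using C(2) C0[OF i] by blast
  next
    fix i assume i: "i < d"
    obtain v where v: "v \<in> C (Suc i)" "v \<notin> C i" using CD(4)[OF i] by auto
    have vV: "v \<in> carrier V" using CD(2)[of "Suc i"] i v by auto
    have Ci: "V.closed_sub (carrier S) (C i)" using CD(1) i by simp
    have "h v \<notin> h ` C i"
    proof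
      assume "h v \<in> h ` C i"
      then obtain w where w: "w \<in> C i" "h v = h w" by auto
      have wV: "w \<in> carrier V" using V.closed_subD(1)[OF Ci w(1)] .
      have "h (v \<ominus>\<^bsub>V\<^esub> w) = \<zero>\<^bsub>M\<^esub>" using h_diff[OF vV wV] w(2) h_closed[OF wV] by (simp add: M.minus_eq M.r_neg)
      moreover have "v \<ominus>\<^bsub>V\<^esub> w \<ominus>\<^bsub>V\<^esub> tens (h (v \<ominus>\<^bsub>V\<^esub> w)) \<one>\<^bsub>S\<^esub> \<in> C i"
        by (rule minus_tens_mem[OF Ci]) (use C(3) C0[of i] i vV wV in auto)
      ultimately have "v \<ominus>\<^bsub>V\<^esub> w \<in> C i"
        using V.minus_cancel_right[of "v \<ominus>\<^bsub>V\<^esub> w" "\<zero>\<^bsub>V\<^esub>"] vV wV by (simp add: tens_zero)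
      from V.closed_sub_add[OF Ci this w(1)] have "v \<in> C i" using vV wV by (simp add: V.M.minus_eq V.M.a_assoc V.M.l_neg)
      then show False using v(2) by simp
    qed
    then show "h ` C i \<subset> h ` C (Suc i)" using v(1) CD(4)[OF i] by blast
  qed
qed

end

text \<open>On generators of \<mm> and of \<open>M\<close> the series amounts to finitely many
  relations, and f is the product of their denominators. Where f(\<alpha>) is outside \<mm>, the
  evaluated series meets the hypotheses of \<open>chain_length_le\<close>.\<close>

lemma length_upper_bound:
  assumes N: "V.closed_sub (carrier S) N"
    and C: "V.sat_chain (nonvan 0 \<alpha>0) (carrier V) d C" "N \<subseteq> C 0"
    and max: "\<And>D. V.sat_chain (nonvan 0 \<alpha>0) (carrier V) (Suc d) D \<Longrightarrow> \<not> N \<subseteq> D 0"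
    and \<alpha>0: "\<alpha>0 \<in> vecs"
  obtains f where "f \<in> nonvan 0 \<alpha>0"
    "\<And>\<alpha> h. \<alpha> \<in> vecs \<Longrightarrow> evaluation \<alpha> h \<Longrightarrow> ev \<alpha> f \<notin> \<mm> \<Longrightarrow> \<not> has_chain R M (h ` N) (Suc d)"
proof -
  let ?W = "nonvan 0 \<alpha>0"
  note W = nonvan_mult_set[OF \<alpha>0, of 0]
  obtain x where x: "\<And>i. i < d \<Longrightarrow> x i \<in> carrier V"
    "\<And>i. i \<le> d \<Longrightarrow> V.closed_sub (carrier S) (V.adjoins N x i)"
    "\<And>i m. i < d \<Longrightarrow> m \<in> carrier S \<Longrightarrow> (\<And>w r. w \<in> ?W \<Longrightarrow> r \<in> carrier S \<Longrightarrow> w \<ominus>\<^bsub>S\<^esub> r \<otimes>\<^bsub>S\<^esub> m \<in> ?W)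
        \<Longrightarrow> m \<odot>\<^bsub>V\<^esub> x i \<in> V.saturation ?W (carrier V) (V.adjoins N x i)"
    "V.saturation ?W (carrier V) (V.adjoins N x d) = carrier V"
    by (rule V.composition_elements[OF W N C], erule max, blast)
  define K where "K i = V.adjoins N x i" for i
  have K: "V.closed_sub (carrier S) (K i)" if "i \<le> d" for i unfolding K_def by (rule x(2)[OF that])
  obtain A where A: "A \<subseteq> carrier R" "finite A" "\<mm> = Idl\<^bsub>R\<^esub> A" using R.finetely_gen[OF R.is_ideal] by blast
  have Am: "A \<subseteq> \<mm>" using R.genideal_self[OF A(1)] A(3) by simp
  obtain G where G: "finite G" "G \<subseteq> carrier M" "\<And>H. submodule H R M \<Longrightarrow> G \<subseteq> H \<Longrightarrow> H = carrier M"
    using M_fg unfolding finitely_generated_module_def by blast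
  have 1: "\<exists>w\<in>?W. \<forall>m\<in>A. w \<odot>\<^bsub>V\<^esub> (const m \<odot>\<^bsub>V\<^esub> x i) \<in> K i" if i: "i < d" for i
  proof -
    have "const m \<odot>\<^bsub>V\<^esub> x i \<in> V.saturation ?W (carrier V) (K i)" if m: "m \<in> A" for m
      unfolding K_def by (rule x(3)[OF i]) (use m A Am nonvan_minus_m[OF \<alpha>0] in auto)
    then have "(\<lambda>m. const m \<odot>\<^bsub>V\<^esub> x i) ` A \<subseteq> V.saturation ?W (carrier V) (K i)" by blast
    from V.common_denominator[OF W K _ this] A(2) i show ?thesis by auto
  qed
  have 2: "\<exists>w\<in>?W. \<forall>g\<in>G. w \<odot>\<^bsub>V\<^esub> tens g \<one>\<^bsub>S\<^esub> \<in> K d"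
  proof -
    have "(\<lambda>g. tens g \<one>\<^bsub>S\<^esub>) ` G \<subseteq> V.saturation ?W (carrier V) (K d)" unfolding K_def x(4) using G(2) by auto
    from V.common_denominator[OF W K _ this] G(1) show ?thesis by auto
  qed
  have WS: "w \<in> carrier S" if "w \<in> ?W" for w using V.mult_setD(1)[OF W that] .
  \<comment> \<open>The denominators found for each index separately are multiplied
    together.\<close>
  have 3: "\<exists>w\<in>?W. \<forall>i<n. \<forall>m\<in>A. w \<odot>\<^bsub>V\<^esub> (const m \<odot>\<^bsub>V\<^esub> x i) \<in> K i" if "n \<le> d" for n
    using that
  proof (induction n)
    case 0
    then show ?case using V.mult_setD(2)[OF W] by auto
  next
    case (Suc n)
    then obtain w where w: "w \<in> ?W" "\<And>i m. i < n \<Longrightarrow> m \<in> A \<Longrightarrow> w \<odot>\<^bsub>V\<^esub> (const m \<odot>\<^bsub>V\<^esub> x i) \<in> K i" by auto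
    obtain u where u: "u \<in> ?W" "\<And>m. m \<in> A \<Longrightarrow> u \<odot>\<^bsub>V\<^esub> (const m \<odot>\<^bsub>V\<^esub> x n) \<in> K n" using 1[of n] Suc.prems by auto
    have "(w \<otimes>\<^bsub>S\<^esub> u) \<odot>\<^bsub>V\<^esub> (const m \<odot>\<^bsub>V\<^esub> x i) \<in> K i" if i: "i < Suc n" and m: "m \<in> A" for i m
    proof -
      have id: "i < d" "i \<le> d" using i Suc.prems by auto
      have mR: "m \<in> carrier R" using A(1) m by auto
      have y: "const m \<odot>\<^bsub>V\<^esub> x i \<in> carrier V" using mR x(1)[OF id(1)] by simp
      show ?thesis
      proof (cases "i = n")
        case True
        have "w \<odot>\<^bsub>V\<^esub> (u \<odot>\<^bsub>V\<^esub> (const m \<odot>\<^bsub>V\<^esub> x i)) \<in> K i"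
          using V.closed_subD(4)[OF K[OF id(2)] WS[OF w(1)]] u(2)[OF m] True by simp
        then show ?thesis using V.smult_assoc1[OF WS[OF w(1)] WS[OF u(1)] y] by simp
      next
        case False
        then have "u \<odot>\<^bsub>V\<^esub> (w \<odot>\<^bsub>V\<^esub> (const m \<odot>\<^bsub>V\<^esub> x i)) \<in> K i"
          using V.closed_subD(4)[OF K[OF id(2)] WS[OF u(1)]] w(2)[OF _ m, of i] i by simp
        then show ?thesis
          using V.smult_assoc1[OF WS[OF w(1)] WS[OF u(1)] y] V.smult_lcomm[OF WS[OF w(1)] WS[OF u(1)] y] by simp
      qed
    qed
    then show ?case using V.mult_setD(3)[OF W w(1) u(1)] by blast
  qed
  obtain w where w: "w \<in> ?W" "\<And>i m. i < d \<Longrightarrow> m \<in> A \<Longrightarrow> w \<odot>\<^bsub>V\<^esub> (const m \<odot>\<^bsub>V\<^esub> x i) \<in> K i" using 3[OF order_refl] by auto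
  obtain u where u: "u \<in> ?W" "\<And>g. g \<in> G \<Longrightarrow> u \<odot>\<^bsub>V\<^esub> tens g \<one>\<^bsub>S\<^esub> \<in> K d" using 2 by auto
  interpret P: primeideal \<mm> R by (rule prime_m)
  have no_chain: "\<not> has_chain R M (h ` N) (Suc d)"
    if \<alpha>: "\<alpha> \<in> vecs" and h: "evaluation \<alpha> h" and nz: "ev \<alpha> (w \<otimes>\<^bsub>S\<^esub> u) \<notin> \<mm>" for \<alpha> h
  proof
    note hc = h_closed[OF \<alpha> h] and hs = h_smult[OF \<alpha> h]
    have ewR: "ev \<alpha> w \<in> carrier R" "ev \<alpha> u \<in> carrier R" using WS w(1) u(1) \<alpha> by auto
    have "ev \<alpha> w \<notin> \<mm>" "ev \<alpha> u \<notin> \<mm>"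
      using nz ewR R.I_r_closed[of "ev \<alpha> w" "ev \<alpha> u"] R.I_l_closed[of "ev \<alpha> u" "ev \<alpha> w"] WS[OF w(1)] WS[OF u(1)]
      by (auto simp: ev_mult[OF \<alpha>])
    \<comment> \<open>Outside \<mm> the evaluated denominators are units, so relations that held up
      to a denominator hold outright in \<open>M\<close>.\<close>
    then have units: "ev \<alpha> w \<in> Units R" "ev \<alpha> u \<in> Units R" using R.unit_if_notin ewR by auto
    have cancel: "y \<in> H" if "r \<in> Units R" "M.closed_sub (carrier R) H" "y \<in> carrier M" "r \<odot>\<^bsub>M\<^esub> y \<in> H" for r y H
    proof -
      have "inv\<^bsub>R\<^esub> r \<odot>\<^bsub>M\<^esub> (r \<odot>\<^bsub>M\<^esub> y) \<in> H" using M.closed_subD(4)[OF that(2) _ that(4)] that(1) by simp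
      then show ?thesis using that(1,3) R.Units_closed[OF that(1)] by (simp add: M.smult_assoc1[symmetric])
    qed
    define Q where "Q i = h ` K i" for i
    have Q: "M.closed_sub (carrier R) (Q i)" if "i \<le> d" for i
      unfolding Q_def by (rule image_submodule[OF \<alpha> h K[OF that]])
    have Qsuc: "Q (Suc i) \<subseteq> M.adjoin (Q i) (h (x i))" if i: "i < d" for i
    proof
      fix y assume "y \<in> Q (Suc i)"
      then obtain v where v: "v \<in> V.adjoin (K i) (x i)" "y = h v" by (auto simp: Q_def K_def)
      then obtain k r where k: "k \<in> K i" "r \<in> carrier S" "v = k \<oplus>\<^bsub>V\<^esub> r \<odot>\<^bsub>V\<^esub> x i" by (auto simp: V.adjoin_def)
      have kV: "k \<in> carrier V" using V.closed_subD(1)[OF K k(1)] i by simp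
      have "y = h k \<oplus>\<^bsub>M\<^esub> ev \<alpha> r \<odot>\<^bsub>M\<^esub> h (x i)"
        unfolding v(2) k(3) using h_add[OF \<alpha> h kV, of "r \<odot>\<^bsub>V\<^esub> x i"] hs[OF k(2) x(1)[OF i]] x(1)[OF i] k(2) by simp
      then show "y \<in> M.adjoin (Q i) (h (x i))"
        unfolding M.adjoin_def Q_def using k(1) ev_closed[OF \<alpha> k(2)] by blast
    qed
    have Qd: "Q d = carrier M"
    proof (rule G(3))
      show "submodule (Q d) R M" using Q[OF order_refl] by (simp add: M.submodule_iff)
      show "G \<subseteq> Q d"
      proof
        fix g assume g: "g \<in> G"
        then have gM: "g \<in> carrier M" using G(2) by auto
        have "h (u \<odot>\<^bsub>V\<^esub> tens g \<one>\<^bsub>S\<^esub>) \<in> Q d" using u(2)[OF g] by (simp add: Q_def)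
        then have "ev \<alpha> u \<odot>\<^bsub>M\<^esub> g \<in> Q d" using hs[OF WS[OF u(1)], of "tens g \<one>\<^bsub>S\<^esub>"] gM h_tens_one[OF \<alpha> h gM] by simp
        then show "g \<in> Q d" using cancel[OF units(2) Q[OF order_refl] gM] by simp
      qed
    qed
    have mQ: "r \<odot>\<^bsub>M\<^esub> h (x i) \<in> Q i" if i: "i < d" and r: "r \<in> \<mm>" for i r
    proof -
      have id: "i \<le> d" using i by simp
      note QD = M.closed_subD[OF Q[OF id]]
      have hx: "h (x i) \<in> carrier M" using hc x(1)[OF i] by simp
      have gen: "m \<odot>\<^bsub>M\<^esub> h (x i) \<in> Q i" if m: "m \<in> A" for m
      proof -
        have mR: "m \<in> carrier R" using A(1) m by auto
        have "h (w \<odot>\<^bsub>V\<^esub> (const m \<odot>\<^bsub>V\<^esub> x i)) \<in> Q i" using w(2)[OF i m] by (simp add: Q_def)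
        then have "ev \<alpha> w \<odot>\<^bsub>M\<^esub> (m \<odot>\<^bsub>M\<^esub> h (x i)) \<in> Q i"
          using hs[OF WS[OF w(1)], of "const m \<odot>\<^bsub>V\<^esub> x i"] hs[OF const_closed[OF mR] x(1)[OF i]] x(1)[OF i] mR
          by (simp add: ev_const[OF \<alpha>])
        then show ?thesis using cancel[OF units(1) Q[OF id]] hx mR by simp
      qed
      \<comment> \<open>The relation is known for generators of \<mm> only; the elements r with r
        h(x_i) in \<open>Q i\<close> form an ideal, which therefore contains \<mm>.\<close>
      define J where "J = {r \<in> carrier R. r \<odot>\<^bsub>M\<^esub> h (x i) \<in> Q i}"
      have zJ: "\<zero>\<^bsub>R\<^esub> \<in> J" using hx QD(2) by (simp add: J_def)
      have dJ: "a \<ominus>\<^bsub>R\<^esub> b \<in> J" if "a \<in> J" "b \<in> J" for a b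
        using that QD(3) hx by (simp add: J_def M.smult_l_diff)
      have nJ: "\<ominus>\<^bsub>R\<^esub> a \<in> J" if "a \<in> J" for a
        using dJ[OF zJ that] that by (simp add: J_def R.minus_eq)
      have "ideal J R"
      proof (rule idealI[OF R.ring_axioms])
        show "subgroup J (add_monoid R)"
        proof (rule group.subgroupI[OF R.add.is_group])
          show "J \<subseteq> carrier (add_monoid R)" by (auto simp: J_def)
          show "J \<noteq> {}" using zJ by auto
          show "inv\<^bsub>add_monoid R\<^esub> a \<in> J" if "a \<in> J" for a using nJ[OF that] by (simp add: a_inv_def)
          show "a \<otimes>\<^bsub>add_monoid R\<^esub> b \<in> J" if "a \<in> J" "b \<in> J" for a b
            using dJ[OF that(1) nJ[OF that(2)]] that by (simp add: J_def R.minus_eq)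
        qed
        fix a b assume ab: "a \<in> J" "b \<in> carrier R"
        then show "b \<otimes>\<^bsub>R\<^esub> a \<in> J" using QD(4)[OF ab(2), of "a \<odot>\<^bsub>M\<^esub> h (x i)"] hx by (simp add: J_def M.smult_assoc1)
        then show "a \<otimes>\<^bsub>R\<^esub> b \<in> J" using ab R.m_comm[of a b] by (simp add: J_def)
      qed
      moreover have "A \<subseteq> J" using gen A(1) by (auto simp: J_def)
      ultimately have "\<mm> \<subseteq> J" using R.genideal_minimal A(3) by simp
      then show ?thesis using r by (auto simp: J_def)
    qed
    assume "has_chain R M (h ` N) (Suc d)"
    then obtain D where D: "\<And>i. i \<le> Suc d \<Longrightarrow> M.closed_sub (carrier R) (D i)" "\<And>i. i \<le> Suc d \<Longrightarrow> h ` N \<subseteq> D i"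
      "\<And>i. i < Suc d \<Longrightarrow> D i \<subset> D (Suc i)"
      unfolding has_chain_def M.submodule_iff by auto
    have "Q 0 \<subseteq> D 0" using D(2)[of 0] by (simp add: Q_def K_def)
    from M.chain_length_le[where \<mm> = \<mm> and n = "Suc d", OF R.unit_if_notin Q Qsuc Qd hc[OF x(1)] mQ D(1) D(3) this]
    show False by simp
  qed
  show thesis
    by (rule that[OF V.mult_setD(3)[OF W w(1) u(1)] no_chain])
qed

end

theorem lemma2p4:
  fixes R :: "('a, 'r) ring_scheme" and \<mm> :: "'a set" and t \<delta> :: nat
    and M :: "('a, 'b, 'm) module_scheme"
    and N' :: "('b \<times> (nat multiset \<Rightarrow> 'a) \<Rightarrow>\<^sub>0 int) set set"
  assumes "noetherian_local_ring \<mm> R"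
    and "infinite (carrier (R Quot \<mm>))"
    and "module R M"
    and "finitely_generated_module R M"
    and "submodule N' (mpoly_ring R t) (poly_module R t M)"
    and "let S = mpoly_ring R t; mS = extended_ideal R t \<mm>; M' = poly_module R t M in
           module_length (localized_ring S mS)
             (quot_module (localized_module S mS M') (localized_submodule S mS M' N')) = enat \<delta>"
  shows "general_vector R \<mm> t (\<lambda>\<alpha>.
             module_length R (quot_module M (specialized_submodule R t \<alpha> M N')) = enat \<delta>)
         \<and>
         (equicharacteristic R \<mm> \<longrightarrow>
           (\<forall>\<alpha>0\<in>vectors R t. general_vector R \<mm> t (\<lambda>\<alpha>.
             enat \<delta> = module_length R (quot_module M (specialized_submodule R t \<alpha> M N')) \<and>
             module_length R (quot_module M (specialized_submodule R t \<alpha> M N'))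
               \<le> module_length R (quot_module M (specialized_submodule R t \<alpha>0 M N')))))"
proof -
  interpret specialization_setup \<mm> R t M
    by (rule specialization_setup.intro) (rule assms)+
  have N: "V.closed_sub (carrier S) N'" using assms(5) by (simp add: V.submodule_iff)
  define z where "z = (\<lambda>i\<in>{..<t}. \<zero>\<^bsub>R\<^esub>)"
  have z: "z \<in> vecs" by (auto simp: z_def vectors_def)
  let ?W = "nonvan 0 z"
  have "(\<exists>C. V.sat_chain ?W (carrier V) \<delta> C \<and> N' \<subseteq> C 0) \<and>
     (\<forall>C. V.sat_chain ?W (carrier V) (Suc \<delta>) C \<longrightarrow> \<not> N' \<subseteq> C 0)"
    using assms(6) V.localized_length_eq[OF nonvan_0 nonvan_mult_set[OF z] N] by (simp add: Let_def)
  then obtain C where C: "V.sat_chain ?W (carrier V) \<delta> C" "N' \<subseteq> C 0"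
    and max: "\<And>D. V.sat_chain ?W (carrier V) (Suc \<delta>) D \<Longrightarrow> \<not> N' \<subseteq> D 0" by blast
  obtain f where f: "f \<in> ?W"
    and up: "\<And>\<alpha> h. \<alpha> \<in> vecs \<Longrightarrow> evaluation \<alpha> h \<Longrightarrow> ev \<alpha> f \<notin> \<mm> \<Longrightarrow> \<not> has_chain R M (h ` N') (Suc \<delta>)"
    by (rule length_upper_bound[OF N C], erule max, rule z, blast)
  have spec: "submodule (specialized_submodule R t \<alpha> M N') R M"
      "has_chain R M (specialized_submodule R t \<alpha> M N') \<delta>"
      "ev \<alpha> f \<notin> \<mm> \<Longrightarrow> \<not> has_chain R M (specialized_submodule R t \<alpha> M N') (Suc \<delta>)"
    if \<alpha>: "\<alpha> \<in> vecs" for \<alpha>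
  proof -
    obtain h where h: "evaluation \<alpha> h" by (rule evaluation_exists[OF \<alpha>])
    note eq = specialized_submodule_eq[OF \<alpha> h assms(5)]
    \<comment> \<open>Because of this equality the single chain \<open>C\<close> gives the lower
      bound at every vector, although it was found with the zero vector.\<close>
    have W: "nonvan 0 \<alpha> = ?W" by (simp add: nonvan_0)
    show "submodule (specialized_submodule R t \<alpha> M N') R M"
      unfolding eq M.submodule_iff by (rule image_submodule[OF \<alpha> h N])
    show "has_chain R M (specialized_submodule R t \<alpha> M N') \<delta>"
      unfolding eq by (rule length_lower_bound[OF \<alpha> h, of \<delta> C]) (use C W in auto)
    show "\<not> has_chain R M (specialized_submodule R t \<alpha> M N') (Suc \<delta>)" if "ev \<alpha> f \<notin> \<mm>"
      unfolding eq by (rule up[OF \<alpha> h that])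
  qed
  have generic: "module_length R (quot_module M (specialized_submodule R t \<alpha> M N')) = enat \<delta>"
    if "\<alpha> \<in> vecs" "ev \<alpha> f \<notin> \<mm>" for \<alpha>
    using additive_action.quot_length_eq[OF M.additive_action spec(1)[OF that(1)], of \<delta>]
      spec(2)[OF that(1)] spec(3)[OF that] by simp
  have every: "enat \<delta> \<le> module_length R (quot_module M (specialized_submodule R t \<alpha> M N'))"
    if "\<alpha> \<in> vecs" for \<alpha>
    using additive_action.quot_length_ge[OF M.additive_action spec(1)[OF that] spec(2)[OF that]] .
  \<comment> \<open>Membership of f among the denominators supplies a vector with f outside \<mm>,
    so the open set defined by f is nonempty.\<close>
  obtain \<beta> where fS: "f \<in> carrier S" and \<beta>: "\<beta> \<in> vecs" "ev \<beta> f \<notin> \<mm>"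
    using f by (auto simp: nonvan_def)
  note general = R.general_vectorI[OF R.maximalideal_axioms infinite_residue fS \<beta>]
  show ?thesis
  proof (intro conjI impI ballI)
    show "general_vector R \<mm> t (\<lambda>\<alpha>. module_length R (quot_module M (specialized_submodule R t \<alpha> M N')) = enat \<delta>)"
      by (rule general) (rule generic)
    \<comment> \<open>The open set of the first part serves again: the length is \<delta> on it, and
      the lower bound holds at \<alpha>0 as at any vector.\<close>
    fix \<alpha>0 assume \<alpha>0: "\<alpha>0 \<in> vecs"
    show "general_vector R \<mm> t (\<lambda>\<alpha>.
        enat \<delta> = module_length R (quot_module M (specialized_submodule R t \<alpha> M N')) \<and>
        module_length R (quot_module M (specialized_submodule R t \<alpha> M N'))
          \<le> module_length R (quot_module M (specialized_submodule R t \<alpha>0 M N')))"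
      by (rule general) (simp add: generic every[OF \<alpha>0])
  qed
qed

end
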